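(* In the class of mean-payoff games, the Nash-checking problem, the deterministic Nash-checking problem, the subgame-perfect-checking problem and the deterministic subgame-perfect-checking problem can all be decided in polynomial time.
   Context: Games. A game $G=(\Pi,V,(V_i)_{i\in\Pi},E,\mu)$ consists of a finite set $\Pi$ of players, a finite directed graph $(V,E)$ in which every vertex has at least one outgoing edge, a partition $(V_i)_{i\in\Pi}$ of $V$ (parts may be empty; $V_i$ is controlled by $i$), and a payoff function $\mu=(\mu_i)_{i\in\Pi}$ mapping plays (infinite paths) to $\mathbb R^\Pi$. Histories are finite paths. $G_{\upharpoonright v_0}$ denotes the game with initial vertex $v_0$ (plays and histories start at $v_0$). It is a mean-payoff game if there are reward mappings $r_i:E\to\mathbb Q$ (encoded in binary) such that $\mu_i(\pi)=\liminf_n\frac1n\sum_{k<n}r_i(\pi_k\pi_{k+1})$ for every player $i$ and play $\pi$. Strategies and equilibria. A strategy $\sigma_i$ of player $i$ maps each history $hv$ from $v_0$ with $v\in V_i$ to a successor of $v$; a profile $\bar\sigma=(\sigma_i)_{i\in\Pi}$ has a unique compatible play, its outcome $\langle\bar\sigma\rangle$; $\bar\sigma(hv)=\sigma_i(hv)$ for $v\in V_i$. $\bar\sigma$ is a Nash equilibrium (NE) if $\mu_i(\langle\sigma'_i,\bar\sigma_{-i}\rangle)\le\mu_i(\langle\bar\sigma\rangle)$ for all $i,\sigma'_i$. It is a subgame-perfect equilibrium (SPE) if for each history $hv$ from $v_0$, the profile $h'\mapsto\bar\sigma(hh')$ is an NE in the game on the same arena from $v$ with payoff $\pi\mapsto\mu(h\pi)$.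 Mealy machines. A multiplayer Mealy machine for $\Pi$ on $G$ is $M=(Q,q_0,\Delta)$ with $Q$ finite, $q_0\in Q$, $\Delta\subseteq Q\times V\times Q\times V$, with $uv\in E$ for every $(p,u,q,v)\in\Delta$, and at least one transition $(p,u,q,v)$ for all $p\in Q$, $u\in V$; it is deterministic if there is exactly one for all $p,u$. $\bar\sigma\in\mathrm{Comp}_{\upharpoonright v_0}(M)$ if there is a map $h\mapsto q_h\in Q$ (on histories from $v_0$ and the empty history, the latter mapped to $q_0$) such that $(q_h,v,q_{hv},\bar\sigma(hv))\in\Delta$ for every history $hv$ from $v_0$. Problems. The (deterministic) Nash-checking (resp. subgame-perfect-checking) problem in a class $\mathcal C$ of games: given $G_{\upharpoonright v_0}\in\mathcal C$ and a (deterministic) multiplayer Mealy machine $M$ for $\Pi$ on $G$, is every $\bar\sigma\in\mathrm{Comp}_{\upharpoonright v_0}(M)$ an NE (resp. SPE)? *)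

theory Defs
  imports
    Complex_Main
    "HOL-Library.Extended_Real"
    "HOL-Library.Log_Nat"
    "HOL-Library.Omega_Words_Fun"
    "HOL-Computational_Algebra.Polynomial"
begin

section \<open>Games\<close>

text \<open>
  The partition \<open>(V\<^sub>i)\<close> of the vertices is given by the map \<open>owner\<close>: the part \<open>V\<^sub>i\<close> is
  \<open>{v \<in> verts G. owner G v = i}\<close> and may be empty. Plays are functions on the natural
  numbers; the values of \<open>payoff\<close> on sequences that are not plays are irrelevant.
\<close>

record ('i, 'v) game =
  players :: "'i set"
  verts :: "'v set"
  owner :: "'v \<Rightarrow> 'i"
  edges :: "('v \<times> 'v) set"
  payoff :: "'i \<Rightarrow> (nat \<Rightarrow> 'v) \<Rightarrow> real"

definition game :: "('i, 'v) game \<Rightarrow> bool" where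
  "game G \<longleftrightarrow>
     finite (players G) \<and> finite (verts G) \<and>
     edges G \<subseteq> verts G \<times> verts G \<and>
     (\<forall>u \<in> verts G. \<exists>v. (u, v) \<in> edges G) \<and>
     (\<forall>v \<in> verts G. owner G v \<in> players G)"

definition play :: "('i, 'v) game \<Rightarrow> (nat \<Rightarrow> 'v) \<Rightarrow> bool" where
  "play G \<pi> \<longleftrightarrow> (\<forall>n. (\<pi> n, \<pi> (Suc n)) \<in> edges G)"

definition history_from :: "('i, 'v) game \<Rightarrow> 'v \<Rightarrow> 'v list \<Rightarrow> bool" where
  "history_from G v\<^sub>0 h \<longleftrightarrow>
     h \<noteq> [] \<and> hd h = v\<^sub>0 \<and> successively (\<lambda>u v. (u, v) \<in> edges G) h"

definition mean_payoff_game :: "('i, 'v) game \<Rightarrow> ('i \<Rightarrow> 'v \<times> 'v \<Rightarrow> rat) \<Rightarrow> bool" where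
  "mean_payoff_game G r \<longleftrightarrow> game G \<and>
     (\<forall>i \<in> players G. \<forall>\<pi>. play G \<pi> \<longrightarrow>
        ereal (payoff G i \<pi>) =
        liminf (\<lambda>n. ereal (1 / real n * (\<Sum>k<n. of_rat (r i (\<pi> k, \<pi> (Suc k)))))))"


section \<open>Strategies and equilibria\<close>

text \<open>
  A strategy is applied to the whole history, whose last element is the current vertex;
  its values on other lists are irrelevant.
\<close>

type_synonym 'v strategy = "'v list \<Rightarrow> 'v"
type_synonym ('i, 'v) profile = "'i \<Rightarrow> 'v strategy"

definition strategy :: "('i, 'v) game \<Rightarrow> 'v \<Rightarrow> 'i \<Rightarrow> 'v strategy \<Rightarrow> bool" where
  "strategy G v\<^sub>0 i s \<longleftrightarrow>
     (\<forall>h v. history_from G v\<^sub>0 (h @ [v]) \<and> owner G v = i \<longrightarrow> (v, s (h @ [v])) \<in> edges G)"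

definition strategy_profile :: "('i, 'v) game \<Rightarrow> 'v \<Rightarrow> ('i, 'v) profile \<Rightarrow> bool" where
  "strategy_profile G v\<^sub>0 \<sigma> \<longleftrightarrow> (\<forall>i \<in> players G. strategy G v\<^sub>0 i (\<sigma> i))"

definition move :: "('i, 'v) game \<Rightarrow> ('i, 'v) profile \<Rightarrow> 'v list \<Rightarrow> 'v" where
  "move G \<sigma> h = \<sigma> (owner G (last h)) h"

primrec outcome_prefix :: "('i, 'v) game \<Rightarrow> 'v \<Rightarrow> ('i, 'v) profile \<Rightarrow> nat \<Rightarrow> 'v list" where
  "outcome_prefix G v\<^sub>0 \<sigma> 0 = [v\<^sub>0]"
| "outcome_prefix G v\<^sub>0 \<sigma> (Suc n) =
     outcome_prefix G v\<^sub>0 \<sigma> n @ [move G \<sigma> (outcome_prefix G v\<^sub>0 \<sigma> n)]"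

definition outcome :: "('i, 'v) game \<Rightarrow> 'v \<Rightarrow> ('i, 'v) profile \<Rightarrow> nat \<Rightarrow> 'v" where
  "outcome G v\<^sub>0 \<sigma> n = last (outcome_prefix G v\<^sub>0 \<sigma> n)"

definition nash_equilibrium :: "('i, 'v) game \<Rightarrow> 'v \<Rightarrow> ('i, 'v) profile \<Rightarrow> bool" where
  "nash_equilibrium G v\<^sub>0 \<sigma> \<longleftrightarrow>
     (\<forall>i \<in> players G. \<forall>s. strategy G v\<^sub>0 i s \<longrightarrow>
        payoff G i (outcome G v\<^sub>0 (\<sigma>(i := s))) \<le> payoff G i (outcome G v\<^sub>0 \<sigma>))"

definition subgame :: "('i, 'v) game \<Rightarrow> 'v list \<Rightarrow> ('i, 'v) game" where
  "subgame G h = G\<lparr>payoff := \<lambda>i \<pi>. payoff G i (conc h \<pi>)\<rparr>"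

definition subgame_perfect_equilibrium ::
    "('i, 'v) game \<Rightarrow> 'v \<Rightarrow> ('i, 'v) profile \<Rightarrow> bool" where
  "subgame_perfect_equilibrium G v\<^sub>0 \<sigma> \<longleftrightarrow>
     (\<forall>h v. history_from G v\<^sub>0 (h @ [v]) \<longrightarrow>
        nash_equilibrium (subgame G h) v (\<lambda>i h'. \<sigma> i (h @ h')))"

lemma length_outcome_prefix [simp]: "length (outcome_prefix G v\<^sub>0 \<sigma> n) = Suc n"
  by (induction n) auto

lemma outcome_0: "outcome G v\<^sub>0 \<sigma> 0 = v\<^sub>0"
  by (simp add: outcome_def)

lemma outcome_prefix_eq: "outcome_prefix G v\<^sub>0 \<sigma> n = map (outcome G v\<^sub>0 \<sigma>) [0..<Suc n]"
proof (induction n)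
  case (Suc n)
  have "outcome G v\<^sub>0 \<sigma> (Suc n) = move G \<sigma> (outcome_prefix G v\<^sub>0 \<sigma> n)"
    by (simp add: outcome_def)
  then have "map (outcome G v\<^sub>0 \<sigma>) [0..<Suc (Suc n)] =
      map (outcome G v\<^sub>0 \<sigma>) [0..<Suc n] @ [move G \<sigma> (outcome_prefix G v\<^sub>0 \<sigma> n)]"
    by simp
  also have "\<dots> = outcome_prefix G v\<^sub>0 \<sigma> (Suc n)"
    unfolding Suc.IH[symmetric] by simp
  finally show ?case by (rule sym)
qed (simp add: outcome_0)

lemma outcome_Suc:
  "outcome G v\<^sub>0 \<sigma> (Suc n) = move G \<sigma> (map (outcome G v\<^sub>0 \<sigma>) [0..<Suc n])"
proof -
  have "outcome G v\<^sub>0 \<sigma> (Suc n) = move G \<sigma> (outcome_prefix G v\<^sub>0 \<sigma> n)"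
    by (simp add: outcome_def)
  then show ?thesis
    by (simp only: outcome_prefix_eq)
qed

lemma outcome_unique:
  assumes "\<pi> 0 = v\<^sub>0" "\<And>n. \<pi> (Suc n) = move G \<sigma> (map \<pi> [0..<Suc n])"
  shows "\<pi> = outcome G v\<^sub>0 \<sigma>"
proof
  fix n
  have "map \<pi> [0..<Suc n] = outcome_prefix G v\<^sub>0 \<sigma> n"
  proof (induction n)
    case (Suc n)
    have "map \<pi> [0..<Suc (Suc n)] = map \<pi> [0..<Suc n] @ [\<pi> (Suc n)]"
      by simp
    also have "\<dots> = outcome_prefix G v\<^sub>0 \<sigma> (Suc n)"
      unfolding assms(2) Suc.IH by simp
    finally show ?case .
  qed (simp add: assms(1))
  then have "last (map \<pi> [0..<Suc n]) = outcome G v\<^sub>0 \<sigma> n"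
    by (simp only: outcome_def)
  then show "\<pi> n = outcome G v\<^sub>0 \<sigma> n"
    by simp
qed


section \<open>Multiplayer Mealy machines\<close>

record ('q, 'v) mealy =
  states :: "'q set"
  init :: 'q
  trans :: "('q \<times> 'v \<times> 'q \<times> 'v) set"

definition mealy_machine :: "('i, 'v) game \<Rightarrow> ('q, 'v) mealy \<Rightarrow> bool" where
  "mealy_machine G M \<longleftrightarrow>
     finite (states M) \<and> init M \<in> states M \<and>
     trans M \<subseteq> states M \<times> verts G \<times> states M \<times> verts G \<and>
     (\<forall>p u q v. (p, u, q, v) \<in> trans M \<longrightarrow> (u, v) \<in> edges G) \<and>
     (\<forall>p \<in> states M. \<forall>u \<in> verts G. \<exists>q v. (p, u, q, v) \<in> trans M)"

definition deterministic :: "('i, 'v) game \<Rightarrow> ('q, 'v) mealy \<Rightarrow> bool" where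
  "deterministic G M \<longleftrightarrow> (\<forall>p \<in> states M. \<forall>u \<in> verts G. \<exists>!qv. (p, u, qv) \<in> trans M)"

definition Comp :: "('i, 'v) game \<Rightarrow> 'v \<Rightarrow> ('q, 'v) mealy \<Rightarrow> ('i, 'v) profile set" where
  "Comp G v\<^sub>0 M = {\<sigma>. strategy_profile G v\<^sub>0 \<sigma> \<and>
     (\<exists>st :: 'v list \<Rightarrow> 'q. st [] = init M \<and>
        (\<forall>h v. history_from G v\<^sub>0 (h @ [v]) \<longrightarrow>
           (st h, v, st (h @ [v]), move G \<sigma> (h @ [v])) \<in> trans M))}"


section \<open>Polynomial time\<close>

text \<open>
  Decision problems are sets of finite sequences of integers, decided by random access
  machines in the style of Cook and Reckhow, under the logarithmic cost criterion: the
  size of an integer is the length of its binary representation, with one additional unit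
  so that sizes are positive, and an instruction is charged the sizes of all values and
  computed addresses that it uses. The constants and register indices occurring in the
  program text are part of the program and contribute a constant factor only, except that
  \<open>Const\<close> is charged for its constant.

  The input is kept on a separate read-only sequence with random access; entries outside
  of it read as \<open>0\<close>. All registers initially contain \<open>0\<close>. A negative address is read as
  the address \<open>0\<close>.
\<close>

datatype instr =
    Const nat int
  | Add nat nat nat
  | Sub nat nat nat
  | Load nat nat      \<comment> \<open>\<open>Load i j\<close>: \<open>X\<^sub>i := X[X\<^sub>j]\<close>\<close>
  | Store nat nat     \<comment> \<open>\<open>Store i j\<close>: \<open>X[X\<^sub>i] := X\<^sub>j\<close>\<close>
  | Read nat nat      \<comment> \<open>\<open>Read i j\<close>: \<open>X\<^sub>i := input[X\<^sub>j]\<close>\<close>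
  | InputLength nat
  | JumpPos nat nat   \<comment> \<open>\<open>JumpPos i l\<close>: go to \<open>l\<close> if \<open>X\<^sub>i > 0\<close>\<close>
  | Accept
  | Reject

type_synonym memory = "nat \<Rightarrow> int"

definition int_size :: "int \<Rightarrow> nat" where
  "int_size z = 1 + floorlog 2 (nat \<bar>z\<bar>)"

definition input_size :: "int list \<Rightarrow> nat" where
  "input_size w = sum_list (map int_size w)"

definition input_at :: "int list \<Rightarrow> nat \<Rightarrow> int" where
  "input_at w a = (if a < length w then w ! a else 0)"

fun step :: "int list \<Rightarrow> instr \<Rightarrow> nat \<times> memory \<Rightarrow> nat \<times> memory" where
  "step w (Const i c) (pc, X) = (Suc pc, X(i := c))"
| "step w (Add i j k) (pc, X) = (Suc pc, X(i := X j + X k))"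
| "step w (Sub i j k) (pc, X) = (Suc pc, X(i := X j - X k))"
| "step w (Load i j) (pc, X) = (Suc pc, X(i := X (nat (X j))))"
| "step w (Store i j) (pc, X) = (Suc pc, X(nat (X i) := X j))"
| "step w (Read i j) (pc, X) = (Suc pc, X(i := input_at w (nat (X j))))"
| "step w (InputLength i) (pc, X) = (Suc pc, X(i := int (length w)))"
| "step w (JumpPos i l) (pc, X) = (if X i > 0 then l else Suc pc, X)"
| "step w Accept c = c"
| "step w Reject c = c"

fun cost :: "int list \<Rightarrow> instr \<Rightarrow> memory \<Rightarrow> nat" where
  "cost w (Const i c) X = 1 + int_size c"
| "cost w (Add i j k) X = 1 + int_size (X j) + int_size (X k)"
| "cost w (Sub i j k) X = 1 + int_size (X j) + int_size (X k)"
| "cost w (Load i j) X = 1 + int_size (X j) + int_size (X (nat (X j)))"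
| "cost w (Store i j) X = 1 + int_size (X i) + int_size (X j)"
| "cost w (Read i j) X = 1 + int_size (X j) + int_size (input_at w (nat (X j)))"
| "cost w (InputLength i) X = 1 + int_size (int (length w))"
| "cost w (JumpPos i l) X = 1 + int_size (X i)"
| "cost w Accept X = 1"
| "cost w Reject X = 1"

text \<open>
  \<open>run P w c t b\<close>: on input \<open>w\<close>, the program \<open>P\<close> halts from the configuration \<open>c\<close> at total
  cost \<open>t\<close> with the verdict \<open>b\<close>. Leaving the program text is not halting.
\<close>

inductive run :: "instr list \<Rightarrow> int list \<Rightarrow> nat \<times> memory \<Rightarrow> nat \<Rightarrow> bool \<Rightarrow> bool"
  for P :: "instr list" and w :: "int list" where
  run_Accept: "pc < length P \<Longrightarrow> P ! pc = Accept \<Longrightarrow> run P w (pc, X) (cost w Accept X) True"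
| run_Reject: "pc < length P \<Longrightarrow> P ! pc = Reject \<Longrightarrow> run P w (pc, X) (cost w Reject X) False"
| run_step: "pc < length P \<Longrightarrow> P ! pc \<noteq> Accept \<Longrightarrow> P ! pc \<noteq> Reject \<Longrightarrow>
    run P w (step w (P ! pc) (pc, X)) t b \<Longrightarrow> run P w (pc, X) (cost w (P ! pc) X + t) b"

lemma run_unique: "run P w c t b \<Longrightarrow> run P w c t' b' \<Longrightarrow> t = t' \<and> b = b'"
proof (induction arbitrary: t' b' rule: run.induct)
  case (run_Accept pc X)
  from run_Accept(3) show ?case by cases (simp_all add: run_Accept(2))
next
  case (run_Reject pc X)
  from run_Reject(3) show ?case by cases (simp_all add: run_Reject(2))
next
  case (run_step pc X t b)
  from run_step.prems show ?case
  proof cases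
    case (run_step t'')
    with run_step.IH show ?thesis by metis
  qed (simp_all add: run_step.hyps(2,3))
qed

definition polynomial_time_decidable :: "int list set \<Rightarrow> bool" where
  "polynomial_time_decidable L \<longleftrightarrow>
     (\<exists>(P :: instr list) (p :: nat poly). \<forall>w. \<exists>t \<le> poly p (input_size w).
        run P w (0, \<lambda>_. 0) t (w \<in> L))"


section \<open>The checking problems for mean-payoff games\<close>

text \<open>
  \<open>encodes w G r v\<^sub>0 M\<close>: the sequence \<open>w\<close> represents the mean-payoff game \<open>G\<close> with rewards
  \<open>r\<close>, the initial vertex \<open>v\<^sub>0\<close> and the machine \<open>M\<close>. Players, vertices and states are
  numbered from \<open>0\<close>. The edges (each one followed by the rewards of all players) and the
  transitions are listed without repetition in an arbitrary order, and a reward is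
  represented by any fraction with positive denominator, not necessarily reduced.
\<close>

definition encode_edge ::
    "nat \<Rightarrow> (nat \<Rightarrow> nat \<times> nat \<Rightarrow> int) \<Rightarrow> (nat \<Rightarrow> nat \<times> nat \<Rightarrow> int) \<Rightarrow> nat \<times> nat \<Rightarrow> int list" where
  "encode_edge k num den e =
     [int (fst e), int (snd e)] @ concat (map (\<lambda>i. [num i e, den i e]) [0..<k])"

fun encode_transition :: "nat \<times> nat \<times> nat \<times> nat \<Rightarrow> int list" where
  "encode_transition (p, u, q, v) = [int p, int u, int q, int v]"

definition encodes ::
    "int list \<Rightarrow> (nat, nat) game \<Rightarrow> (nat \<Rightarrow> nat \<times> nat \<Rightarrow> rat) \<Rightarrow> nat \<Rightarrow> (nat, nat) mealy \<Rightarrow> bool"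
  where
  "encodes w G r v\<^sub>0 M \<longleftrightarrow>
     (\<exists>k n s es ts num den.
        players G = {..<k} \<and> verts G = {..<n} \<and> states M = {..<s} \<and>
        distinct es \<and> set es = edges G \<and>
        distinct ts \<and> set ts = trans M \<and>
        (\<forall>i \<in> players G. \<forall>e \<in> edges G. den i e > 0 \<and> r i e = Fract (num i e) (den i e)) \<and>
        w = [int k, int n] @ map (\<lambda>v. int (owner G v)) [0..<n] @
            [int (length es)] @ concat (map (encode_edge k num den) es) @
            [int v\<^sub>0] @
            [int s, int (init M)] @
            [int (length ts)] @ concat (map encode_transition ts))"

definition mp_instance :: "int list \<Rightarrow> (nat, nat) game \<Rightarrow> nat \<Rightarrow> (nat, nat) mealy \<Rightarrow> bool" where
  "mp_instance w G v\<^sub>0 M \<longleftrightarrow>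
     v\<^sub>0 \<in> verts G \<and> mealy_machine G M \<and> (\<exists>r. mean_payoff_game G r \<and> encodes w G r v\<^sub>0 M)"

text \<open>
  Each problem consists of the codes of its positive instances; in particular, sequences that
  do not represent an instance have to be rejected.
\<close>

definition mp_nash_checking :: "int list set" where
  "mp_nash_checking = {w. \<exists>G v\<^sub>0 M. mp_instance w G v\<^sub>0 M \<and>
     (\<forall>\<sigma> \<in> Comp G v\<^sub>0 M. nash_equilibrium G v\<^sub>0 \<sigma>)}"

definition mp_deterministic_nash_checking :: "int list set" where
  "mp_deterministic_nash_checking = {w. \<exists>G v\<^sub>0 M. mp_instance w G v\<^sub>0 M \<and> deterministic G M \<and>
     (\<forall>\<sigma> \<in> Comp G v\<^sub>0 M. nash_equilibrium G v\<^sub>0 \<sigma>)}"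

definition mp_subgame_perfect_checking :: "int list set" where
  "mp_subgame_perfect_checking = {w. \<exists>G v\<^sub>0 M. mp_instance w G v\<^sub>0 M \<and>
     (\<forall>\<sigma> \<in> Comp G v\<^sub>0 M. subgame_perfect_equilibrium G v\<^sub>0 \<sigma>)}"

definition mp_deterministic_subgame_perfect_checking :: "int list set" where
  "mp_deterministic_subgame_perfect_checking =
     {w. \<exists>G v\<^sub>0 M. mp_instance w G v\<^sub>0 M \<and> deterministic G M \<and>
       (\<forall>\<sigma> \<in> Comp G v\<^sub>0 M. subgame_perfect_equilibrium G v\<^sub>0 \<sigma>)}"

end

theory Submission
  imports Defs "HOL-Analysis.Extended_Real_Limits"
begin

text \<open>
  A compatible profile fails to be an equilibrium if and only if, in a finite weighted graph, a closed
  walk of positive weight is reachable. The graph first follows a compatible play together with the state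
  of the machine; when the owner \<open>i\<close> of the current vertex leaves the prescribed move, it splits into two
  plays that share the state, a deviating one, in which \<open>i\<close> moves freely while the machine is updated as
  before, and a compatible one. From then on the two histories differ, hence the nondeterminism of the
  machine is resolved independently along them, and the weight of a pair of steps is the difference of the
  rewards of \<open>i\<close>. If no positive closed walk is reachable, then the weights of walks are bounded and the
  deviation does not increase the mean payoff; otherwise a lasso yields a profitable deviation. For
  subgame perfection, the first phase may follow arbitrary edges.

  Multiplying by all denominators makes the rewards integral, and the Bellman-Ford algorithm finds the
  positive closed walk. The machine has no multiplication, so that each step adds at most one bit to the
  stored numbers, and it suffices to bound the number of steps. This bound is immediate for programs in
  which every loop is executed exactly as many times as the input has bits.
\<close>

section \<open>Unit cost and logarithmic cost\<close>

text \<open>Lower limits are not additive, so payoffs cannot simply be subtracted. What makes reward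
  differences sufficient is that a one-sided bound on the difference of the partial sums already
  yields one inequality of means, while a lasso makes both plays ultimately periodic, so that both
  means are true limits. That choices along two plays cannot contradict each other comes from states
  and moves being functions of the whole history: once two histories differ, no extension of the one
  is an extension of the other. On the algorithmic side, no estimate of the scaled rewards is ever
  made, because the number of steps alone bounds their length. Loops run as often as the input has
  bits, since a multiplication has to go through the bits of a denominator. A vertex of the graph
  has at most five coordinates, each with at most that many values, so six nested loops provide
  enough rounds. Malformed sequences need no separate time analysis: a huge number in the input
  cannot prolong a loop beyond the size of the input.\<close>

inductive steps :: "instr list \<Rightarrow> int list \<Rightarrow> nat \<times> memory \<Rightarrow> nat \<Rightarrow> nat \<times> memory \<Rightarrow> bool"
  for P w where
  steps_refl: "steps P w c 0 c"
| steps_step: "pc < length P \<Longrightarrow> P ! pc \<noteq> Accept \<Longrightarrow> P ! pc \<noteq> Reject \<Longrightarrow>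
    steps P w (step w (P ! pc) (pc, X)) n c' \<Longrightarrow> steps P w (pc, X) (Suc n) c'"

lemma steps_trans: "steps P w c n c' \<Longrightarrow> steps P w c' m c'' \<Longrightarrow> steps P w c (n + m) c''"
  by (induction rule: steps.induct) (auto intro: steps_step)

lemma steps_one:
  "pc < length P \<Longrightarrow> P ! pc \<noteq> Accept \<Longrightarrow> P ! pc \<noteq> Reject \<Longrightarrow>
    steps P w (pc, X) 1 (step w (P ! pc) (pc, X))"
  using steps_step[OF _ _ _ steps_refl] by (metis One_nat_def)

lemma int_size_le: "\<bar>z\<bar> \<le> 2 ^ B \<Longrightarrow> int_size z \<le> B + 2"
proof -
  assume "\<bar>z\<bar> \<le> 2 ^ B"
  then have "nat \<bar>z\<bar> \<le> 2 ^ B"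
    by (simp add: nat_le_iff)
  then have "floorlog 2 (nat \<bar>z\<bar>) \<le> floorlog 2 (2 ^ B)"
    by (rule floorlog_mono)
  also have "\<dots> = B + 1"
    by (simp add: floorlog_def)
  finally show ?thesis
    by (simp add: int_size_def)
qed

lemma abs_le_int_size: "\<bar>z\<bar> \<le> 2 ^ int_size z"
proof (cases "z = 0")
  case False
  have "nat \<bar>z\<bar> < 2 ^ floorlog 2 (nat \<bar>z\<bar>)"
    using False floorlog_bounds[of "nat \<bar>z\<bar>" 2] by linarith
  then have "\<bar>z\<bar> < 2 ^ floorlog 2 (nat \<bar>z\<bar>)"
    by (metis abs_ge_zero nat_less_numeral_power_cancel_iff)
  also have "\<dots> \<le> 2 ^ int_size z"
    by (simp add: int_size_def)
  finally show ?thesis by simp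
qed simp

lemma int_size_le_input_size: "a < length w \<Longrightarrow> int_size (w ! a) \<le> input_size w"
  unfolding input_size_def using member_le_sum_list[of "int_size (w ! a)" "map int_size w"] by auto

lemma length_le_input_size: "length w \<le> input_size w"
proof (induction w)
  case (Cons z w)
  have "1 \<le> int_size z" by (simp add: int_size_def)
  with Cons show ?case by (simp add: input_size_def)
qed simp

lemma abs_input_le: "\<bar>input_at w a\<bar> \<le> 2 ^ input_size w"
proof (cases "a < length w")
  case True
  have "\<bar>w ! a\<bar> \<le> 2 ^ int_size (w ! a)" by (rule abs_le_int_size)
  also have "\<dots> \<le> 2 ^ input_size w"
    using int_size_le_input_size[OF True] by simp
  finally show ?thesis using True by (simp add: input_at_def)
qed (simp add: input_at_def)

lemma length_le_power: "int (length w) \<le> 2 ^ input_size w"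
proof -
  have "length w \<le> 2 ^ input_size w"
    using length_le_input_size[of w] less_exp[of "input_size w"] by linarith
  then show ?thesis
    by (metis of_nat_le_iff of_nat_numeral of_nat_power)
qed

definition small_consts :: "instr list \<Rightarrow> nat \<Rightarrow> bool" where
  "small_consts P B \<longleftrightarrow> (\<forall>i c. Const i c \<in> set P \<longrightarrow> \<bar>c\<bar> \<le> 2 ^ B)"

lemma ex_small_consts: "\<exists>B. small_consts P B"
proof (induction P)
  case (Cons i P)
  then obtain B where B: "small_consts P B" by blast
  show ?case
  proof (cases "\<exists>j c. i = Const j c")
    case True
    then obtain j c where i: "i = Const j c" by blast
    have "\<bar>z\<bar> \<le> 2 ^ (B + int_size c)" if "\<bar>z\<bar> \<le> 2 ^ B \<or> z = c" for z :: int
    proof -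
      have "\<bar>c\<bar> \<le> 2 ^ (B + int_size c)"
        using abs_le_int_size[of c] power_increasing[of "int_size c" "B + int_size c" "2::int"] by linarith
      moreover have "(2::int) ^ B \<le> 2 ^ (B + int_size c)"
        by (rule power_increasing) auto
      ultimately show ?thesis using that by linarith
    qed
    then have "small_consts (i # P) (B + int_size c)"
      using B unfolding small_consts_def i by auto
    then show ?thesis by blast
  next
    case False
    then have "small_consts (i # P) B"
      using B unfolding small_consts_def by auto
    then show ?thesis by blast
  qed
qed (simp add: small_consts_def)

text \<open>Without multiplication a step lengthens the stored values by at most one bit, so
  polynomially many steps have polynomial logarithmic cost.\<close>

lemma step_bounded:
  assumes X: "\<And>a. \<bar>X a\<bar> \<le> 2 ^ B"
    and i: "\<And>j c. i = Const j c \<Longrightarrow> \<bar>c\<bar> \<le> 2 ^ B"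
    and I: "input_size w \<le> B"
  shows "\<bar>snd (step w i (pc, X)) a\<bar> \<le> 2 ^ Suc B" "cost w i X \<le> 2 * B + 5"
proof -
  have p: "(2::int) ^ input_size w \<le> 2 ^ B"
    using I by (simp add: power_increasing)
  have X': "\<bar>X a\<bar> \<le> 2 * 2 ^ B" for a
    using X[of a] by simp
  have inp: "\<bar>input_at w b\<bar> \<le> 2 ^ B" for b
    using abs_input_le[of w b] p by linarith
  have len: "int (length w) \<le> 2 ^ B"
    using length_le_power[of w] p by linarith
  have add: "\<bar>X j + X k\<bar> \<le> 2 * 2 ^ B" "\<bar>X j - X k\<bar> \<le> 2 * 2 ^ B" for j k
    using X[of j] X[of k] by linarith+
  have dbl: "z \<le> 2 * 2 ^ B" if "z \<le> 2 ^ B" for z :: int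
    using that zero_le_power[of "2::int" B] by linarith
  show "\<bar>snd (step w i (pc, X)) a\<bar> \<le> 2 ^ Suc B"
    using X' dbl[OF inp] dbl[OF len] add dbl[OF i] by (cases i) auto
  note sX = int_size_le[OF X]
  have sl: "int_size (int (length w)) \<le> B + 2"
    by (rule int_size_le) (use len in simp)
  show "cost w i X \<le> 2 * B + 5"
  proof (cases i)
    case (Const j c)
    with int_size_le[OF i[OF this]] show ?thesis by simp
  next
    case (Add x y z)
    with sX[of y] sX[of z] show ?thesis by simp
  next
    case (Sub x y z)
    with sX[of y] sX[of z] show ?thesis by simp
  next
    case (Load x y)
    with sX[of y] sX[of "nat (X y)"] show ?thesis by simp
  next
    case (Store x y)
    with sX[of y] sX[of x] show ?thesis by simp
  next
    case (Read x y)
    with sX[of y] int_size_le[OF inp, of "nat (X y)"] show ?thesis by simp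
  next
    case (InputLength x)
    with sl show ?thesis by simp
  next
    case (JumpPos x y)
    with sX[of x] show ?thesis by simp
  qed auto
qed

text \<open>The bound \<open>2 ^ B\<close> on the stored values gains one bit per step, hence
  \<open>B\<close> is generalised in the induction. Each of the \<open>n\<close> steps then costs at
  most \<open>2 * (B + n) + 5\<close>: two operand sizes and a constant.\<close>

lemma steps_run:
  assumes "steps P w c n c'" "run P w c' t b" "\<And>a. \<bar>snd c a\<bar> \<le> 2 ^ B"
    "small_consts P B" "input_size w \<le> B"
  shows "\<exists>t'. run P w c t' b \<and> t' \<le> n * (2 * (B + n) + 5) + t"
  using assms
proof (induction arbitrary: B rule: steps.induct)
  case (steps_refl c)
  then show ?case by auto
next
  case (steps_step pc X n c')
  let ?i = "P ! pc"
  have i: "\<bar>c\<bar> \<le> 2 ^ B" if "?i = Const j c" for j c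
    using steps_step.hyps(1) steps_step.prems(3) that unfolding small_consts_def
    by (metis nth_mem)
  have X: "\<bar>X a\<bar> \<le> 2 ^ B" for a
    using steps_step.prems(2)[of a] by simp
  have sb: "\<bar>snd (step w ?i (pc, X)) a\<bar> \<le> 2 ^ Suc B" "cost w ?i X \<le> 2 * B + 5" for a
    by (rule step_bounded[OF X i steps_step.prems(4)]; assumption)+
  have sc: "small_consts P (Suc B)"
    unfolding small_consts_def
  proof (intro allI impI)
    fix j c assume "Const j c \<in> set P"
    then have "\<bar>c\<bar> \<le> 2 ^ B" using steps_step.prems(3) unfolding small_consts_def by blast
    then show "\<bar>c\<bar> \<le> 2 ^ Suc B" using zero_le_power[of "2::int" B] by simp
  qed
  have "\<exists>t'. run P w (step w ?i (pc, X)) t' b \<and> t' \<le> n * (2 * (Suc B + n) + 5) + t"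
    by (rule steps_step.IH[OF steps_step.prems(1) _ sc]) (use sb steps_step.prems(4) in auto)
  then obtain t' where t': "run P w (step w ?i (pc, X)) t' b" "t' \<le> n * (2 * (Suc B + n) + 5) + t"
    by blast
  from run_step[OF steps_step.hyps(1-3) t'(1)]
  have "run P w (pc, X) (cost w ?i X + t') b" .
  moreover have "cost w ?i X + t' \<le> Suc n * (2 * (B + Suc n) + 5) + t"
    using sb(2) t'(2) by simp
  ultimately show ?case by blast
qed

lemma polynomial_time_decidableI:
  assumes "\<And>w. \<exists>n pc X. steps P w (0, \<lambda>_. 0) n (pc, X) \<and> n \<le> poly p (input_size w) \<and>
      pc < length P \<and> P ! pc = (if w \<in> L then Accept else Reject)"
  shows "polynomial_time_decidable L"
proof -
  obtain B where B: "small_consts P B" using ex_small_consts by blast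
  \<comment> \<open>This evaluates to the bound of \<open>steps_run\<close> with \<open>p\<close> in
    place of \<open>n\<close>: \<open>pCons B [:1:]\<close> is \<open>B\<close> plus the input size,
    and the last \<open>1\<close> pays for the halting instruction.\<close>
  define q where "q = p * (smult 2 (pCons B [:1:] + p) + [:5:]) + [:1:]"
  have "\<exists>t \<le> poly q (input_size w). run P w (0, \<lambda>_. 0) t (w \<in> L)" for w
  proof -
    from assms obtain n pc X where st: "steps P w (0, \<lambda>_. 0) n (pc, X)"
      and n: "n \<le> poly p (input_size w)" and pc: "pc < length P" "P ! pc = (if w \<in> L then Accept else Reject)"
      by blast
    have r: "run P w (pc, X) 1 (w \<in> L)"
      using run_Accept[OF pc(1), of w X] run_Reject[OF pc(1), of w X] pc(2) by (cases "w \<in> L") auto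
    let ?B = "B + input_size w"
    have "small_consts P ?B"
      unfolding small_consts_def
    proof (intro allI impI)
      fix j c assume "Const j c \<in> set P"
      then have "\<bar>c\<bar> \<le> 2 ^ B" using B unfolding small_consts_def by blast
      also have "(2::int) ^ B \<le> 2 ^ ?B" by (rule power_increasing) auto
      finally show "\<bar>c\<bar> \<le> 2 ^ ?B" .
    qed
    from steps_run[OF st r _ this] obtain t where
      t: "run P w (0, \<lambda>_. 0) t (w \<in> L)" "t \<le> n * (2 * (?B + n) + 5) + 1"
      by auto
    note t(2)
    also have "n * (2 * (?B + n) + 5) + 1 \<le>
        poly p (input_size w) * (2 * (?B + poly p (input_size w)) + 5) + 1"
      using n by (intro add_mono mult_mono) auto
    also have "\<dots> = poly q (input_size w)"
      by (simp add: q_def algebra_simps)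
    finally show ?thesis using t(1) by blast
  qed
  then show ?thesis
    unfolding polynomial_time_decidable_def by blast
qed

section \<open>Structured programs\<close>

text \<open>All jumps of the machine are conditional: an unconditional one sets \<open>scratch\<close> to \<open>1\<close> first.\<close>

definition scratch :: nat where "scratch = 2"

datatype stm = Do instr | Sq stm stm | IfPos nat stm stm | WhilePos nat stm

fun plain :: "instr \<Rightarrow> bool" where
  "plain (JumpPos i l) = False"
| "plain Accept = False"
| "plain Reject = False"
| "plain _ = True"

definition eff :: "int list \<Rightarrow> instr \<Rightarrow> memory \<Rightarrow> memory" where
  "eff w i X = snd (step w i (0, X))"

lemma step_plain: "plain i \<Longrightarrow> step w i (pc, X) = (Suc pc, eff w i X)"
  by (cases i) (auto simp: eff_def)

text \<open>The counts are the exact numbers of machine instructions: one for a test, and two more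
  for the unconditional jump that ends an else branch, leaves a loop or closes an iteration. Such a
  jump writes to \<open>scratch\<close>, so this update shows in the resulting memory.\<close>

inductive bs :: "int list \<Rightarrow> stm \<Rightarrow> memory \<Rightarrow> nat \<Rightarrow> memory \<Rightarrow> bool" for w where
  bs_Do: "plain i \<Longrightarrow> bs w (Do i) X 1 (eff w i X)"
| bs_Sq: "bs w c X n Y \<Longrightarrow> bs w d Y m Z \<Longrightarrow> bs w (Sq c d) X (n + m) Z"
| bs_IfT: "X r > 0 \<Longrightarrow> bs w c X n Y \<Longrightarrow> bs w (IfPos r c d) X (n + 1) Y"
| bs_IfF: "\<not> X r > 0 \<Longrightarrow> bs w d X n Y \<Longrightarrow> bs w (IfPos r c d) X (n + 3) (Y(scratch := 1))"
| bs_WhileF: "\<not> X r > 0 \<Longrightarrow> bs w (WhilePos r c) X 3 (X(scratch := 1))"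
| bs_WhileT: "X r > 0 \<Longrightarrow> bs w c X n Y \<Longrightarrow> bs w (WhilePos r c) (Y(scratch := 1)) m Z \<Longrightarrow>
    bs w (WhilePos r c) X (n + m + 3) Z"

primrec code_size :: "stm \<Rightarrow> nat" where
  "code_size (Do i) = 1"
| "code_size (Sq c d) = code_size c + code_size d"
| "code_size (IfPos r c d) = code_size c + code_size d + 3"
| "code_size (WhilePos r c) = code_size c + 5"

text \<open>Jump targets are absolute, hence the parameter \<open>a\<close>, the address of the
  first instruction. The else branch comes first: a failed test falls through to it, a successful
  one jumps over it.\<close>

primrec code :: "nat \<Rightarrow> stm \<Rightarrow> instr list" where
  "code a (Do i) = [i]"
| "code a (Sq c d) = code a c @ code (a + code_size c) d"
| "code a (IfPos r c d) = [JumpPos r (a + 3 + code_size d)] @ code (a + 1) d @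
     [Const scratch 1, JumpPos scratch (a + 3 + code_size d + code_size c)] @ code (a + 3 + code_size d) c"
| "code a (WhilePos r c) = [JumpPos r (a + 3), Const scratch 1, JumpPos scratch (a + 5 + code_size c)] @
     code (a + 3) c @ [Const scratch 1, JumpPos scratch a]"

lemma length_code [simp]: "length (code a c) = code_size c"
  by (induction c arbitrary: a) auto

definition occurs :: "instr list \<Rightarrow> nat \<Rightarrow> instr list \<Rightarrow> bool" where
  "occurs P a cs \<longleftrightarrow> (\<exists>pre post. P = pre @ cs @ post \<and> length pre = a)"

lemma occurs_append: "occurs P a (cs @ ds) \<longleftrightarrow> occurs P a cs \<and> occurs P (a + length cs) ds"
proof
  assume "occurs P a (cs @ ds)"
  then obtain pre post where "P = pre @ cs @ ds @ post" "length pre = a"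
    by (auto simp: occurs_def)
  then show "occurs P a cs \<and> occurs P (a + length cs) ds"
    unfolding occurs_def by (metis append.assoc length_append)
next
  assume "occurs P a cs \<and> occurs P (a + length cs) ds"
  then obtain pre post pre' post' where
    1: "P = pre @ cs @ post" "length pre = a" and 2: "P = pre' @ ds @ post'" "length pre' = a + length cs"
    unfolding occurs_def by blast
  from 1 2 have "(pre @ cs) @ post = pre' @ (ds @ post')"
    by simp
  moreover have "length (pre @ cs) = length pre'"
    using 1 2 by simp
  ultimately have "post = ds @ post'"
    by (metis append_eq_append_conv)
  with 1 show "occurs P a (cs @ ds)"
    unfolding occurs_def by auto
qed

lemma occurs_Cons: "occurs P a (i # cs) \<longleftrightarrow> occurs P a [i] \<and> occurs P (Suc a) cs"
  using occurs_append[of P a "[i]" cs] by simp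

lemma occurs_single: "occurs P a [i] \<longleftrightarrow> a < length P \<and> P ! a = i"
proof
  assume "a < length P \<and> P ! a = i"
  then show "occurs P a [i]"
    unfolding occurs_def by (intro exI[of _ "take a P"] exI[of _ "drop (Suc a) P"]) (use id_take_nth_drop[of a P] in auto)
qed (auto simp: occurs_def)

lemma steps_plain:
  assumes "occurs P a [i]" "plain i"
  shows "steps P w (a, X) 1 (Suc a, eff w i X)"
proof -
  have "i \<noteq> Accept" "i \<noteq> Reject" using assms(2) by auto
  then show ?thesis
    using steps_one[of a P w X] assms by (auto simp: occurs_single step_plain)
qed

lemma steps_jump:
  assumes "occurs P a [JumpPos r l]"
  shows "steps P w (a, X) 1 (if X r > 0 then l else Suc a, X)"
  using steps_one[of a P w X] assms by (auto simp: occurs_single)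

lemma steps_goto:
  assumes "occurs P a [Const scratch 1]" "occurs P (Suc a) [JumpPos scratch l]"
  shows "steps P w (a, X) 2 (l, X(scratch := 1))"
  using steps_trans[OF steps_plain[OF assms(1), of w X] steps_jump[OF assms(2), of w]]
  by (simp add: eff_def numeral_2_eq_2)

lemma steps_code:
  "bs w c X n Y \<Longrightarrow> occurs P a (code a c) \<Longrightarrow> steps P w (a, X) n (a + code_size c, Y)"
proof (induction arbitrary: a rule: bs.induct)
  case (bs_Do i X)
  then show ?case using steps_plain by simp
next
  case (bs_Sq c X n Y d m Z)
  then have "occurs P a (code a c)" "occurs P (a + code_size c) (code (a + code_size c) d)"
    by (simp_all add: occurs_append)
  from steps_trans[OF bs_Sq.IH(1)[OF this(1)] bs_Sq.IH(2)[OF this(2)]]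
  show ?case by (simp add: add.assoc)
next
  case (bs_IfT X r c n Y d)
  then have "occurs P a [JumpPos r (a + 3 + code_size d)]"
    "occurs P (a + 3 + code_size d) (code (a + 3 + code_size d) c)"
    by (simp_all add: occurs_append occurs_Cons[of _ _ _ "_ # _"] occurs_Cons[of _ _ _ "code _ _"] occurs_Cons[of _ _ _ "code _ _ @ _"] numeral_3_eq_3)
  moreover have "steps P w (a, X) 1 (a + 3 + code_size d, X)"
    using steps_jump[OF calculation(1), of w X] bs_IfT.hyps(1) by simp
  ultimately show ?case
    using steps_trans bs_IfT.IH by (fastforce simp: ac_simps)
next
  case (bs_IfF X r d n Y c)
  let ?l = "a + 3 + code_size d + code_size c"
  from bs_IfF.prems have at: "occurs P a [JumpPos r (a + 3 + code_size d)]" "occurs P (a + 1) (code (a + 1) d)"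
    "occurs P (a + 1 + code_size d) [Const scratch 1]"
    "occurs P (Suc (a + 1 + code_size d)) [JumpPos scratch ?l]"
    by (simp_all add: occurs_append occurs_Cons[of _ _ _ "_ # _"] occurs_Cons[of _ _ _ "code _ _"] occurs_Cons[of _ _ _ "code _ _ @ _"])
  have 1: "steps P w (a, X) 1 (a + 1, X)"
    using steps_jump[OF at(1), of w X] bs_IfF.hyps(1) by simp
  have "steps P w (a, X) (1 + n + 2) (?l, Y(scratch := 1))"
    using steps_trans[OF steps_trans[OF 1 bs_IfF.IH[OF at(2)]] steps_goto[OF at(3,4)]] by simp
  moreover have "1 + n + 2 = n + 3" "?l = a + code_size (IfPos r c d)" by simp_all
  ultimately show ?case by metis
next
  case (bs_WhileF X r c)
  then have at: "occurs P a [JumpPos r (a + 3)]" "occurs P (Suc a) [Const scratch 1]"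
    "occurs P (Suc (Suc a)) [JumpPos scratch (a + 5 + code_size c)]"
    by (simp_all add: occurs_append occurs_Cons[of _ _ _ "_ # _"] occurs_Cons[of _ _ _ "code _ _"] occurs_Cons[of _ _ _ "code _ _ @ _"])
  have 1: "steps P w (a, X) 1 (Suc a, X)"
    using steps_jump[OF at(1), of w X] bs_WhileF.hyps(1) by simp
  have "steps P w (a, X) (1 + 2) (a + 5 + code_size c, X(scratch := 1))"
    using steps_trans[OF 1 steps_goto[OF at(2,3)]] by simp
  moreover have "1 + 2 = (3::nat)" "a + 5 + code_size c = a + code_size (WhilePos r c)" by simp_all
  ultimately show ?case by metis
next
  case (bs_WhileT X r c n Y m Z)
  then have at: "occurs P a [JumpPos r (a + 3)]" "occurs P (a + 3) (code (a + 3) c)"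
    "occurs P (a + 3 + code_size c) [Const scratch 1]" "occurs P (Suc (a + 3 + code_size c)) [JumpPos scratch a]"
    by (simp_all add: occurs_append occurs_Cons[of _ _ _ "_ # _"] occurs_Cons[of _ _ _ "code _ _"] occurs_Cons[of _ _ _ "code _ _ @ _"] numeral_3_eq_3)
  have 1: "steps P w (a, X) 1 (a + 3, X)"
    using steps_jump[OF at(1), of w X] bs_WhileT.hyps(1) by simp
  from steps_trans[OF steps_trans[OF steps_trans[OF 1 bs_WhileT.IH(1)[OF at(2)]] steps_goto[OF at(3,4)]]
      bs_WhileT.IH(2)[OF bs_WhileT.prems]]
  show ?case by (simp add: ac_simps numeral_3_eq_3)
qed

section \<open>A loop language with total semantics\<close>

text \<open>The start memory is an argument instead of being described by a precondition, so that
  postconditions can refer to it directly. The cost is only bounded from above, since exact counts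
  depend on the data.\<close>

definition triple :: "int list \<Rightarrow> stm \<Rightarrow> memory \<Rightarrow> nat \<Rightarrow> (memory \<Rightarrow> bool) \<Rightarrow> bool" where
  "triple w c X T Q \<longleftrightarrow> (\<exists>n Y. bs w c X n Y \<and> n \<le> T \<and> Q Y)"

lemma triple_weaken: "triple w c X T R \<Longrightarrow> (\<And>Y. R Y \<Longrightarrow> Q Y) \<Longrightarrow> T \<le> T' \<Longrightarrow> triple w c X T' Q"
  unfolding triple_def by (meson order.trans)

lemma triple_Sq:
  "triple w c X T R \<Longrightarrow> (\<And>Y. R Y \<Longrightarrow> triple w d Y T' Q) \<Longrightarrow> triple w (Sq c d) X (T + T') Q"
  unfolding triple_def by (meson bs_Sq add_mono)

text \<open>Both branches are charged together, because a sum of polynomials is again a polynomial,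
  while a maximum is not.\<close>

lemma triple_IfPos:
  assumes "X r > 0 \<Longrightarrow> triple w c X T Q" "\<not> X r > 0 \<Longrightarrow> triple w d X T' (\<lambda>Y. Q (Y(scratch := 1)))"
  shows "triple w (IfPos r c d) X (T + T' + 3) Q"
proof (cases "X r > 0")
  case True
  with assms(1) obtain n Y where "bs w c X n Y" "n \<le> T" "Q Y" unfolding triple_def by blast
  with True show ?thesis
    unfolding triple_def by (intro exI[of _ "n + 1"] exI[of _ Y]) (auto intro: bs_IfT[simplified])
next
  case False
  with assms(2) obtain n Y where "bs w d X n Y" "n \<le> T'" "Q (Y(scratch := 1))" unfolding triple_def by blast
  with False show ?thesis
    unfolding triple_def by (intro exI[of _ "n + 3"] exI[of _ "Y(scratch := 1)"]) (auto intro: bs_IfF)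
qed

text \<open>The invariant is indexed by the number of finished iterations and decides the test, so
  that exactly \<open>n\<close> iterations take place. The induction is on the number of iterations
  left.\<close>

lemma triple_WhilePos:
  assumes "P 0 X"
    and body: "\<And>i Y. i < n \<Longrightarrow> P i Y \<Longrightarrow> Y r > 0 \<and> triple w c Y T (\<lambda>Z. P (Suc i) (Z(scratch := 1)))"
    and exit: "\<And>Y. P n Y \<Longrightarrow> \<not> Y r > 0 \<and> Q (Y(scratch := 1))"
  shows "triple w (WhilePos r c) X (n * (T + 3) + 3) Q"
proof -
  have "P (n - k) Y \<Longrightarrow> k \<le> n \<Longrightarrow> triple w (WhilePos r c) Y (k * (T + 3) + 3) Q" for k Y
  proof (induction k arbitrary: Y)
    case 0
    with exit[of Y] show ?case
      unfolding triple_def by (auto intro!: exI bs_WhileF)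
  next
    case (Suc k)
    from Suc.prems body[of "n - Suc k" Y] have pos: "Y r > 0"
      and "triple w c Y T (\<lambda>Z. P (n - k) (Z(scratch := 1)))"
      by (auto simp: Suc_diff_Suc)
    then obtain m Z where m: "bs w c Y m Z" "m \<le> T" "P (n - k) (Z(scratch := 1))"
      unfolding triple_def by blast
    from Suc.IH[OF m(3)] Suc.prems obtain l Z' where
      l: "bs w (WhilePos r c) (Z(scratch := 1)) l Z'" "l \<le> k * (T + 3) + 3" "Q Z'"
      unfolding triple_def by auto
    from bs_WhileT[OF pos m(1) l(1)] m(2) l(2,3) show ?case
      unfolding triple_def by (intro exI[of _ "m + l + 3"] exI[of _ Z']) auto
  qed
  from this[of n X] assms(1) show ?thesis by simp
qed

text \<open>\<open>stm\<close> has no empty statement; a write to \<open>scratch\<close> stands in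
  for it.\<close>

fun block :: "instr list \<Rightarrow> stm" where
  "block [] = Do (Const scratch 1)"
| "block [i] = Do i"
| "block (i # is) = Sq (Do i) (block is)"

lemma bs_block:
  "is \<noteq> [] \<Longrightarrow> list_all plain is \<Longrightarrow> bs w (block is) X (length is) (foldl (\<lambda>X i. eff w i X) X is)"
proof (induction "is" arbitrary: X rule: block.induct)
  case (3 i j js)
  then have "bs w (block (i # j # js)) X (1 + length (j # js)) (foldl (\<lambda>X i. eff w i X) (eff w i X) (j # js))"
    unfolding block.simps using bs_Sq[OF bs_Do] by auto
  then show ?case by simp
qed (auto intro: bs_Do[simplified])

lemma triple_block:
  "is \<noteq> [] \<Longrightarrow> list_all plain is \<Longrightarrow> Q (foldl (\<lambda>X i. eff w i X) X is) \<Longrightarrow> length is \<le> T \<Longrightarrow>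
    triple w (block is) X T Q"
  unfolding triple_def using bs_block by blast

lemma eff_simps [simp]:
  "eff w (Const i c) X = X(i := c)"
  "eff w (Add i j k) X = X(i := X j + X k)"
  "eff w (Sub i j k) X = X(i := X j - X k)"
  "eff w (Load i j) X = X(i := X (nat (X j)))"
  "eff w (Store i j) X = X(nat (X i) := X j)"
  "eff w (Read i j) X = X(i := input_at w (nat (X j)))"
  "eff w (InputLength i) X = X(i := int (length w))"
  by (simp_all add: eff_def)

text \<open>\<open>Powers\<close> serves the multiplication, \<open>Rewards\<close> holds the
  integral rewards, and \<open>Mark\<close> and \<open>Dist\<close> together form the labelling:
  whether a vertex is labelled, and with what.\<close>

datatype array = Powers | Rewards | Mark | Dist

text \<open>The number of iterations of every loop is a parameter \<open>N\<close> of the semantics. The program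
  sets it to the length of the input at first, and to the bit size of the input once that is
  computed by means of \<open>Bits\<close>.\<close>

datatype aexp =
    Num int | Var nat | Plus aexp aexp | Minus aexp aexp | Arr array aexp
  | Inp aexp | Len | Bits aexp
  | Ite aexp aexp aexp
  | Sum nat aexp

text \<open>Conditions count as true when they are positive, the only test of the machine. Negative
  indices are mapped to \<open>0\<close> by \<open>nat\<close>, again as on the machine.\<close>

primrec aval :: "int list \<Rightarrow> nat \<Rightarrow> (array \<Rightarrow> nat \<Rightarrow> int) \<Rightarrow> aexp \<Rightarrow> (nat \<Rightarrow> int) \<Rightarrow> int" where
  "aval w N a (Num c) v = c"
| "aval w N a (Var x) v = v x"
| "aval w N a (Plus e f) v = aval w N a e v + aval w N a f v"
| "aval w N a (Minus e f) v = aval w N a e v - aval w N a f v"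
| "aval w N a (Arr b e) v = a b (nat (aval w N a e v))"
| "aval w N a (Inp e) v = input_at w (nat (aval w N a e v))"
| "aval w N a Len v = int (length w)"
| "aval w N a (Bits e) v = int (floorlog 2 (nat \<bar>input_at w (nat (aval w N a e v))\<bar>))"
| "aval w N a (Ite e f g) v = (if aval w N a e v > 0 then aval w N a f v else aval w N a g v)"
| "aval w N a (Sum x e) v = (\<Sum>i<N. aval w N a e (v(x := int i)))"

datatype com =
    Skip | Assign nat aexp | Put array aexp aexp | Seq com com | Cond aexp com com | For nat com

type_synonym state = "(nat \<Rightarrow> int) \<times> (array \<Rightarrow> nat \<Rightarrow> int)"

primrec exec :: "int list \<Rightarrow> nat \<Rightarrow> com \<Rightarrow> state \<Rightarrow> state" where
  "exec w N Skip s = s"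
| "exec w N (Assign x e) s = ((fst s)(x := aval w N (snd s) e (fst s)), snd s)"
| "exec w N (Put b e f) s =
     (fst s, (snd s)(b := (snd s b)(nat (aval w N (snd s) e (fst s)) := aval w N (snd s) f (fst s))))"
| "exec w N (Seq c d) s = exec w N d (exec w N c s)"
| "exec w N (Cond e c d) s = (if aval w N (snd s) e (fst s) > 0 then exec w N c s else exec w N d s)"
| "exec w N (For x c) s = fold (\<lambda>i s. exec w N c ((fst s)(x := int i), snd s)) [0..<N] s"

text \<open>Memory layout: variable \<open>x\<close> at \<open>8x\<close>, the \<open>d\<close>-th temporary at \<open>8d + 1\<close>, \<open>scratch\<close> at \<open>2\<close>,
  the loop bound at \<open>3\<close>, and the four arrays interleaved in the remaining residue classes.\<close>

definition var_addr :: "nat \<Rightarrow> nat" where "var_addr x = 8 * x"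
definition tmp_addr :: "nat \<Rightarrow> nat" where "tmp_addr d = 8 * d + 1"
definition bound_addr :: nat where "bound_addr = 3"
definition array_off :: "array \<Rightarrow> nat" where
  "array_off b = (case b of Powers \<Rightarrow> 4 | Rewards \<Rightarrow> 5 | Mark \<Rightarrow> 6 | Dist \<Rightarrow> 7)"
definition arr_addr :: "array \<Rightarrow> nat \<Rightarrow> nat" where "arr_addr b i = 8 * i + array_off b"

lemma array_off_bounds: "4 \<le> array_off b" "array_off b < 8"
  by (cases b; simp add: array_off_def)+

lemma array_off_inj [simp]: "array_off b = array_off c \<longleftrightarrow> b = c"
  by (cases b; cases c; simp add: array_off_def)

lemma addr_simps [simp]:
  "var_addr x = var_addr y \<longleftrightarrow> x = y" "tmp_addr x = tmp_addr y \<longleftrightarrow> x = y"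
  "var_addr x \<noteq> tmp_addr y" "tmp_addr y \<noteq> var_addr x"
  "var_addr x \<noteq> scratch" "scratch \<noteq> var_addr x" "tmp_addr x \<noteq> scratch" "scratch \<noteq> tmp_addr x"
  "var_addr x \<noteq> bound_addr" "bound_addr \<noteq> var_addr x" "tmp_addr x \<noteq> bound_addr" "bound_addr \<noteq> tmp_addr x"
  "scratch \<noteq> bound_addr" "bound_addr \<noteq> scratch"
  unfolding var_addr_def tmp_addr_def scratch_def bound_addr_def by presburger+

lemma arr_addr_mod: "arr_addr b i mod 8 = array_off b" "arr_addr b i div 8 = i"
  using array_off_bounds[of b] by (simp_all add: arr_addr_def)

lemma arr_addr_inj [simp]: "arr_addr b i = arr_addr c j \<longleftrightarrow> b = c \<and> i = j"
  by (metis arr_addr_mod array_off_inj)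

lemma arr_addr_simps [simp]:
  "arr_addr b i \<noteq> var_addr x" "var_addr x \<noteq> arr_addr b i"
  "arr_addr b i \<noteq> tmp_addr x" "tmp_addr x \<noteq> arr_addr b i"
  "arr_addr b i \<noteq> scratch" "scratch \<noteq> arr_addr b i"
  "arr_addr b i \<noteq> bound_addr" "bound_addr \<noteq> arr_addr b i"
proof -
  have "var_addr x mod 8 = 0" "tmp_addr x mod 8 = 1" "scratch mod 8 = 2" "bound_addr mod 8 = 3"
    by (simp_all add: var_addr_def tmp_addr_def scratch_def bound_addr_def mod_Suc)
  moreover have "arr_addr b i mod 8 \<ge> 4"
    by (simp add: arr_addr_mod array_off_bounds)
  ultimately show "arr_addr b i \<noteq> var_addr x" "arr_addr b i \<noteq> tmp_addr x"
    "arr_addr b i \<noteq> scratch" "arr_addr b i \<noteq> bound_addr"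
    by (metis not_numeral_le_zero, metis numeral_le_one_iff semiring_norm(69),
        metis numeral_le_iff semiring_norm(69,71), metis numeral_le_iff semiring_norm(69,72,73))
  then show "var_addr x \<noteq> arr_addr b i" "tmp_addr x \<noteq> arr_addr b i"
    "scratch \<noteq> arr_addr b i" "bound_addr \<noteq> arr_addr b i"
    by metis+
qed

text \<open>Temporaries and \<open>scratch\<close> are left open, so that computations in them
  preserve the relation.\<close>

definition repr :: "nat \<Rightarrow> (nat \<Rightarrow> int) \<Rightarrow> (array \<Rightarrow> nat \<Rightarrow> int) \<Rightarrow> memory \<Rightarrow> bool" where
  "repr N v a X \<longleftrightarrow> (\<forall>x. X (var_addr x) = v x) \<and> (\<forall>b i. X (arr_addr b i) = a b i) \<and> X bound_addr = int N"

lemma repr_var: "repr N v a X \<Longrightarrow> X (var_addr x) = v x"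
  and repr_arr: "repr N v a X \<Longrightarrow> X (arr_addr b i) = a b i"
  and repr_bound: "repr N v a X \<Longrightarrow> X bound_addr = int N"
  by (simp_all add: repr_def)

lemma repr_upd [simp]:
  "repr N v a (X(tmp_addr d := z)) = repr N v a X"
  "repr N v a (X(scratch := z)) = repr N v a X"
  by (simp_all add: repr_def)

lemma repr_upd_var: "repr N v a X \<Longrightarrow> repr N (v(x := z)) a (X(var_addr x := z))"
  by (simp add: repr_def)

lemma repr_upd_var': "repr N (v(x := z')) a X \<Longrightarrow> repr N (v(x := z)) a (X(var_addr x := z))"
  by (simp add: repr_def)

lemma repr_upd_arr: "repr N v a X \<Longrightarrow> repr N v (a(b := (a b)(i := z))) (X(arr_addr b i := z))"
  by (simp add: repr_def)

section \<open>Compilation of expressions\<close>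

definition copy :: "nat \<Rightarrow> nat \<Rightarrow> instr list" where
  "copy i j = [Const i 0, Add i i j]"

text \<open>The conditional replaces a negative index by \<open>0\<close>, in accordance with
  \<open>nat\<close>. Three doublings provide the factor 8 of the memory layout.\<close>

definition addr_code :: "nat \<Rightarrow> array \<Rightarrow> stm" where
  "addr_code d b = Sq (IfPos (tmp_addr d) (block [Const scratch 1]) (block [Const (tmp_addr d) 0]))
     (block [Add (tmp_addr d) (tmp_addr d) (tmp_addr d), Add (tmp_addr d) (tmp_addr d) (tmp_addr d),
       Add (tmp_addr d) (tmp_addr d) (tmp_addr d), Const (tmp_addr (d + 1)) (int (array_off b)),
       Add (tmp_addr d) (tmp_addr d) (tmp_addr (d + 1))])"

lemma triple_addr_code:
  assumes "\<And>Y. (\<And>k. k \<noteq> tmp_addr d \<Longrightarrow> k \<noteq> tmp_addr (d + 1) \<Longrightarrow> k \<noteq> scratch \<Longrightarrow> Y k = X k) \<Longrightarrow>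
    Y (tmp_addr d) = int (arr_addr b (nat (X (tmp_addr d)))) \<Longrightarrow> Q Y"
  shows "triple w (addr_code d b) X 10 Q"
proof -
  define R where "R Y \<longleftrightarrow> (\<forall>k. k \<noteq> tmp_addr d \<longrightarrow> k \<noteq> scratch \<longrightarrow> Y k = X k) \<and>
    Y (tmp_addr d) = int (nat (X (tmp_addr d)))" for Y
  have "triple w (IfPos (tmp_addr d) (block [Const scratch 1]) (block [Const (tmp_addr d) 0])) X (1 + 1 + 3) R"
    by (rule triple_IfPos; rule triple_block) (simp_all add: R_def)
  then have "triple w (addr_code d b) X ((1 + 1 + 3) + 5) Q"
    unfolding addr_code_def
  proof (rule triple_Sq)
    fix Y assume "R Y"
    let ?is = "[Add (tmp_addr d) (tmp_addr d) (tmp_addr d), Add (tmp_addr d) (tmp_addr d) (tmp_addr d),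
       Add (tmp_addr d) (tmp_addr d) (tmp_addr d), Const (tmp_addr (d + 1)) (int (array_off b)),
       Add (tmp_addr d) (tmp_addr d) (tmp_addr (d + 1))]"
    show "triple w (block ?is) Y 5 Q"
      by (rule triple_block) (use \<open>R Y\<close> in \<open>auto intro!: assms simp: R_def arr_addr_def\<close>)
  qed
  then show ?thesis by simp
qed

text \<open>The value is left in temporary \<open>d\<close>; those below \<open>d\<close> are
  preserved, those above are free. In \<open>Bits\<close>, \<open>d + 1\<close> runs through the
  powers of two, \<open>d + 2\<close> counts them, \<open>d + 3\<close> is the test and
  \<open>d + 4\<close> the constant \<open>1\<close>. In \<open>Sum\<close>, \<open>d\<close>
  accumulates, \<open>d + 1\<close> saves the variable \<open>x\<close>, which is itself used as the
  index, and \<open>d + 2\<close> is the number of iterations left.\<close>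

primrec aexp_code :: "nat \<Rightarrow> aexp \<Rightarrow> stm" where
  "aexp_code d (Num c) = block [Const (tmp_addr d) c]"
| "aexp_code d (Var x) = block (copy (tmp_addr d) (var_addr x))"
| "aexp_code d (Plus e f) = Sq (aexp_code d e) (Sq (aexp_code (d + 1) f)
     (block [Add (tmp_addr d) (tmp_addr d) (tmp_addr (d + 1))]))"
| "aexp_code d (Minus e f) = Sq (aexp_code d e) (Sq (aexp_code (d + 1) f)
     (block [Sub (tmp_addr d) (tmp_addr d) (tmp_addr (d + 1))]))"
| "aexp_code d (Arr b e) = Sq (aexp_code d e) (Sq (addr_code d b)
     (block [Load (tmp_addr d) (tmp_addr d)]))"
| "aexp_code d (Inp e) = Sq (aexp_code d e) (block [Read (tmp_addr d) (tmp_addr d)])"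
| "aexp_code d Len = block [InputLength (tmp_addr d)]"
| "aexp_code d (Bits e) = Sq (aexp_code d e) (Sq (block [Read (tmp_addr d) (tmp_addr d)])
     (Sq (IfPos (tmp_addr d) (block [Const scratch 1])
            (block [Const (tmp_addr (d + 1)) 0, Sub (tmp_addr d) (tmp_addr (d + 1)) (tmp_addr d)]))
     (Sq (block [Const (tmp_addr (d + 1)) 1, Const (tmp_addr (d + 2)) 0, Const (tmp_addr (d + 4)) 1,
            Sub (tmp_addr (d + 3)) (tmp_addr d) (tmp_addr (d + 1)),
            Add (tmp_addr (d + 3)) (tmp_addr (d + 3)) (tmp_addr (d + 4))])
     (Sq (WhilePos (tmp_addr (d + 3))
            (block [Add (tmp_addr (d + 1)) (tmp_addr (d + 1)) (tmp_addr (d + 1)),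
              Add (tmp_addr (d + 2)) (tmp_addr (d + 2)) (tmp_addr (d + 4)),
              Sub (tmp_addr (d + 3)) (tmp_addr d) (tmp_addr (d + 1)),
              Add (tmp_addr (d + 3)) (tmp_addr (d + 3)) (tmp_addr (d + 4))]))
         (block (copy (tmp_addr d) (tmp_addr (d + 2))))))))"
| "aexp_code d (Ite e f g) =
     Sq (aexp_code d e) (IfPos (tmp_addr d) (aexp_code d f) (aexp_code d g))"
| "aexp_code d (Sum x e) =
     Sq (block ([Const (tmp_addr d) 0] @ copy (tmp_addr (d + 1)) (var_addr x) @
           copy (tmp_addr (d + 2)) bound_addr @ [Const (var_addr x) 0]))
     (Sq (WhilePos (tmp_addr (d + 2)) (Sq (aexp_code (d + 3) e)
           (block [Add (tmp_addr d) (tmp_addr d) (tmp_addr (d + 3)), Const (tmp_addr (d + 3)) 1,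
             Add (var_addr x) (var_addr x) (tmp_addr (d + 3)),
             Sub (tmp_addr (d + 2)) (tmp_addr (d + 2)) (tmp_addr (d + 3))])))
         (block (copy (var_addr x) (tmp_addr (d + 1)))))"

text \<open>Polynomials in a number that bounds the loop bound as well as the bit size of the input:
  \<open>Sum\<close> iterates as often as the former says, \<open>Bits\<close> at most as often as
  the latter.\<close>

primrec aexp_time :: "aexp \<Rightarrow> nat poly" where
  "aexp_time (Num c) = [:1:]"
| "aexp_time (Var x) = [:2:]"
| "aexp_time (Plus e f) = aexp_time e + (aexp_time f + [:1:])"
| "aexp_time (Minus e f) = aexp_time e + (aexp_time f + [:1:])"
| "aexp_time (Arr b e) = aexp_time e + [:11:]"
| "aexp_time (Inp e) = aexp_time e + [:1:]"
| "aexp_time Len = [:1:]"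
| "aexp_time (Bits e) = aexp_time e + [:17, 7:]"
| "aexp_time (Ite e f g) = aexp_time e + (aexp_time f + aexp_time g + [:3:])"
| "aexp_time (Sum x e) = [:11:] + [:0, 1:] * (aexp_time e + [:7:])"

text \<open>This makes the doubling loop for \<open>Bits\<close> a bit counter: its test
  \<open>2 ^ i <= m\<close> succeeds for precisely the first \<open>floorlog 2 m\<close> values of
  \<open>i\<close>.\<close>

lemma less_floorlog_iff: "i < floorlog 2 m \<longleftrightarrow> 2 ^ i \<le> m"
proof (cases "m = 0")
  case False
  then have *: "2 ^ (floorlog 2 m - 1) \<le> m" "m < 2 ^ floorlog 2 m"
    using floorlog_bounds[of m 2] by simp_all
  show ?thesis
  proof
    assume "i < floorlog 2 m"
    then have "(2::nat) ^ i \<le> 2 ^ (floorlog 2 m - 1)" by (intro power_increasing) auto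
    with * show "2 ^ i \<le> m" by linarith
  next
    assume "2 ^ i \<le> m"
    with * have "(2::nat) ^ i < 2 ^ floorlog 2 m" by linarith
    then show "i < floorlog 2 m" by simp
  qed
qed (simp add: floorlog_def)

lemma floorlog_input_le: "floorlog 2 (nat \<bar>input_at w k\<bar>) \<le> input_size w"
proof (cases "k < length w")
  case True
  then show ?thesis
    using int_size_le_input_size[OF True] by (simp add: input_at_def int_size_def)
qed (simp add: input_at_def floorlog_def)

definition temps_kept :: "nat \<Rightarrow> memory \<Rightarrow> memory \<Rightarrow> bool" where
  "temps_kept d X Y \<longleftrightarrow> (\<forall>d'<d. Y (tmp_addr d') = X (tmp_addr d'))"

definition aexp_post where
  "aexp_post N v a d X z Y \<longleftrightarrow> repr N v a Y \<and> Y (tmp_addr d) = z \<and> temps_kept d X Y"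

lemma triple_bits:
  assumes X: "repr N v a X" and I: "input_size w \<le> I"
    and e: "triple w (aexp_code d e) X T (aexp_post N v a d X z)"
  shows "triple w (aexp_code d (Bits e)) X (T + (17 + 7 * I)) (aexp_post N v a d X (int (floorlog 2 (nat \<bar>input_at w (nat z)\<bar>))))"
proof -
  let ?m = "nat \<bar>input_at w (nat z)\<bar>"
  let ?n = "floorlog 2 ?m"
  let ?Q = "aexp_post N v a d X (int ?n)"
  \<comment> \<open>Over the integers, \<open>m - 2 ^ i + 1\<close> is positive if and only if
    \<open>2 ^ i <= m\<close>; this is the content of the test register
    \<open>d + 3\<close>.\<close>
  define P where "P i Y \<longleftrightarrow> repr N v a Y \<and> temps_kept d X Y \<and> Y (tmp_addr d) = int ?m \<and>
     Y (tmp_addr (d + 1)) = 2 ^ i \<and> Y (tmp_addr (d + 2)) = int i \<and> Y (tmp_addr (d + 4)) = 1 \<and>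
     Y (tmp_addr (d + 3)) = int ?m - 2 ^ i + 1" for i :: nat and Y
  have pos: "int ?m - 2 ^ i + 1 > 0 \<longleftrightarrow> i < ?n" for i
  proof -
    have "int ?m - 2 ^ i + 1 > 0 \<longleftrightarrow> int (2 ^ i) \<le> int ?m" by auto
    also have "\<dots> \<longleftrightarrow> 2 ^ i \<le> ?m" by (rule of_nat_le_iff)
    finally show ?thesis by (simp only: less_floorlog_iff)
  qed
  have "triple w (aexp_code d (Bits e)) X (T + (1 + ((1 + 2 + 3) + (5 + ((?n * (4 + 3) + 3) + 2))))) ?Q"
    unfolding aexp_code.simps
    apply (rule triple_Sq[OF e])
    apply (rule triple_Sq[where R = "aexp_post N v a d X (input_at w (nat z))"])
     apply (rule triple_block)
        apply (simp_all add: aexp_post_def temps_kept_def)[4]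
    apply (rule triple_Sq[where R = "aexp_post N v a d X (int ?m)"])
     apply (rule triple_IfPos; rule triple_block)
            apply (simp_all add: aexp_post_def temps_kept_def)[8]
    apply (rule triple_Sq[where R = "P 0"])
     apply (rule triple_block)
        apply (simp_all add: aexp_post_def temps_kept_def P_def)[4]
    apply (rule triple_Sq[where R = "P ?n"])
     apply (rule triple_WhilePos[where P = P])
       apply assumption
      apply (rule conjI)
    subgoal for Ya Yb Yc Yd i Y
      using pos[of i] by (simp add: P_def)
      apply (rule triple_block)
         apply (simp_all add: P_def temps_kept_def)[4]
    subgoal for Ya Yb Yc Yd Y
      using pos[of ?n] by (simp add: P_def temps_kept_def)
    apply (rule triple_block)
       apply (simp_all add: aexp_post_def temps_kept_def P_def copy_def)[4]
    done
  then show ?thesis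
    by (rule triple_weaken) (use floorlog_input_le[of w "nat z"] I in auto)
qed

lemma triple_sum:
  assumes X: "repr N v a X" and N: "N \<le> I"
    and e: "\<And>i Y. repr N (v(x := int i)) a Y \<Longrightarrow>
      triple w (aexp_code (d + 3) e) Y T (aexp_post N (v(x := int i)) a (d + 3) Y (z i))"
  shows "triple w (aexp_code d (Sum x e)) X (11 + I * (T + 7)) (aexp_post N v a d X (\<Sum>i<N. z i))"
proof -
  \<comment> \<open>The variable \<open>x\<close> changes with the iterations, and the valuation in
    the invariant with it; the old value, kept in temporary \<open>d + 1\<close>, is restored at the
    end.\<close>
  define P where "P i Y \<longleftrightarrow> repr N (v(x := int i)) a Y \<and> temps_kept d X Y \<and>
    Y (tmp_addr d) = (\<Sum>j<i. z j) \<and> Y (tmp_addr (d + 1)) = v x \<and>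
    Y (tmp_addr (d + 2)) = int N - int i" for i Y
  have body: "triple w (Sq (aexp_code (d + 3) e)
           (block [Add (tmp_addr d) (tmp_addr d) (tmp_addr (d + 3)), Const (tmp_addr (d + 3)) 1,
             Add (var_addr x) (var_addr x) (tmp_addr (d + 3)),
             Sub (tmp_addr (d + 2)) (tmp_addr (d + 2)) (tmp_addr (d + 3))]))
     Y (T + 4) (\<lambda>Z. P (Suc i) (Z(scratch := 1)))" if "P i Y" for i Y
  proof (rule triple_Sq[OF e])
    show "repr N (v(x := int i)) a Y" using that by (simp add: P_def)
    fix Z assume Z: "aexp_post N (v(x := int i)) a (d + 3) Y (z i) Z"
    have vx: "Z (var_addr x) = int i"
      using Z repr_var[of N "v(x := int i)" a Z x] by (simp add: aexp_post_def)
    have kept: "temps_kept d X Z" "Z (tmp_addr d) = (\<Sum>j<i. z j)" "Z (tmp_addr (d + 1)) = v x"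
      "Z (tmp_addr (d + 2)) = int N - int i" "Z (tmp_addr (d + 3)) = z i"
      using Z that by (simp_all add: P_def aexp_post_def temps_kept_def)
    show "triple w (block [Add (tmp_addr d) (tmp_addr d) (tmp_addr (d + 3)), Const (tmp_addr (d + 3)) 1,
             Add (var_addr x) (var_addr x) (tmp_addr (d + 3)),
             Sub (tmp_addr (d + 2)) (tmp_addr (d + 2)) (tmp_addr (d + 3))]) Z 4
        (\<lambda>Z. P (Suc i) (Z(scratch := 1)))"
    proof (rule triple_block)
      have "repr N (v(x := int i)) a Z" using Z by (simp add: aexp_post_def)
      then show "P (Suc i) ((foldl (\<lambda>X i. eff w i X) Z [Add (tmp_addr d) (tmp_addr d) (tmp_addr (d + 3)),
          Const (tmp_addr (d + 3)) 1, Add (var_addr x) (var_addr x) (tmp_addr (d + 3)),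
          Sub (tmp_addr (d + 2)) (tmp_addr (d + 2)) (tmp_addr (d + 3))])(scratch := 1))"
        using kept vx by (simp add: P_def temps_kept_def repr_def)
    qed simp_all
  qed
  have "triple w (aexp_code d (Sum x e)) X (6 + ((N * ((T + 4) + 3) + 3) + 2)) (aexp_post N v a d X (\<Sum>i<N. z i))"
    unfolding aexp_code.simps
    apply (rule triple_Sq[where R = "P 0"])
     apply (rule triple_block)
    using X apply (simp_all add: copy_def P_def temps_kept_def repr_def)[4]
    apply (rule triple_Sq[where R = "P N"])
     apply (rule triple_WhilePos[where P = P])
       apply assumption
      apply (rule conjI)
       apply (simp add: P_def)
      apply (erule body)
     apply (simp add: P_def temps_kept_def)
    apply (rule triple_block)
       apply (simp_all add: copy_def)[2]
     defer
     apply (simp add: copy_def)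
    subgoal for Y Z
      using repr_upd_var'[of N v x "int N" a Z "v x"]
      by (simp add: P_def copy_def aexp_post_def temps_kept_def)
    done
  then show ?thesis
    by (rule triple_weaken) (use N in \<open>auto simp: algebra_simps intro: add_mono mult_right_mono\<close>)
qed

text \<open>\<open>N\<close> and \<open>I\<close> are separate because the bit size of the input is
  computed while the loop bound is still the length of the input.\<close>

lemma triple_aexp:
  assumes "repr N v a X" "N \<le> I" "input_size w \<le> I"
  shows "triple w (aexp_code d e) X (poly (aexp_time e) I) (aexp_post N v a d X (aval w N a e v))"
  using assms(1)
proof (induction e arbitrary: d v X)
  case (Num c)
  show ?case
    unfolding aexp_code.simps by (rule triple_block) (use Num in \<open>simp_all add: aexp_post_def temps_kept_def repr_def\<close>)
next
  case (Var x)
  show ?case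
    unfolding aexp_code.simps
    by (rule triple_block) (use Var in \<open>simp_all add: copy_def aexp_post_def temps_kept_def repr_def\<close>)
next
  case (Plus e f)
  have "triple w (aexp_code d (Plus e f)) X (poly (aexp_time e) I + (poly (aexp_time f) I + 1))
    (aexp_post N v a d X (aval w N a (Plus e f) v))"
    unfolding aexp_code.simps
    apply (rule triple_Sq[OF Plus.IH(1)[OF Plus.prems]])
    apply (rule triple_Sq[OF Plus.IH(2)[where v = v]])
     apply (simp add: aexp_post_def)
    apply (rule triple_block)
       apply (simp_all add: aexp_post_def temps_kept_def)
    done
  then show ?case by simp
next
  case (Minus e f)
  have "triple w (aexp_code d (Minus e f)) X (poly (aexp_time e) I + (poly (aexp_time f) I + 1))
    (aexp_post N v a d X (aval w N a (Minus e f) v))"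
    unfolding aexp_code.simps
    apply (rule triple_Sq[OF Minus.IH(1)[OF Minus.prems]])
    apply (rule triple_Sq[OF Minus.IH(2)[where v = v]])
     apply (simp add: aexp_post_def)
    apply (rule triple_block)
       apply (simp_all add: aexp_post_def temps_kept_def)
    done
  then show ?case by simp
next
  case (Arr b e)
  let ?z = "aval w N a e v"
  have "triple w (aexp_code d (Arr b e)) X (poly (aexp_time e) I + (10 + 1))
    (aexp_post N v a d X (aval w N a (Arr b e) v))"
    unfolding aexp_code.simps
    apply (rule triple_Sq[OF Arr.IH[OF Arr.prems]])
    apply (rule triple_Sq[where R = "aexp_post N v a d X (int (arr_addr b (nat ?z)))"])
     apply (rule triple_addr_code)
     apply (simp add: aexp_post_def temps_kept_def repr_def)
    apply (rule triple_block)
       apply (auto simp add: aexp_post_def temps_kept_def repr_def)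
    done
  then show ?case by simp
next
  case (Inp e)
  have "triple w (aexp_code d (Inp e)) X (poly (aexp_time e) I + 1)
    (aexp_post N v a d X (aval w N a (Inp e) v))"
    unfolding aexp_code.simps
    apply (rule triple_Sq[OF Inp.IH[OF Inp.prems]])
    apply (rule triple_block)
       apply (simp_all add: aexp_post_def temps_kept_def)
    done
  then show ?case by simp
next
  case Len
  show ?case
    unfolding aexp_code.simps by (rule triple_block) (use Len in \<open>simp_all add: aexp_post_def temps_kept_def repr_def\<close>)
next
  case (Bits e)
  from triple_bits[OF Bits.prems assms(3) Bits.IH[OF Bits.prems]]
  show ?case by (simp add: algebra_simps del: aexp_code.simps)
next
  case (Ite e f g)
  have "triple w (aexp_code d (Ite e f g)) X
    (poly (aexp_time e) I + (poly (aexp_time f) I + poly (aexp_time g) I + 3))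
    (aexp_post N v a d X (aval w N a (Ite e f g) v))"
    unfolding aexp_code.simps
    apply (rule triple_Sq[OF Ite.IH(1)[OF Ite.prems]])
    apply (rule triple_IfPos)
    subgoal premises p for Y
      apply (rule triple_weaken[OF Ite.IH(2)])
      using p by (auto simp: aexp_post_def temps_kept_def)
    subgoal premises p for Y
      apply (rule triple_weaken[OF Ite.IH(3)])
      using p by (auto simp: aexp_post_def temps_kept_def)
    done
  then show ?case by simp
next
  case (Sum x e)
  have "triple w (aexp_code d (Sum x e)) X (11 + I * (poly (aexp_time e) I + 7))
    (aexp_post N v a d X (\<Sum>i<N. aval w N a e (v(x := int i))))"
    by (rule triple_sum[OF Sum.prems assms(2)]) (rule Sum.IH)
  then show ?case by simp
qed

section \<open>Compilation of commands\<close>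

primrec com_code :: "nat \<Rightarrow> com \<Rightarrow> stm" where
  "com_code d Skip = block []"
| "com_code d (Assign x e) = Sq (aexp_code d e) (block (copy (var_addr x) (tmp_addr d)))"
| "com_code d (Put b e f) = Sq (aexp_code d f) (Sq (aexp_code (d + 1) e) (Sq (addr_code (d + 1) b)
     (block [Store (tmp_addr (d + 1)) (tmp_addr d)])))"
| "com_code d (Seq c c') = Sq (com_code d c) (com_code d c')"
| "com_code d (Cond e c c') = Sq (aexp_code d e) (IfPos (tmp_addr d) (com_code d c) (com_code d c'))"
| "com_code d (For x c) =
     Sq (block (copy (tmp_addr d) bound_addr @ [Const (tmp_addr (d + 1)) 0]))
        (WhilePos (tmp_addr d) (Sq (block (copy (var_addr x) (tmp_addr (d + 1)))) (Sq (com_code (d + 2) c)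
           (block [Const (tmp_addr (d + 2)) 1, Add (tmp_addr (d + 1)) (tmp_addr (d + 1)) (tmp_addr (d + 2)),
             Sub (tmp_addr d) (tmp_addr d) (tmp_addr (d + 2))]))))"

primrec com_time :: "com \<Rightarrow> nat poly" where
  "com_time Skip = [:1:]"
| "com_time (Assign x e) = aexp_time e + [:2:]"
| "com_time (Put b e f) = aexp_time f + (aexp_time e + [:11:])"
| "com_time (Seq c d) = com_time c + com_time d"
| "com_time (Cond e c d) = aexp_time e + (com_time c + com_time d + [:3:])"
| "com_time (For x c) = [:6:] + [:0, 1:] * (com_time c + [:8:])"

definition com_post where
  "com_post N s d X Y \<longleftrightarrow> repr N (fst s) (snd s) Y \<and> temps_kept d X Y"

text \<open>Iterations are counted in two temporaries, and the index is copied to \<open>x\<close>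
  at the start of each one. The body may therefore assign \<open>x\<close> without affecting the
  number of iterations.\<close>

lemma triple_for:
  assumes X: "repr N (fst s) (snd s) X" and N: "N \<le> I"
    and c: "\<And>s Y. repr N (fst s) (snd s) Y \<Longrightarrow> triple w (com_code (d + 2) c) Y T (com_post N (exec w N c s) (d + 2) Y)"
  shows "triple w (com_code d (For x c)) X (6 + I * (T + 8)) (com_post N (exec w N (For x c) s) d X)"
proof -
  let ?f = "\<lambda>i s. exec w N c ((fst s)(x := int i), snd s)"
  define S where "S i = fold ?f [0..<i] s" for i
  define P where "P i Y \<longleftrightarrow> repr N (fst (S i)) (snd (S i)) Y \<and> temps_kept d X Y \<and>
    Y (tmp_addr d) = int N - int i \<and> Y (tmp_addr (d + 1)) = int i" for i Y
  have S: "S (Suc i) = exec w N c ((fst (S i))(x := int i), snd (S i))" for i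
    by (simp add: S_def)
  have body: "triple w (Sq (block (copy (var_addr x) (tmp_addr (d + 1)))) (Sq (com_code (d + 2) c)
           (block [Const (tmp_addr (d + 2)) 1, Add (tmp_addr (d + 1)) (tmp_addr (d + 1)) (tmp_addr (d + 2)),
             Sub (tmp_addr d) (tmp_addr d) (tmp_addr (d + 2))]))) Y (2 + (T + 3))
     (\<lambda>Z. P (Suc i) (Z(scratch := 1)))" if "P i Y" for i Y
    apply (rule triple_Sq[where R = "\<lambda>Z. repr N ((fst (S i))(x := int i)) (snd (S i)) Z \<and>
         temps_kept d X Z \<and> Z (tmp_addr d) = int N - int i \<and> Z (tmp_addr (d + 1)) = int i"])
     apply (rule triple_block)
    using that repr_upd_var[of N "fst (S i)" "snd (S i)" Y x "int i"] repr_upd_var'[of N "fst (S i)" x 0 "snd (S i)" "Y(var_addr x := 0)" "int i"]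
        repr_upd_var[of N "fst (S i)" "snd (S i)" Y x 0]
        apply (simp_all add: P_def copy_def temps_kept_def)[4]
    apply (rule triple_Sq[OF c[where s = "((fst (S i))(x := int i), snd (S i))"]])
     apply simp
    apply (rule triple_block)
       apply (auto simp: P_def S com_post_def temps_kept_def)
    done
  have "triple w (com_code d (For x c)) X (3 + (N * ((2 + (T + 3)) + 3) + 3)) (com_post N (exec w N (For x c) s) d X)"
    unfolding com_code.simps
    apply (rule triple_Sq[where R = "P 0"])
     apply (rule triple_block)
    using X apply (simp_all add: copy_def P_def temps_kept_def repr_bound S_def)[4]
    apply (rule triple_WhilePos[where P = P])
      apply assumption
     apply (rule conjI)
      apply (simp add: P_def)
     apply (erule body)
    apply (auto simp add: P_def temps_kept_def com_post_def S_def)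
    done
  then show ?thesis
    by (rule triple_weaken) (use N in \<open>auto simp: algebra_simps intro: add_mono mult_right_mono\<close>)
qed

lemma triple_com:
  assumes "repr N (fst s) (snd s) X" "N \<le> I" "input_size w \<le> I"
  shows "triple w (com_code d c) X (poly (com_time c) I) (com_post N (exec w N c s) d X)"
  using assms(1)
proof (induction c arbitrary: d s X)
  case Skip
  have "triple w (block [Const scratch 1]) X 1 (com_post N s d X)"
    by (rule triple_block) (use Skip in \<open>simp_all add: com_post_def temps_kept_def\<close>)
  then show ?case by simp
next
  case (Assign x e)
  have "triple w (com_code d (Assign x e)) X (poly (aexp_time e) I + 2) (com_post N (exec w N (Assign x e) s) d X)"
    unfolding com_code.simps
    apply (rule triple_Sq[OF triple_aexp[OF Assign assms(2,3)]])
    apply (rule triple_block)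
       apply (simp_all add: copy_def com_post_def temps_kept_def aexp_post_def repr_def)
    done
  then show ?case by simp
next
  case (Put b e f)
  have "triple w (com_code d (Put b e f)) X (poly (aexp_time f) I + (poly (aexp_time e) I + (10 + 1)))
    (com_post N (exec w N (Put b e f) s) d X)"
    unfolding com_code.simps
    apply (rule triple_Sq[OF triple_aexp[OF Put assms(2,3)]])
    apply (rule triple_Sq[OF triple_aexp[where v = "fst s" and a = "snd s", OF _ assms(2,3)]])
     apply (simp add: aexp_post_def)
    apply (rule triple_Sq[where R = "\<lambda>Y. repr N (fst s) (snd s) Y \<and> temps_kept d X Y \<and>
        Y (tmp_addr d) = aval w N (snd s) f (fst s) \<and>
        Y (tmp_addr (d + 1)) = int (arr_addr b (nat (aval w N (snd s) e (fst s))))"])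
     apply (rule triple_addr_code)
     apply (simp add: aexp_post_def temps_kept_def repr_def)
    apply (rule triple_block)
       apply (simp_all add: com_post_def temps_kept_def repr_upd_arr)
    done
  then show ?case by simp
next
  case (Seq c c')
  show ?case
    unfolding com_code.simps com_time.simps poly_add
    apply (rule triple_Sq[OF Seq.IH(1)[OF Seq.prems]])
    apply (rule triple_weaken[OF Seq.IH(2)])
    by (auto simp: com_post_def temps_kept_def)
next
  case (Cond e c c')
  have "triple w (com_code d (Cond e c c')) X
    (poly (aexp_time e) I + (poly (com_time c) I + poly (com_time c') I + 3))
    (com_post N (exec w N (Cond e c c') s) d X)"
    unfolding com_code.simps
    apply (rule triple_Sq[OF triple_aexp[OF Cond.prems assms(2,3)]])
    apply (rule triple_IfPos)
    subgoal premises p for Y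
      apply (rule triple_weaken[OF Cond.IH(1)])
      using p by (auto simp: aexp_post_def com_post_def temps_kept_def)
    subgoal premises p for Y
      apply (rule triple_weaken[OF Cond.IH(2)])
      using p by (auto simp: aexp_post_def com_post_def temps_kept_def)
    done
  then show ?case by simp
next
  case (For x c)
  have "triple w (com_code d (For x c)) X (6 + I * (poly (com_time c) I + 8))
    (com_post N (exec w N (For x c) s) d X)"
    by (rule triple_for[OF For.prems assms(2)]) (rule For.IH)
  then show ?case by simp
qed

section \<open>The compiled program and its running time\<close>

definition size_exp :: aexp where
  "size_exp = Sum 0 (Ite (Minus Len (Var 0)) (Plus (Num 1) (Bits (Var 0))) (Num 0))"

lemma input_size_conv: "input_size w = (\<Sum>i<length w. int_size (w ! i))"
  by (simp add: input_size_def sum_list_sum_nth atLeast0LessThan)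

lemma aval_size_exp: "aval w (length w) a size_exp v = int (input_size w)"
  by (simp add: size_exp_def input_size_conv int_size_def input_at_def)

definition init_code :: stm where
  "init_code = Sq (block [InputLength bound_addr]) (Sq (aexp_code 0 size_exp)
     (block (copy bound_addr (tmp_addr 0))))"

text \<open>Variable \<open>0\<close> carries the verdict: the last jump skips over
  \<open>Reject\<close>.\<close>

definition program :: "com \<Rightarrow> instr list" where
  "program c = (let cs = code 0 (Sq init_code (com_code 0 c)) in
     cs @ [JumpPos (var_addr 0) (length cs + 2), Reject, Accept])"

definition start :: state where "start = (\<lambda>_. 0, \<lambda>_ _. 0)"

text \<open>The semantics \<open>exec\<close> is total, and the time polynomial of a command does
  not depend on the data. Only the correctness of the result remains to be shown about a concrete
  program.\<close>

theorem polynomial_time_decidable_exec: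
  assumes "\<And>w. w \<in> L \<longleftrightarrow> fst (exec w (input_size w) c start) 0 > 0"
  shows "polynomial_time_decidable L"
proof (rule polynomial_time_decidableI)
  fix w
  let ?N = "input_size w"
  let ?X = "\<lambda>_::nat. 0::int"
  have "triple w (Sq init_code (com_code 0 c)) ?X ((1 + (poly (aexp_time size_exp) ?N + 2)) + poly (com_time c) ?N)
    (com_post ?N (exec w ?N c start) 0 ?X)"
    unfolding init_code_def
    apply (rule triple_Sq[where R = "repr ?N (\<lambda>_. 0) (\<lambda>_ _. 0)"])
     apply (rule triple_Sq[where R = "repr (length w) (\<lambda>_. 0) (\<lambda>_ _. 0)"])
      apply (rule triple_block)
         apply (simp_all add: repr_def)[4]
     apply (rule triple_Sq[OF triple_aexp[OF _ length_le_input_size order.refl]])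
      apply assumption
     apply (rule triple_block)
        apply (simp_all add: copy_def aval_size_exp aexp_post_def repr_def)[4]
    apply (rule triple_weaken[OF triple_com[OF _ order.refl order.refl, where s = start]])
      apply (simp add: start_def)
     apply (auto simp: com_post_def temps_kept_def)
    done
  then obtain n Y where Y: "bs w (Sq init_code (com_code 0 c)) ?X n Y" "repr ?N (fst (exec w ?N c start)) (snd (exec w ?N c start)) Y"
    "n \<le> (1 + (poly (aexp_time size_exp) ?N + 2)) + poly (com_time c) ?N"
    unfolding triple_def com_post_def by blast
  define cs where "cs = code 0 (Sq init_code (com_code 0 c))"
  have P: "program c = cs @ [JumpPos (var_addr 0) (length cs + 2), Reject, Accept]"
    by (simp add: program_def cs_def Let_def)
  have "occurs (program c) 0 cs"
    unfolding occurs_def P by auto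
  from steps_code[OF Y(1) this[unfolded cs_def]]
  have "steps (program c) w (0, ?X) n (length cs, Y)"
    by (simp add: cs_def)
  moreover have "occurs (program c) (length cs) [JumpPos (var_addr 0) (length cs + 2)]"
    by (simp add: occurs_single P)
  note steps_jump[OF this, of w Y]
  moreover have "Y (var_addr 0) > 0 \<longleftrightarrow> w \<in> L"
    using assms[of w] repr_var[OF Y(2), of 0] by simp
  ultimately have st: "steps (program c) w (0, ?X) (n + 1) (if w \<in> L then length cs + 2 else Suc (length cs), Y)"
    using steps_trans by (metis (full_types))
  \<comment> \<open>The constant \<open>4\<close> collects the three instructions that set the loop
    bound and the final jump.\<close>
  have "n + 1 \<le> poly (aexp_time size_exp + com_time c + [:4:]) ?N"
    using Y(3) by simp
  moreover have "(if w \<in> L then length cs + 2 else Suc (length cs)) < length (program c)"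
    "program c ! (if w \<in> L then length cs + 2 else Suc (length cs)) = (if w \<in> L then Accept else Reject)"
    by (simp_all add: P nth_append)
  ultimately show "\<exists>n pc X. steps (program c) w (0, ?X) n (pc, X) \<and>
      n \<le> poly (aexp_time size_exp + com_time c + [:4:]) ?N \<and>
      pc < length (program c) \<and> program c ! pc = (if w \<in> L then Accept else Reject)"
    using st by blast
qed

section \<open>Positive closed walks and the Bellman-Ford algorithm\<close>

type_synonym 'a wgraph = "('a \<times> 'a \<times> int) set"

inductive walk :: "'a wgraph \<Rightarrow> 'a \<Rightarrow> nat \<Rightarrow> int \<Rightarrow> 'a \<Rightarrow> bool" for E where
  walk_refl: "walk E u 0 0 u"
| walk_step: "walk E u n a v \<Longrightarrow> (v, v', c) \<in> E \<Longrightarrow> walk E u (Suc n) (a + c) v'"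

definition positive_walk :: "'a wgraph \<Rightarrow> 'a \<Rightarrow> bool" where
  "positive_walk E s \<longleftrightarrow> (\<exists>u n a m b. walk E s n a u \<and> walk E u m b u \<and> b > 0)"

lemma walk_append: "walk E v m b x \<Longrightarrow> walk E u n a v \<Longrightarrow> walk E u (n + m) (a + b) x"
proof (induction rule: walk.induct)
  case (walk_step v m b x x' c)
  from walk.walk_step[OF walk_step.IH[OF walk_step.prems] walk_step.hyps(2)]
  show ?case by (simp add: add.assoc)
qed simp

lemma walk_edge: "(u, v, c) \<in> E \<Longrightarrow> walk E u 1 c v"
  using walk_step[OF walk_refl, of u v c E] by simp

text \<open>The function \<open>c\<close> records the weight accumulated so far. The weight of any
  part of the walk is then a difference of two values, which is what cutting out cycles
  needs.\<close>

lemma walk_path: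
  "walk E u n a v \<Longrightarrow> \<exists>f c. f 0 = u \<and> f n = v \<and> c 0 = 0 \<and> c n = a \<and>
     (\<forall>i<n. (f i, f (Suc i), c (Suc i) - c i) \<in> E)"
proof (induction rule: walk.induct)
  case (walk_refl u)
  show ?case by (intro exI[of _ "\<lambda>_. u"] exI[of _ "\<lambda>_. 0"]) simp
next
  case (walk_step u n a v v' c')
  then obtain f c where f: "f 0 = u" "f n = v" "c 0 = 0" "c n = a"
    "\<forall>i<n. (f i, f (Suc i), c (Suc i) - c i) \<in> E" by blast
  have "((f(Suc n := v')) i, (f(Suc n := v')) (Suc i),
      (c(Suc n := a + c')) (Suc i) - (c(Suc n := a + c')) i) \<in> E" if "i < Suc n" for i
    using f walk_step.hyps(2) that by (cases "i = n") simp_all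
  then show ?case
    using f by (intro exI[of _ "f(Suc n := v')"] exI[of _ "c(Suc n := a + c')"]) simp
qed

lemma path_walk:
  fixes c :: "nat \<Rightarrow> int"
  assumes "\<And>i. j \<le> i \<Longrightarrow> i < k \<Longrightarrow> (f i, f (Suc i), c (Suc i) - c i) \<in> E" "j \<le> k"
  shows "walk E (f j) (k - j) (c k - c j) (f k)"
  using assms
proof (induction k)
  case 0
  then show ?case by (simp add: walk_refl)
next
  case (Suc k)
  show ?case
  proof (cases "j = Suc k")
    case True
    then show ?thesis by (simp add: walk_refl)
  next
    case False
    with Suc have "walk E (f j) (k - j) (c k - c j) (f k)" "j \<le> k" by auto
    from walk_step[OF this(1) Suc.prems(1)[OF this(2)]]
    show ?thesis using \<open>j \<le> k\<close> by (simp add: Suc_diff_le)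
  qed
qed

lemma walk_nodes: "walk E u n a v \<Longrightarrow> E \<subseteq> V \<times> V \<times> UNIV \<Longrightarrow> u \<in> V \<Longrightarrow> v \<in> V"
  by (induction rule: walk.induct) auto

text \<open>A walk with at least \<open>card V\<close> edges repeats a vertex. The closed walk in
  between is reachable from \<open>s\<close>, so its weight is not positive, and removing it does
  not decrease the total.\<close>

lemma walk_shorten:
  assumes "\<not> positive_walk E s" "E \<subseteq> V \<times> V \<times> UNIV" "finite V" "s \<in> V"
  shows "walk E s n a v \<Longrightarrow> \<exists>m b. walk E s m b v \<and> m < card V \<and> a \<le> b"
proof (induction n arbitrary: a rule: less_induct)
  case (less n)
  show ?case
  proof (cases "n < card V")
    case False
    from walk_path[OF less.prems] obtain f c where f: "f 0 = s" "f n = v" "c 0 = 0" "c n = a"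
      "\<And>i. i < n \<Longrightarrow> (f i, f (Suc i), c (Suc i) - c i) \<in> E" by blast
    have w: "walk E (f j) (k - j) (c k - c j) (f k)" if "j \<le> k" "k \<le> n" for j k
      by (rule path_walk) (use f that in auto)
    have "f ` {..n} \<subseteq> V"
    proof
      fix x assume "x \<in> f ` {..n}"
      then obtain k where "k \<le> n" "x = f k" by auto
      with walk_nodes[OF w[of 0 k] assms(2)] f assms(4) show "x \<in> V" by auto
    qed
    \<comment> \<open>The positions from \<open>0\<close> to \<open>n\<close> are one more than the
      edges, hence more than the vertices.\<close>
    from card_mono[OF assms(3) this] False have "card (f ` {..n}) < card {..n}" by simp
    then have "\<not> inj_on f {..n}" by (rule pigeonhole)
    then obtain j' k' where "j' \<le> n" "k' \<le> n" "f j' = f k'" "j' \<noteq> k'"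
      unfolding inj_on_def by auto
    then obtain j k where jk: "j < k" "k \<le> n" "f j = f k"
      by (cases "j' < k'") (metis, metis linorder_neqE_nat)
    have "c k - c j \<le> 0"
    proof (rule ccontr)
      assume "\<not> ?thesis"
      then have "c k - c j > 0" by simp
      moreover have "walk E s j (c j) (f j)" using w[of 0 j] jk f by simp
      moreover have "walk E (f j) (k - j) (c k - c j) (f j)" using w[of j k] jk by simp
      ultimately have "positive_walk E s"
        unfolding positive_walk_def by blast
      with assms(1) show False by simp
    qed
    have "walk E s (j + (n - k)) (c j + (a - c k)) v"
      by (rule walk_append[of E "f j"]) (use w[of 0 j] w[of k n] jk f in simp_all)
    moreover have "j + (n - k) < n" using jk by linarith
    ultimately obtain m b where "walk E s m b v" "m < card V" "c j + (a - c k) \<le> b"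
      using less.IH by blast
    with \<open>c k - c j \<le> 0\<close> show ?thesis by (intro exI[of _ m] exI[of _ b]) auto
  qed (use less.prems in blast)
qed

text \<open>A labelling assigns to each vertex reached so far the weight of some walk to it; the Boolean
  component of the state records changes.\<close>

type_synonym 'a labelling = "'a \<Rightarrow> int option"

text \<open>Heaviest walks are sought: an edge relaxes when it offers more than the present label,
  and a missing label counts as minus infinity.\<close>

definition relaxes :: "'a labelling \<Rightarrow> 'a \<times> 'a \<times> int \<Rightarrow> bool" where
  "relaxes d = (\<lambda>(u, v, c). \<exists>x. d u = Some x \<and> (\<forall>y. d v = Some y \<longrightarrow> y < x + c))"

definition relax :: "'a \<times> 'a \<times> int \<Rightarrow> 'a labelling \<times> bool \<Rightarrow> 'a labelling \<times> bool" where
  "relax e s = (if relaxes (fst s) e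
     then ((fst s)(fst (snd e) \<mapsto> the (fst s (fst e)) + snd (snd e)), True) else s)"

text \<open>The flag is reset, so that after a round it tells whether this very round has changed a
  label.\<close>

definition bf_round :: "('a \<times> 'a \<times> int) list \<Rightarrow> 'a labelling \<times> bool \<Rightarrow> 'a labelling \<times> bool" where
  "bf_round es s = fold relax es (fst s, False)"

definition sound_labelling :: "'a wgraph \<Rightarrow> 'a \<Rightarrow> 'a labelling \<Rightarrow> bool" where
  "sound_labelling E s d \<longleftrightarrow> (\<forall>v x. d v = Some x \<longrightarrow> (\<exists>n. walk E s n x v))"

definition labelling_le :: "'a labelling \<Rightarrow> 'a labelling \<Rightarrow> bool" where
  "labelling_le d d' \<longleftrightarrow> (\<forall>v x. d v = Some x \<longrightarrow> (\<exists>y. d' v = Some y \<and> x \<le> y))"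

lemma labelling_le_refl: "labelling_le d d"
  by (simp add: labelling_le_def)

lemma labelling_le_trans: "labelling_le d d' \<Longrightarrow> labelling_le d' d'' \<Longrightarrow> labelling_le d d''"
  unfolding labelling_le_def by (meson order.trans)

lemma relax_le: "labelling_le (fst s) (fst (relax e s))"
  by (cases e) (auto simp: relax_def relaxes_def labelling_le_def intro: less_imp_le)

lemma fold_relax_le: "labelling_le (fst s) (fst (fold relax es s))"
proof (induction es arbitrary: s)
  case (Cons e es)
  from labelling_le_trans[OF relax_le[of s e] Cons.IH[of "relax e s"]] show ?case by simp
qed (simp add: labelling_le_refl)

text \<open>When the edge is processed, the label of \<open>u\<close> is at least its initial value,
  and the label of \<open>v\<close> is brought up accordingly; afterwards labels only grow. So one
  round extends all walks accounted for by one edge, whatever the order of the list.\<close>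

lemma fold_relax_edge:
  "(u, v, c) \<in> set es \<Longrightarrow> fst s u = Some x \<Longrightarrow> \<exists>y. fst (fold relax es s) v = Some y \<and> x + c \<le> y"
proof (induction es arbitrary: s x)
  case (Cons e es)
  show ?case
  proof (cases "e = (u, v, c)")
    case True
    obtain y where "fst (relax e s) v = Some y" "x + c \<le> y"
      using Cons.prems(2) by (cases "relaxes (fst s) e") (auto simp: True relax_def relaxes_def not_less)
    moreover from this(1) obtain z where "fst (fold relax es (relax e s)) v = Some z" "y \<le> z"
      using fold_relax_le[of "relax e s" es] unfolding labelling_le_def by blast
    ultimately show ?thesis by (intro exI[of _ z]) auto
  next
    case False
    with Cons.prems have "(u, v, c) \<in> set es" by simp
    moreover obtain y where "fst (relax e s) u = Some y" "x \<le> y"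
      using relax_le[of s e] Cons.prems(2) unfolding labelling_le_def by blast
    ultimately obtain z where "fst (fold relax es (relax e s)) v = Some z" "y + c \<le> z"
      using Cons.IH[of "relax e s" y] by blast
    with \<open>x \<le> y\<close> show ?thesis by (intro exI[of _ z]) auto
  qed
qed simp

lemma relax_sound:
  assumes "sound_labelling E s (fst t)" "e \<in> E"
  shows "sound_labelling E s (fst (relax e t))"
proof (cases "relaxes (fst t) e")
  case True
  obtain u v c where e: "e = (u, v, c)" by (cases e)
  with True obtain x where x: "fst t u = Some x" by (auto simp: relaxes_def)
  with assms(1) obtain n where "walk E s n x u" unfolding sound_labelling_def by blast
  then have "walk E s (Suc n) (x + c) v" using walk_step assms(2) e by metis
  with assms(1) True x show ?thesis
    by (auto simp: relax_def sound_labelling_def e)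
qed (use assms in \<open>simp add: relax_def\<close>)

lemma fold_relax_sound:
  "sound_labelling E s (fst t) \<Longrightarrow> set es \<subseteq> E \<Longrightarrow> sound_labelling E s (fst (fold relax es t))"
  by (induction es arbitrary: t) (auto simp: relax_sound)

lemma fold_relax_changed: "snd t \<Longrightarrow> snd (fold relax es t)"
  by (induction es arbitrary: t) (auto simp: relax_def)

text \<open>Until the first change the labelling is the initial one, so the edge responsible for
  that change relaxes the initial labelling.\<close>

lemma fold_relax_unchanged:
  "snd (fold relax es t) \<longleftrightarrow> snd t \<or> (\<exists>e \<in> set es. relaxes (fst t) e)"
proof (induction es arbitrary: t)
  case (Cons e es)
  show ?case
  proof (cases "relaxes (fst t) e")
    case True
    then have "snd (relax e t)" by (simp add: relax_def)
    then show ?thesis using fold_relax_changed[of "relax e t" es] True by simp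
  next
    case False
    then show ?thesis using Cons.IH[of t] by (simp add: relax_def)
  qed
qed simp

text \<open>After \<open>K\<close> rounds all walks with at most \<open>K\<close> edges are
  accounted for. Without positive closed walks these attain all maxima by
  \<open>walk_shorten\<close>, and the extra round changes nothing. Conversely, if it changes
  nothing, then labels dominate along every edge, and going around a closed walk of positive weight
  would force a label above itself.\<close>

theorem bellman_ford:
  fixes s :: 'a
  assumes V: "set es \<subseteq> V \<times> V \<times> UNIV" "finite V" "s \<in> V" and K: "card V \<le> K"
  shows "snd ((bf_round es ^^ Suc K) ([s \<mapsto> 0], b)) \<longleftrightarrow> positive_walk (set es) s"
proof -
  define D where "D t = fst ((bf_round es ^^ t) ([s \<mapsto> 0], b))" for t
  have D0: "D 0 = [s \<mapsto> 0]" by (simp add: D_def)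
  have DS: "D (Suc t) = fst (fold relax es (D t, False))" for t
    by (simp add: D_def bf_round_def)
  have chg: "snd ((bf_round es ^^ Suc K) ([s \<mapsto> 0], b)) \<longleftrightarrow> (\<exists>e \<in> set es. relaxes (D K) e)"
    by (simp add: D_def bf_round_def fold_relax_unchanged)
  have mono: "labelling_le (D t) (D (Suc t))" for t
    using fold_relax_le[of "(D t, False)" es] by (simp add: DS)
  have mono': "labelling_le (D t) (D (t + k))" for t k
    by (induction k) (auto simp: labelling_le_refl intro: labelling_le_trans[OF _ mono])
  have sound: "sound_labelling (set es) s (D t)" for t
  proof (induction t)
    case 0
    show ?case by (auto simp: D0 sound_labelling_def intro: walk_refl)
  next
    case (Suc t)
    then show ?case using fold_relax_sound[of "set es" s "(D t, False)" es] by (simp add: DS)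
  qed
  have reach: "\<exists>y. D n v = Some y \<and> a \<le> y" if "walk (set es) u n a v" "u = s" for u n a v
    using that
  proof (induction rule: walk.induct)
    case (walk_refl u)
    then show ?case by (simp add: D0)
  next
    case (walk_step u n a v v' c)
    then obtain y where y: "D n v = Some y" "a \<le> y" by blast
    with fold_relax_edge[OF walk_step.hyps(2), of "(D n, False)" y] obtain z where
      "D (Suc n) v' = Some z" "y + c \<le> z" by (auto simp: DS)
    with y(2) show ?case by (intro exI[of _ z]) auto
  qed
  show ?thesis
    unfolding chg
  proof
    assume "\<exists>e \<in> set es. relaxes (D K) e"
    then obtain u v c where e: "(u, v, c) \<in> set es" "relaxes (D K) (u, v, c)" by (metis prod_cases3)
    then obtain x where x: "D K u = Some x" "\<And>y. D K v = Some y \<Longrightarrow> y < x + c"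
      by (auto simp: relaxes_def)
    with sound[of K] obtain n where "walk (set es) s n x u" unfolding sound_labelling_def by blast
    from walk_step[OF this e(1)] have w: "walk (set es) s (Suc n) (x + c) v" .
    show "positive_walk (set es) s"
    proof (rule ccontr)
      assume "\<not> positive_walk (set es) s"
      from walk_shorten[OF this V w] obtain m a where m: "walk (set es) s m a v" "m < card V" "x + c \<le> a"
        by blast
      from reach[OF m(1)] obtain y where "D m v = Some y" "a \<le> y" by blast
      moreover have "labelling_le (D m) (D K)"
        using mono'[of m "K - m"] m(2) K by simp
      ultimately obtain z where "D K v = Some z" "y \<le> z" unfolding labelling_le_def by blast
      with x(2)[of z] m(3) \<open>a \<le> y\<close> show False by simp
    qed
  next
    assume "positive_walk (set es) s"
    then obtain u n a m b where w: "walk (set es) s n a u" "walk (set es) u m b u" "b > 0"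
      unfolding positive_walk_def by blast
    show "\<exists>e \<in> set es. relaxes (D K) e"
    proof (rule ccontr)
      assume stable: "\<not> ?thesis"
      have st: "\<exists>y. D K v = Some y \<and> x + c \<le> y" if "(u, v, c) \<in> set es" "D K u = Some x" for u v c x
      proof -
        from stable that(1) have "\<not> relaxes (D K) (u, v, c)" by blast
        with that(2) show ?thesis by (auto simp: relaxes_def not_less)
      qed
      have go: "\<exists>y. D K v = Some y \<and> x + b \<le> y" if "walk (set es) u m b v" "D K u = Some x" for u m b v x
        using that
      proof (induction rule: walk.induct)
        case (walk_step u n a v v' c)
        then obtain y where "D K v = Some y" "x + a \<le> y" by blast
        with st[OF walk_step.hyps(2) this(1)] obtain z where "D K v' = Some z" "y + c \<le> z" by blast
        with \<open>x + a \<le> y\<close> show ?case by (intro exI[of _ z]) auto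
      qed simp
      have "\<exists>y. D K s = Some y"
        using mono'[of 0 K] by (auto simp add: D0 labelling_le_def split: if_splits)
      with go[OF w(1)] obtain y where y: "D K u = Some y" by blast
      from go[OF w(2) y] y w(3) show False by simp
    qed
  qed
qed

lemma walk_weight_bounded:
  assumes "\<not> positive_walk E s" "finite E"
  shows "\<exists>B. \<forall>n a v. walk E s n a v \<longrightarrow> a \<le> B"
proof -
  define V where "V = insert s (fst ` E \<union> (fst \<circ> snd) ` E)"
  have V: "E \<subseteq> V \<times> V \<times> UNIV" "finite V" "s \<in> V"
    using assms(2) by (force simp: V_def)+
  define C where "C = (\<Sum>e\<in>E. \<bar>snd (snd e)\<bar>)"
  have C: "\<bar>c\<bar> \<le> C" if "(u, v, c) \<in> E" for u v c
    unfolding C_def using member_le_sum[OF that, of "\<lambda>e. \<bar>snd (snd e)\<bar>"] assms(2) by simp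
  have "C \<ge> 0" by (simp add: C_def sum_nonneg)
  have wB: "a \<le> int n * C" if "walk E u n a v" for u n a v
    using that
  proof (induction rule: walk.induct)
    case (walk_step u n a v v' c)
    with C[OF walk_step.hyps(2)] show ?case by (simp add: algebra_simps)
  qed simp
  have "a \<le> int (card V) * C" if "walk E s n a v" for n a v
  proof -
    from walk_shorten[OF assms(1) V that] obtain m b where m: "walk E s m b v" "m < card V" "a \<le> b" by blast
    have "int m * C \<le> int (card V) * C" using m(2) \<open>C \<ge> 0\<close> by (intro mult_right_mono) auto
    with wB[OF m(1)] m(3) show ?thesis by linarith
  qed
  then show ?thesis by blast
qed

section \<open>Limit inferior of means\<close>

definition mean :: "(nat \<Rightarrow> real) \<Rightarrow> ereal" where
  "mean x = liminf (\<lambda>n. ereal (1 / real n * (\<Sum>k<n. x k)))"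

text \<open>A convergent summand can be split off from a lower limit. Here it is
  \<open>C / n\<close>, which tends to \<open>0\<close>.\<close>

lemma mean_le:
  assumes "\<And>n. (\<Sum>k<n. x k) \<le> (\<Sum>k<n. y k) + C"
  shows "mean x \<le> mean y"
proof -
  have "(\<lambda>n. C * inverse (real n)) \<longlonglongrightarrow> C * 0"
    by (intro tendsto_mult tendsto_const lim_inverse_n)
  then have lim: "(\<lambda>n. ereal (C * inverse (real n))) \<longlonglongrightarrow> 0"
    by (simp add: zero_ereal_def)
  have "1 / real n * (\<Sum>k<n. x k) \<le> C * inverse (real n) + 1 / real n * (\<Sum>k<n. y k)" for n
    using mult_left_mono[OF assms[of n], of "1 / real n"]
    by (simp add: divide_inverse algebra_simps)
  then have "mean x \<le> liminf (\<lambda>n. ereal (C * inverse (real n)) + ereal (1 / real n * (\<Sum>k<n. y k)))"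
    unfolding mean_def by (intro Liminf_mono always_eventually) simp
  also have "\<dots> = 0 + mean y"
    unfolding mean_def by (rule ereal_liminf_lim_add[OF lim]) simp
  finally show ?thesis by simp
qed

lemma mean_eq:
  assumes "\<And>n. \<bar>(\<Sum>k<n. x k) - (\<Sum>k<n. y k)\<bar> \<le> C"
  shows "mean x = mean y"
proof (rule antisym)
  show "mean x \<le> mean y" by (rule mean_le[where C = C]) (use assms in \<open>smt (verit)\<close>)
  show "mean y \<le> mean x" by (rule mean_le[where C = C]) (use assms in \<open>smt (verit)\<close>)
qed

lemma mean_const: "mean (\<lambda>_. c) = ereal c"
proof -
  have "(\<lambda>n. ereal (1 / real n * (\<Sum>k<n. c))) \<longlonglongrightarrow> ereal c"
    by (rule tendsto_eventually) (auto simp: eventually_sequentially intro!: exI[of _ 1])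
  then show ?thesis unfolding mean_def by (rule lim_imp_Liminf[rotated]) simp
qed

text \<open>Payoffs are real numbers; finiteness of the mean is needed when a game is built from its
  code.\<close>

lemma mean_finite:
  assumes "\<And>k. \<bar>x k\<bar> \<le> B"
  shows "\<bar>mean x\<bar> \<noteq> \<infinity>"
proof -
  have 1: "x k \<le> B" "- B \<le> x k" for k using assms[of k] by auto
  have "mean x \<le> mean (\<lambda>_. B)" by (rule mean_le[where C = 0]) (simp add: 1 sum_mono del: sum_constant)
  moreover have "mean (\<lambda>_. - B) \<le> mean x" by (rule mean_le[where C = 0]) (simp add: 1 sum_mono del: sum_constant)
  ultimately show ?thesis by (auto simp: mean_const)
qed

text \<open>Equally long initial sums of a sequence and of its shift differ only in \<open>L\<close>
  terms at either end, hence boundedly. This is the independence of finite prefixes that subgames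
  require.\<close>

lemma mean_shift:
  assumes x: "\<And>k. \<bar>x k\<bar> \<le> B" and y: "\<And>k. y k = x (k + L)"
  shows "mean x = mean y"
proof (rule mean_eq)
  fix n
  have bnd: "\<bar>\<Sum>k\<in>A. x k\<bar> \<le> real (card A) * B" for A
    by (rule order.trans[OF sum_abs]) (use sum_bounded_above[of A "\<lambda>k. \<bar>x k\<bar>" B] x in auto)
  have "(\<Sum>k<n. y k) = (\<Sum>k\<in>{L..<n + L}. x k)"
    unfolding y using sum.shift_bounds_nat_ivl[of x 0 L n] by (simp add: atLeast0LessThan)
  then have 1: "(\<Sum>k<L. x k) + (\<Sum>k<n. y k) = (\<Sum>k<n + L. x k)"
    using sum.atLeastLessThan_concat[of 0 L "n + L" x] by (simp add: atLeast0LessThan)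
  have 2: "(\<Sum>k<n. x k) + (\<Sum>k\<in>{n..<n + L}. x k) = (\<Sum>k<n + L. x k)"
    using sum.atLeastLessThan_concat[of 0 n "n + L" x] by (simp add: atLeast0LessThan)
  show "\<bar>(\<Sum>k<n. x k) - (\<Sum>k<n. y k)\<bar> \<le> 2 * (real L * B)"
    using 1 2 bnd[of "{..<L}"] bnd[of "{n..<n + L}"] by simp
qed

text \<open>After subtraction of the average \<open>c\<close> over a period, the partial sums
  \<open>S\<close> are periodic from \<open>n\<close> on, hence bounded, so the mean is that of a
  constant sequence.\<close>

lemma mean_periodic:
  assumes per: "\<And>k. n \<le> k \<Longrightarrow> x (k + m) = x k" and m: "m > 0"
  shows "mean x = ereal ((\<Sum>k<m. x (n + k)) / real m)"
proof -
  define c where "c = (\<Sum>k<m. x (n + k)) / real m"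
  define S where "S N = (\<Sum>k<N. x k - c)" for N
  have 0: "S (n + m) = S n"
  proof -
    have "(\<Sum>k\<in>{n..<n + m}. x k - c) = (\<Sum>k<m. x (n + k) - c)"
      using sum.shift_bounds_nat_ivl[of "\<lambda>k. x k - c" 0 n m] by (simp add: atLeast0LessThan add.commute)
    also have "\<dots> = 0" using m by (simp add: sum_subtractf c_def)
    finally show ?thesis
      using sum.atLeastLessThan_concat[of 0 n "n + m" "\<lambda>k. x k - c"] by (simp add: S_def atLeast0LessThan)
  qed
  have S: "S (N + m) = S N" if "n \<le> N" for N
    using that
  proof (induction N rule: dec_induct)
    case (step N)
    then show ?case using per[of N] by (simp add: S_def)
  qed (rule 0)
  define B where "B = (\<Sum>j<n + m. \<bar>S j\<bar>)"
  have "\<bar>S N\<bar> \<le> B" for N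
  proof (induction N rule: less_induct)
    case (less N)
    show ?case
    proof (cases "N < n + m")
      case True
      then show ?thesis unfolding B_def by (intro member_le_sum) auto
    next
      case False
      then have "S N = S (N - m)" using S[of "N - m"] by simp
      then show ?thesis using less[of "N - m"] m False by simp
    qed
  qed
  then have "\<bar>(\<Sum>k<N. x k) - (\<Sum>k<N. c)\<bar> \<le> B" for N
    by (simp add: S_def sum_subtractf)
  then have "mean x = mean (\<lambda>_. c)" by (rule mean_eq)
  then show ?thesis by (simp add: mean_const c_def)
qed

section \<open>Lassos\<close>

text \<open>The weights \<open>C\<close> belong to the lasso because a graph may contain edges of
  different weights between the same two vertices; their periodicity does not follow from that of
  \<open>F\<close>.\<close>

lemma positive_walk_lasso:
  assumes "positive_walk E s"
  shows "\<exists>F C n m. F 0 = s \<and> (\<forall>k. (F k, F (Suc k), C k) \<in> E) \<and> m > 0 \<and>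
    (\<forall>k\<ge>n. F (k + m) = F k \<and> C (k + m) = C k) \<and> (\<Sum>k<m. C (n + k)) > (0::int)"
proof -
  from assms obtain u n a m b where w: "walk E s n a u" "walk E u m b u" "b > 0"
    unfolding positive_walk_def by blast
  from walk_path[OF w(1)] obtain f c where f: "f 0 = s" "f n = u"
    "\<And>i. i < n \<Longrightarrow> (f i, f (Suc i), c (Suc i) - c i) \<in> E" by blast
  from walk_path[OF w(2)] obtain g d where g: "g 0 = u" "g m = u" "d 0 = 0" "d m = b"
    "\<And>i. i < m \<Longrightarrow> (g i, g (Suc i), d (Suc i) - d i) \<in> E" by blast
  have m: "m > 0" using g w(3) by (cases m) auto
  define F where "F k = (if k < n then f k else g ((k - n) mod m))" for k
  define C where "C k = (if k < n then c (Suc k) - c k else d (Suc ((k - n) mod m)) - d ((k - n) mod m))" for k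
  have "F 0 = s" using f g by (cases "n = 0") (auto simp: F_def)
  moreover have "\<forall>k. (F k, F (Suc k), C k) \<in> E"
  proof
    fix k
    show "(F k, F (Suc k), C k) \<in> E"
    proof -
    consider "Suc k < n" | "Suc k = n" | "n \<le> k" by linarith
    then show ?thesis
    proof cases
      case 1
      then show ?thesis using f(3)[of k] by (simp add: F_def C_def)
    next
      case 2
      then show ?thesis using f(3)[of k] f(2) g(1) by (simp add: F_def C_def)
    next
      case 3
      let ?r = "(k - n) mod m"
      have "?r < m" using m by simp
      \<comment> \<open>At the end of a period the index wraps from \<open>m\<close> to
        \<open>0\<close>, where \<open>g\<close> has the same value \<open>u\<close>.\<close>
      have "g (Suc (k - n) mod m) = g (Suc ?r)"
        using g(1,2) by (simp add: mod_Suc)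
      with g(5)[OF \<open>?r < m\<close>] 3 show ?thesis by (simp add: F_def C_def Suc_diff_le)
    qed
  qed
  qed
  moreover have "\<forall>k\<ge>n. F (k + m) = F k \<and> C (k + m) = C k"
    by (auto simp: F_def C_def add.commute[of _ m] simp flip: add_diff_assoc)
  moreover have "(\<Sum>k<m. C (n + k)) = (\<Sum>k<m. d (Suc k) - d k)"
    by (intro sum.cong) (auto simp: C_def)
  moreover have "(\<Sum>k<m. d (Suc k) - d k) = b"
    using g(3,4) by (simp add: sum_lessThan_telescope)
  ultimately have "F 0 = s \<and> (\<forall>k. (F k, F (Suc k), C k) \<in> E) \<and> m > 0 \<and>
    (\<forall>k\<ge>n. F (k + m) = F k \<and> C (k + m) = C k) \<and> (\<Sum>k<m. C (n + k)) > 0"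
    using m w(3) by simp
  then show ?thesis by blast
qed

section \<open>Machines and profiles\<close>

lemma game_edges: "game G \<Longrightarrow> (u, v) \<in> edges G \<Longrightarrow> u \<in> verts G \<and> v \<in> verts G"
  by (auto simp: game_def)

lemma history_from_single [simp]: "history_from G v\<^sub>0 [v] \<longleftrightarrow> v = v\<^sub>0"
  by (auto simp: history_from_def)

lemma history_from_snoc:
  "h \<noteq> [] \<Longrightarrow> history_from G v\<^sub>0 (h @ [v]) \<longleftrightarrow> history_from G v\<^sub>0 h \<and> (last h, v) \<in> edges G"
  by (auto simp: history_from_def successively_append_iff)

lemma history_from_append:
  "history_from G v\<^sub>0 (h @ [v]) \<Longrightarrow> history_from G v h' \<Longrightarrow> history_from G v\<^sub>0 (h @ h')"
  by (cases h') (auto simp: history_from_def successively_append_iff successively_Cons hd_append)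

lemma history_from_drop: "history_from G v\<^sub>0 (h @ h') \<Longrightarrow> h' \<noteq> [] \<Longrightarrow> history_from G (hd h') h'"
  by (simp add: history_from_def successively_append_iff)

lemma history_from_vert:
  assumes "game G" "v\<^sub>0 \<in> verts G"
  shows "history_from G v\<^sub>0 (h @ [v]) \<Longrightarrow> v \<in> verts G"
  using assms by (cases "h = []") (auto simp: history_from_snoc dest: game_edges)

lemma mealy_machine_state:
  "mealy_machine G M \<Longrightarrow> (p, u, q, v) \<in> trans M \<Longrightarrow> q \<in> states M \<and> (u, v) \<in> edges G"
  by (auto simp: mealy_machine_def)

definition rewards :: "('i \<Rightarrow> 'v \<times> 'v \<Rightarrow> rat) \<Rightarrow> 'i \<Rightarrow> (nat \<Rightarrow> 'v) \<Rightarrow> nat \<Rightarrow> real" where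
  "rewards r i \<pi> k = of_rat (r i (\<pi> k, \<pi> (Suc k)))"

text \<open>Only plays from \<open>v\<close> are considered, because this is what subgames inherit:
  a sequence that starts elsewhere, put behind a history, need not form a play.\<close>

definition mean_payoff_from :: "('i, 'v) game \<Rightarrow> ('i \<Rightarrow> 'v \<times> 'v \<Rightarrow> rat) \<Rightarrow> 'v \<Rightarrow> bool" where
  "mean_payoff_from G r v \<longleftrightarrow>
     (\<forall>i \<in> players G. \<forall>\<pi>. play G \<pi> \<longrightarrow> \<pi> 0 = v \<longrightarrow> ereal (payoff G i \<pi>) = mean (rewards r i \<pi>))"

lemma mean_payoff_game_from: "mean_payoff_game G r \<Longrightarrow> mean_payoff_from G r v"
  by (simp add: mean_payoff_game_def mean_payoff_from_def mean_def rewards_def)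

lemma game_finite_edges: "game G \<Longrightarrow> finite (edges G)"
  by (auto simp: game_def intro: finite_subset)

lemma rewards_bounded:
  assumes "game G"
  shows "\<exists>B. \<forall>\<pi>. play G \<pi> \<longrightarrow> (\<forall>k. \<bar>rewards r i \<pi> k\<bar> \<le> B)"
proof -
  let ?B = "\<Sum>e\<in>edges G. \<bar>of_rat (r i e) :: real\<bar>"
  have "\<bar>rewards r i \<pi> k\<bar> \<le> ?B" if "play G \<pi>" for \<pi> k
    unfolding rewards_def
    using member_le_sum[of "(\<pi> k, \<pi> (Suc k))" "edges G" "\<lambda>e. \<bar>of_rat (r i e) :: real\<bar>"]
      that game_finite_edges[OF assms] by (simp add: play_def)
  then show ?thesis by blast
qed

lemma subgame_simps [simp]:
  "players (subgame G h) = players G" "verts (subgame G h) = verts G" "owner (subgame G h) = owner G"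
  "edges (subgame G h) = edges G" "payoff (subgame G h) i \<pi> = payoff G i (conc h \<pi>)"
  by (simp_all add: subgame_def)

lemma game_subgame [simp]: "game (subgame G h) = game G"
  by (simp add: game_def)

lemma history_from_subgame [simp]: "history_from (subgame G h) = history_from G"
  by (intro ext) (simp add: history_from_def)

lemma play_subgame [simp]: "play (subgame G h) = play G"
  by (intro ext) (simp add: play_def)

lemma strategy_subgame [simp]: "strategy (subgame G h) = strategy G"
  by (intro ext) (simp add: strategy_def)

lemma move_subgame [simp]: "move (subgame G h) = move G"
  by (intro ext) (simp add: move_def)

lemma mealy_machine_subgame:
  "mealy_machine G M \<Longrightarrow> q \<in> states M \<Longrightarrow> mealy_machine (subgame G h) (M\<lparr>init := q\<rparr>)"
  by (simp add: mealy_machine_def)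

text \<open>The rewards along \<open>conc h \<pi>\<close> are those along \<open>\<pi>\<close>
  delayed by \<open>length h\<close> steps, so \<open>mean_shift\<close> applies. The rest is to see
  that the concatenation is a play from \<open>v\<^sub>0\<close>.\<close>

lemma mean_payoff_from_subgame:
  assumes "game G" "mean_payoff_from G r v\<^sub>0" "history_from G v\<^sub>0 (h @ [v])"
  shows "mean_payoff_from (subgame G h) r v"
  unfolding mean_payoff_from_def
proof (intro ballI allI impI)
  fix i \<pi>
  assume i: "i \<in> players (subgame G h)" and \<pi>: "play (subgame G h) \<pi>" "\<pi> 0 = v"
  let ?\<rho> = "conc h \<pi>"
  have succ: "successively (\<lambda>u v. (u, v) \<in> edges G) h" "h \<noteq> [] \<Longrightarrow> (last h, v) \<in> edges G"
    using assms(3) by (auto simp: history_from_def successively_append_iff)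
  have play: "play G ?\<rho>"
    unfolding play_def
  proof
    fix n
    consider "Suc n < length h" | "Suc n = length h" | "length h \<le> n" by linarith
    then show "(?\<rho> n, ?\<rho> (Suc n)) \<in> edges G"
    proof cases
      case 1
      then show ?thesis using succ(1) by (simp add: successively_conv_nth)
    next
      case 2
      then have h: "h \<noteq> []" "n = length h - 1" by auto
      then have "last h = h ! n" by (simp only: last_conv_nth[OF h(1)])
      moreover have "?\<rho> n = h ! n" using 2 by (intro conc_fst) simp
      moreover have "?\<rho> (Suc n) = v" using conc_snd[of "Suc n" h \<pi>] 2 \<pi>(2) by simp
      ultimately show ?thesis using succ(2)[OF h(1)] by metis
    next
      case 3
      moreover have "(\<pi> (n - length h), \<pi> (Suc (n - length h))) \<in> edges G"
        using \<pi>(1) unfolding play_def subgame_simps by blast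
      ultimately show ?thesis by (simp add: Suc_diff_le)
    qed
  qed
  have "?\<rho> 0 = v\<^sub>0"
  proof (cases "h = []")
    case False
    then have "?\<rho> 0 = hd h" by (simp add: conc_fst hd_conv_nth)
    with False assms(3) show ?thesis by (simp add: history_from_def)
  qed (use assms(3) \<pi>(2) in simp)
  with assms(2) i play have "ereal (payoff G i ?\<rho>) = mean (rewards r i ?\<rho>)"
    unfolding mean_payoff_from_def subgame_simps by blast
  moreover obtain B where B: "\<forall>\<pi>. play G \<pi> \<longrightarrow> (\<forall>k. \<bar>rewards r i \<pi> k\<bar> \<le> B)"
    using rewards_bounded[OF assms(1), of r i] by (elim exE)
  have "mean (rewards r i ?\<rho>) = mean (rewards r i \<pi>)"
  proof (rule mean_shift)
    fix k
    show "\<bar>rewards r i ?\<rho> k\<bar> \<le> B" using B play by simp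
    show "rewards r i \<pi> k = rewards r i ?\<rho> (k + length h)" by (simp add: rewards_def Suc_diff_le)
  qed
  with calculation show "ereal (payoff (subgame G h) i \<pi>) = mean (rewards r i \<pi>)" by simp
qed

text \<open>The means of constructing compatible profiles: states and moves may be prescribed on a
  set \<open>D\<close> of histories closed under nonempty prefixes, provided that they form
  transitions; elsewhere arbitrary transitions are chosen. One function serves all players, as
  \<open>move\<close> consults only the owner of the last vertex.\<close>

lemma Comp_extend:
  assumes G: "game G" and M: "mealy_machine G M" and v\<^sub>0: "v\<^sub>0 \<in> verts G"
    and Nil: "f [] = init M"
    and D: "\<And>h v. h @ [v] \<in> D \<Longrightarrow> history_from G v\<^sub>0 (h @ [v]) \<Longrightarrow>
      (h = [] \<or> h \<in> D) \<and> (f h, v, f (h @ [v]), g (h @ [v])) \<in> trans M"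
  shows "\<exists>g'. (\<lambda>_. g') \<in> Comp G v\<^sub>0 M \<and> (\<forall>h \<in> D. g' h = g h)"
proof -
  \<comment> \<open>Histories grow at the end, so the recursion for the states runs over the
    reversed list. State and move are the two components of the same choice, which keeps them in one
    transition.\<close>
  define S where "S = rec_list (init M)
    (\<lambda>v rh q. if rev (v # rh) \<in> D then f (rev (v # rh)) else fst (SOME x. (q, v, x) \<in> trans M))"
  define st where "st h = S (rev h)" for h
  define g' where "g' h = (if h \<in> D then g h else snd (SOME x. (st (butlast h), last h, x) \<in> trans M))" for h
  have st_Nil: "st [] = init M" by (simp add: st_def S_def)
  have st_snoc: "st (h @ [v]) = (if h @ [v] \<in> D then f (h @ [v]) else fst (SOME x. (st h, v, x) \<in> trans M))" for h v
    by (simp add: st_def S_def)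
  have st_D: "st h = f h" if "h \<in> D \<or> h = []" for h
    using that by (cases h rule: rev_cases) (auto simp: st_Nil Nil st_snoc)
  have tr: "(st h, v, st (h @ [v]), g' (h @ [v])) \<in> trans M" if "history_from G v\<^sub>0 (h @ [v])" for h v
    using that
  proof (induction h arbitrary: v rule: rev_induct)
    case Nil
    have "\<exists>x. (init M, v, x) \<in> trans M"
      using M v\<^sub>0 Nil by (fastforce simp: mealy_machine_def)
    from someI_ex[OF this] have "(init M, v, SOME x. (init M, v, x) \<in> trans M) \<in> trans M" .
    with D[of "[]" v] Nil st_snoc[of "[]" v] show ?case
      by (auto simp: st_Nil g'_def assms(4))
  next
    case (snoc u h)
    from snoc.prems have h: "history_from G v\<^sub>0 (h @ [u])" by (subst (asm) history_from_snoc) auto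
    from snoc.IH[OF h] M have q: "st (h @ [u]) \<in> states M" by (auto simp: mealy_machine_def)
    have "v \<in> verts G" using history_from_vert[OF G v\<^sub>0 snoc.prems] .
    with q M have "\<exists>x. (st (h @ [u]), v, x) \<in> trans M" by (fastforce simp: mealy_machine_def)
    from someI_ex[OF this] obtain x y where xy: "(SOME x. (st (h @ [u]), v, x) \<in> trans M) = (x, y)"
      "(st (h @ [u]), v, x, y) \<in> trans M" by (metis prod.collapse)
    show ?case
    proof (cases "(h @ [u]) @ [v] \<in> D")
      case True
      then have "st ((h @ [u]) @ [v]) = f ((h @ [u]) @ [v])" "g' ((h @ [u]) @ [v]) = g ((h @ [u]) @ [v])"
        by (simp_all only: st_snoc g'_def if_True)
      with D[OF True snoc.prems] st_D[of "h @ [u]"] show ?thesis by metis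
    next
      case False
      then have "g' ((h @ [u]) @ [v]) = y" "st ((h @ [u]) @ [v]) = x"
        by (simp_all only: g'_def st_snoc[of "h @ [u]" v] if_False butlast_snoc last_snoc xy fst_conv snd_conv)
      with xy(2) show ?thesis by metis
    qed
  qed
  have mv: "move G (\<lambda>_. g') h = g' h" for h by (simp add: move_def)
  have "(\<lambda>_. g') \<in> Comp G v\<^sub>0 M"
    unfolding Comp_def strategy_profile_def strategy_def mem_Collect_eq
  proof (intro conjI ballI allI impI exI[of _ st])
    fix h v
    assume "history_from G v\<^sub>0 (h @ [v])"
    from tr[OF this] show "(st h, v, st (h @ [v]), move G (\<lambda>_. g') (h @ [v])) \<in> trans M"
      by (simp add: mv)
  qed (use tr st_Nil mealy_machine_state[OF M] in blast)+
  then show ?thesis by (intro exI[of _ g']) (simp add: g'_def)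
qed

lemma outcome_cong:
  assumes "\<And>i h. h \<noteq> [] \<Longrightarrow> hd h = v \<Longrightarrow> \<sigma> i h = \<sigma>' i h"
  shows "outcome G v \<sigma> = outcome G v \<sigma>'"
proof -
  have "outcome_prefix G v \<sigma> n = outcome_prefix G v \<sigma>' n \<and> outcome_prefix G v \<sigma>' n \<noteq> [] \<and>
      hd (outcome_prefix G v \<sigma>' n) = v" for n
    by (induction n) (auto simp: move_def assms)
  then show ?thesis by (intro ext) (simp add: outcome_def)
qed

text \<open>Strategies are total functions on lists, but values at lists that do not start at
  \<open>v\<close> never enter an outcome from \<open>v\<close>. This allows a glued profile to be
  compared with its part in a subgame.\<close>

lemma nash_equilibrium_cong:
  assumes "\<And>i h. h \<noteq> [] \<Longrightarrow> hd h = v \<Longrightarrow> \<sigma> i h = \<sigma>' i h"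
  shows "nash_equilibrium G v \<sigma> \<longleftrightarrow> nash_equilibrium G v \<sigma>'"
proof -
  have 1: "outcome G v \<sigma> = outcome G v \<sigma>'" by (rule outcome_cong) (rule assms)
  have 2: "outcome G v (\<sigma>(i := s)) = outcome G v (\<sigma>'(i := s))" for i s
    by (rule outcome_cong) (simp add: assms)
  show ?thesis unfolding nash_equilibrium_def 1 2 ..
qed

text \<open>Also applied with \<open>s = \<sigma> i\<close>, where it describes the outcome of
  \<open>\<sigma>\<close> itself. A deviation does not disturb the machine: its state is updated by
  the vertices visited, and \<open>st\<close> provides a transition at every history.\<close>

lemma outcome_deviation:
  assumes G: "game G" and v\<^sub>0: "v\<^sub>0 \<in> verts G" and M: "mealy_machine G M"
    and st: "\<forall>h v. history_from G v\<^sub>0 (h @ [v]) \<longrightarrow>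
      (st h, v, st (h @ [v]), move G \<sigma> (h @ [v])) \<in> trans M"
    and s: "strategy G v\<^sub>0 i s"
  defines "\<pi> \<equiv> outcome G v\<^sub>0 (\<sigma>(i := s))"
  shows "play G \<pi>" "\<pi> 0 = v\<^sub>0"
    "(st (map \<pi> [0..<n]), \<pi> n, st (map \<pi> [0..<Suc n]), move G \<sigma> (map \<pi> [0..<Suc n])) \<in> trans M"
    "owner G (\<pi> n) = i \<or> \<pi> (Suc n) = move G \<sigma> (map \<pi> [0..<Suc n])"
proof -
  show 0: "\<pi> 0 = v\<^sub>0" by (simp add: \<pi>_def outcome_0)
  have Suc: "\<pi> (Suc n) = move G (\<sigma>(i := s)) (map \<pi> [0..<Suc n])" for n
    unfolding \<pi>_def by (rule outcome_Suc)
  have last: "last (map \<pi> [0..<Suc n]) = \<pi> n" for n by simp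
  show own: "owner G (\<pi> n) = i \<or> \<pi> (Suc n) = move G \<sigma> (map \<pi> [0..<Suc n])" for n
    unfolding Suc move_def last by auto
  have tr: "(st (map \<pi> [0..<n]), \<pi> n, st (map \<pi> [0..<Suc n]), move G \<sigma> (map \<pi> [0..<Suc n])) \<in> trans M"
    if "history_from G v\<^sub>0 (map \<pi> [0..<Suc n])" for n
    using st[rule_format, of "map \<pi> [0..<n]" "\<pi> n"] that by simp
  have edge: "(\<pi> n, \<pi> (Suc n)) \<in> edges G" if h: "history_from G v\<^sub>0 (map \<pi> [0..<Suc n])" for n
  proof (cases "owner G (\<pi> n) = i")
    case True
    then have "\<pi> (Suc n) = s (map \<pi> [0..<n] @ [\<pi> n])"
      unfolding Suc move_def last by simp
    with s h True show ?thesis unfolding strategy_def by simp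
  next
    case False
    with own[of n] mealy_machine_state[OF M tr[OF h]] show ?thesis by simp
  qed
  have h: "history_from G v\<^sub>0 (map \<pi> [0..<Suc n])" for n
  proof (induction n)
    case (Suc n)
    have "history_from G v\<^sub>0 (map \<pi> [0..<Suc n] @ [\<pi> (Suc n)])"
      using Suc.IH edge[OF Suc.IH] by (subst history_from_snoc) auto
    then show ?case by simp
  qed (simp add: 0)
  show "play G \<pi>" using edge[OF h] by (simp add: play_def)
  show "(st (map \<pi> [0..<n]), \<pi> n, st (map \<pi> [0..<Suc n]), move G \<sigma> (map \<pi> [0..<Suc n])) \<in> trans M"
    using tr[OF h] .
qed

section \<open>The deviation graph\<close>

text \<open>\<open>Common q v\<close>: state and vertex of a compatible play. \<open>Split i p u q v\<close>: after a deviation of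
  player \<open>i\<close>, the pair \<open>(p, u)\<close> follows the deviating play and \<open>(q, v)\<close> the compatible one. The state
  reached on the step of the deviation is shared, since it does not depend on the vertex that is chosen.\<close>

datatype ('i, 'q, 'v) node = Common 'q 'v | Split 'i 'q 'v 'q 'v

text \<open>The flag \<open>any\<close> frees the first phase from the proposed moves, for use with
  subgame perfection; the states are still updated by transitions. In \<open>split\<close>,
  \<open>x\<close> is the move proposed to the deviating play, which only \<open>i\<close> may
  refuse. Steps before and at the deviation have weight \<open>0\<close>, as finitely many steps do
  not influence a mean.\<close>

inductive_set deviation_graph ::
    "bool \<Rightarrow> 'i set \<Rightarrow> ('v \<Rightarrow> 'i) \<Rightarrow> ('v \<times> 'v) set \<Rightarrow> ('q \<times> 'v \<times> 'q \<times> 'v) set \<Rightarrow>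
     ('i \<Rightarrow> 'v \<times> 'v \<Rightarrow> int) \<Rightarrow> ('i, 'q, 'v) node wgraph"
  for any :: bool and I own E T R where
  common: "(q, v, q', u) \<in> T \<Longrightarrow> (v, u') \<in> E \<Longrightarrow> any \<or> u' = u \<Longrightarrow>
    (Common q v, Common q' u', 0) \<in> deviation_graph any I own E T R"
| deviate: "(q, v, q', u) \<in> T \<Longrightarrow> (v, u') \<in> E \<Longrightarrow> u' \<noteq> u \<Longrightarrow>
    (Common q v, Split (own v) q' u' q' u, 0) \<in> deviation_graph any I own E T R"
| split: "i \<in> I \<Longrightarrow> (p, u, p', x) \<in> T \<Longrightarrow> (u, u') \<in> E \<Longrightarrow> own u = i \<or> u' = x \<Longrightarrow> (q, v, q', v') \<in> T \<Longrightarrow>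
    (Split i p u q v, Split i p' u' q' v', R i (u, u') - R i (v, v')) \<in> deviation_graph any I own E T R"

fun dev_state where "dev_state (Common q v) = q" | "dev_state (Split i p u q v) = p"
fun dev_vert where "dev_vert (Common q v) = v" | "dev_vert (Split i p u q v) = u"
fun main_state where "main_state (Common q v) = q" | "main_state (Split i p u q v) = q"
fun main_vert where "main_vert (Common q v) = v" | "main_vert (Split i p u q v) = v"
fun is_split where "is_split (Common q v) = False" | "is_split (Split i p u q v) = True"
fun deviator where "deviator (Common q v) = undefined" | "deviator (Split i p u q v) = i"

lemma finite_deviation_graph:
  assumes "finite I" "finite E" "finite T"
  shows "finite (deviation_graph any I own E T R)"
proof -
  let ?f = "\<lambda>((q, v, q', u), (x, u')). (Common q v, Common q' u', 0)"
  let ?g = "\<lambda>((q, v, q', u), (x, u')). (Common q v, Split (own v) q' u' q' u, 0)"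
  let ?h = "\<lambda>(i, (p, u, p', x), (y, u'), (q, v, q', v')).
     (Split i p u q v, Split i p' u' q' v', R i (u, u') - R i (v, v'))"
  have "deviation_graph any I own E T R \<subseteq> ?f ` (T \<times> E) \<union> ?g ` (T \<times> E) \<union> ?h ` (I \<times> T \<times> E \<times> T)"
  proof
    fix e assume "e \<in> deviation_graph any I own E T R"
    moreover obtain x y c where e: "e = (x, y, c)" by (cases e)
    ultimately have "(x, y, c) \<in> deviation_graph any I own E T R" by simp
    then show "e \<in> ?f ` (T \<times> E) \<union> ?g ` (T \<times> E) \<union> ?h ` (I \<times> T \<times> E \<times> T)"
    proof (cases rule: deviation_graph.cases)
      case (common q v q' u u')
      then have "e = ?f ((q, v, q', u), (v, u'))" "((q, v, q', u), (v, u')) \<in> T \<times> E" by (auto simp: e)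
      then show ?thesis by blast
    next
      case (deviate q v q' u u')
      then have "e = ?g ((q, v, q', u), (v, u'))" "((q, v, q', u), (v, u')) \<in> T \<times> E" by (auto simp: e)
      then show ?thesis by blast
    next
      case (split i p u p' x u' q v q' v')
      then have "e = ?h (i, (p, u, p', x), (u, u'), (q, v, q', v'))"
        "(i, (p, u, p', x), (u, u'), (q, v, q', v')) \<in> I \<times> T \<times> E \<times> T" by (auto simp: e)
      then show ?thesis by blast
    qed
  qed
  then show ?thesis using assms by (meson finite_SigmaI finite_UnI finite_imageI finite_subset)
qed

section \<open>Nash equilibria and positive closed walks\<close>

abbreviation game_graph ::
    "bool \<Rightarrow> ('i, 'v) game \<Rightarrow> ('q, 'v) mealy \<Rightarrow> ('i \<Rightarrow> 'v \<times> 'v \<Rightarrow> int) \<Rightarrow> ('i, 'q, 'v) node wgraph" where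
  "game_graph any G M R \<equiv> deviation_graph any (players G) (owner G) (edges G) (trans M) R"

text \<open>Every player may have a separate factor, since rewards of different players are never
  compared.\<close>

definition scaled ::
    "('i, 'v) game \<Rightarrow> ('i \<Rightarrow> 'v \<times> 'v \<Rightarrow> rat) \<Rightarrow> ('i \<Rightarrow> 'v \<times> 'v \<Rightarrow> int) \<Rightarrow> bool" where
  "scaled G r R \<longleftrightarrow> (\<forall>i \<in> players G. \<exists>D > 0. \<forall>e \<in> edges G. real_of_int (R i e) = D * of_rat (r i e))"

lemma mealy_machine_finite: "game G \<Longrightarrow> mealy_machine G M \<Longrightarrow> finite (trans M)"
  unfolding game_def mealy_machine_def by (meson finite_SigmaI finite_subset)

lemma Comp_states:
  "\<sigma> \<in> Comp G v\<^sub>0 M \<Longrightarrow> \<exists>st. st [] = init M \<and> (\<forall>h v. history_from G v\<^sub>0 (h @ [v]) \<longrightarrow>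
     (st h, v, st (h @ [v]), move G \<sigma> (h @ [v])) \<in> trans M)"
  by (auto simp: Comp_def)

lemma nash_if_no_positive_walk:
  fixes G :: "('i, 'v) game" and M :: "('q, 'v) mealy"
  assumes G: "game G" and M: "mealy_machine G M" and v\<^sub>0: "v\<^sub>0 \<in> verts G"
    and mp: "mean_payoff_from G r v\<^sub>0" and R: "scaled G r R"
    and np: "\<not> positive_walk (game_graph False G M R) (Common (init M) v\<^sub>0)"
    and \<sigma>: "\<sigma> \<in> Comp G v\<^sub>0 M"
  shows "nash_equilibrium G v\<^sub>0 \<sigma>"
  unfolding nash_equilibrium_def
proof (intro ballI allI impI)
  fix i s assume i: "i \<in> players G" and s: "strategy G v\<^sub>0 i s"
  let ?E = "game_graph False G M R"
  from Comp_states[OF \<sigma>] obtain st where st_Nil: "st [] = init M"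
    and st: "\<forall>h v. history_from G v\<^sub>0 (h @ [v]) \<longrightarrow>
      (st h, v, st (h @ [v]), move G \<sigma> (h @ [v])) \<in> trans M" by blast
  have si: "strategy G v\<^sub>0 i (\<sigma> i)" using \<sigma> i by (simp add: Comp_def strategy_profile_def)
  define \<pi> where "\<pi> = outcome G v\<^sub>0 \<sigma>"
  define \<rho> where "\<rho> = outcome G v\<^sub>0 (\<sigma>(i := s))"
  note dev_\<pi> = outcome_deviation[OF G v\<^sub>0 M st si, simplified fun_upd_triv, folded \<pi>_def]
  note dev_\<rho> = outcome_deviation[OF G v\<^sub>0 M st s, folded \<rho>_def]
  have \<pi>_Suc: "\<pi> (Suc n) = move G \<sigma> (map \<pi> [0..<Suc n])" for n
    unfolding \<pi>_def by (rule outcome_Suc)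
  define Q where "Q n = st (map \<pi> [0..<n])" for n
  define P where "P n = st (map \<rho> [0..<n])" for n
  have Q: "(Q n, \<pi> n, Q (Suc n), \<pi> (Suc n)) \<in> trans M" for n
    using dev_\<pi>(3)[of n] unfolding Q_def \<pi>_Suc .
  have P: "\<exists>x. (P n, \<rho> n, P (Suc n), x) \<in> trans M \<and> (owner G (\<rho> n) = i \<or> \<rho> (Suc n) = x)" for n
    using dev_\<rho>(3,4)[of n] unfolding P_def by blast
  have \<rho>_edge: "(\<rho> n, \<rho> (Suc n)) \<in> edges G" for n using dev_\<rho>(1) by (simp add: play_def)
  have \<pi>_edge: "(\<pi> n, \<pi> (Suc n)) \<in> edges G" for n using dev_\<pi>(1) by (simp add: play_def)
  have "mean (rewards r i \<rho>) \<le> mean (rewards r i \<pi>)"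
  proof (cases "\<rho> = \<pi>")
    case False
    then have ex: "\<exists>k. \<rho> k \<noteq> \<pi> k" by auto
    define J where "J = (LEAST k. \<rho> k \<noteq> \<pi> k)"
    have J: "\<rho> J \<noteq> \<pi> J" unfolding J_def using ex by (rule LeastI_ex)
    have bef: "\<rho> k = \<pi> k" if "k < J" for k using not_less_Least[of k "\<lambda>k. \<rho> k \<noteq> \<pi> k"] that by (auto simp: J_def)
    have pre: "map \<rho> [0..<k] = map \<pi> [0..<k]" if "k \<le> J" for k using that bef by auto
    \<comment> \<open>This includes \<open>k = J\<close>: the state \<open>P J\<close> has only read
      the vertices before position \<open>J\<close>.\<close>
    have PQ: "P k = Q k" if "k \<le> J" for k by (simp add: P_def Q_def pre[OF that])
    have "J > 0" using J dev_\<pi>(2) dev_\<rho>(2) by (cases J) auto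
    then obtain j where j: "J = Suc j" by (cases J) auto
    have "owner G (\<rho> j) = i"
    proof -
      have "map \<rho> [0..<Suc j] = map \<pi> [0..<Suc j]" by (rule pre) (simp add: j)
      with J have "\<rho> (Suc j) \<noteq> move G \<sigma> (map \<rho> [0..<Suc j])" by (simp only: j \<pi>_Suc not_False_eq_True)
      with dev_\<rho>(4)[of j] show ?thesis by blast
    qed
    define F where "F k = (if k < J then Common (Q k) (\<pi> k) else Split i (P k) (\<rho> k) (Q k) (\<pi> k))" for k
    define w where "w k = (if k < J then 0 else R i (\<rho> k, \<rho> (Suc k)) - R i (\<pi> k, \<pi> (Suc k)))" for k
    have F: "(F k, F (Suc k), w k) \<in> ?E" for k
    proof -
      consider "Suc k < J" | "k = j" | "J \<le> k" using j by linarith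
      then show ?thesis
      proof cases
        case 1
        with Q[of k] \<pi>_edge[of k] show ?thesis
          by (auto simp: F_def w_def intro!: deviation_graph.common)
      next
        case 2
        have "(Common (Q j) (\<pi> j), Split (owner G (\<pi> j)) (Q J) (\<rho> J) (Q J) (\<pi> J), 0) \<in> ?E"
          using Q[of j] \<rho>_edge[of j] J bef[of j] j by (intro deviation_graph.deviate) auto
        with 2 show ?thesis
          using \<open>owner G (\<rho> j) = i\<close> bef[of j] PQ[of J] by (simp add: F_def w_def j)
      next
        case 3
        from P[of k] obtain x where "(P k, \<rho> k, P (Suc k), x) \<in> trans M"
          "owner G (\<rho> k) = i \<or> \<rho> (Suc k) = x" by blast
        with 3 i Q[of k] \<rho>_edge[of k] show ?thesis
          by (auto simp: F_def w_def intro!: deviation_graph.split)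
      qed
    qed
    have walk: "walk ?E (F 0) n (\<Sum>k<n. w k) (F n)" for n
      using path_walk[of 0 n F "\<lambda>n. \<Sum>k<n. w k" ?E] F by simp
    have F0: "F 0 = Common (init M) v\<^sub>0"
      using \<open>J > 0\<close> dev_\<pi>(2) by (simp add: F_def Q_def st_Nil)
    have "finite ?E"
      using G game_finite_edges[OF G] mealy_machine_finite[OF G M]
      by (intro finite_deviation_graph) (auto simp: game_def)
    from walk_weight_bounded[OF np this] obtain B where B: "(\<Sum>k<n. w k) \<le> B" for n
      using walk unfolding F0 by blast
    from R i obtain D where D: "D > 0" "\<And>e. e \<in> edges G \<Longrightarrow> real_of_int (R i e) = D * of_rat (r i e)"
      by (auto simp: scaled_def)
    \<comment> \<open>The step of the deviation itself, at position \<open>j\<close>, has weight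
      \<open>0\<close> in the graph although the rewards differ there; \<open>c\<close> accounts for
      it.\<close>
    define c where "c = rewards r i \<rho> j - rewards r i \<pi> j"
    have diff: "rewards r i \<rho> k - rewards r i \<pi> k = real_of_int (w k) / D + (if k = j then c else 0)" for k
    proof -
      consider "Suc k < J" | "k = j" | "J \<le> k" using j by linarith
      then show ?thesis
      proof cases
        case 1
        with bef[of k] bef[of "Suc k"] j show ?thesis by (simp add: w_def rewards_def)
      next
        case 3
        then show ?thesis
          using D(1) j D(2)[OF \<rho>_edge[of k]] D(2)[OF \<pi>_edge[of k]]
          by (simp add: w_def rewards_def field_simps)
      qed (simp add: w_def c_def j)
    qed
    have "(\<Sum>k<n. rewards r i \<rho> k) \<le> (\<Sum>k<n. rewards r i \<pi> k) + (real_of_int B / D + \<bar>c\<bar>)" for n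
    proof -
      have "(\<Sum>k<n. rewards r i \<rho> k) - (\<Sum>k<n. rewards r i \<pi> k) =
          (\<Sum>k<n. real_of_int (w k) / D + (if k = j then c else 0))"
        unfolding diff[symmetric] by (simp add: sum_subtractf)
      also have "\<dots> = real_of_int (\<Sum>k<n. w k) / D + (if j < n then c else 0)"
        by (simp add: sum.distrib sum_divide_distrib)
      also have "\<dots> \<le> real_of_int B / D + \<bar>c\<bar>"
      proof (intro add_mono divide_right_mono)
        show "real_of_int (\<Sum>k<n. w k) \<le> real_of_int B" using B[of n] by (simp only: of_int_le_iff)
      qed (use D(1) in auto)
      finally show ?thesis by simp
    qed
    then show ?thesis by (rule mean_le)
  qed simp
  moreover have "ereal (payoff G i \<rho>) = mean (rewards r i \<rho>)" "ereal (payoff G i \<pi>) = mean (rewards r i \<pi>)"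
    using mp i dev_\<rho>(1,2) dev_\<pi>(1,2) by (auto simp: mean_payoff_from_def)
  ultimately have "ereal (payoff G i \<rho>) \<le> ereal (payoff G i \<pi>)" by simp
  then show "payoff G i (outcome G v\<^sub>0 (\<sigma>(i := s))) \<le> payoff G i (outcome G v\<^sub>0 \<sigma>)"
    by (simp add: \<rho>_def \<pi>_def)
qed

lemma is_split_step:
  "(x, y, c) \<in> deviation_graph any I own E T R \<Longrightarrow> is_split x \<Longrightarrow> is_split y \<and> deviator y = deviator x"
  by (cases rule: deviation_graph.cases) auto

lemma not_split_weight:
  "(x, y, c) \<in> deviation_graph any I own E T R \<Longrightarrow> \<not> is_split x \<Longrightarrow> c = 0"
  by (cases rule: deviation_graph.cases) auto

lemma main_step:
  "(x, y, c) \<in> deviation_graph False I own E T R \<Longrightarrow>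
    (main_state x, main_vert x, main_state y, main_vert y) \<in> T"
  by (cases rule: deviation_graph.cases) auto

lemma dev_step:
  assumes "(x, y, c) \<in> deviation_graph False I own E T R" "T \<subseteq> S \<times> V \<times> S \<times> V"
  shows "(dev_vert x, dev_vert y) \<in> E \<and> (\<exists>u. (dev_state x, dev_vert x, dev_state y, u) \<in> T \<and>
    (is_split y \<longrightarrow> own (dev_vert x) = deviator y \<or> dev_vert y = u) \<and>
    (\<not> is_split x \<longrightarrow> u = main_vert y))"
  using assms(1) by (cases rule: deviation_graph.cases) auto

lemma split_weight:
  "(x, y, c) \<in> deviation_graph any I own E T R \<Longrightarrow> is_split x \<Longrightarrow>
    c = R (deviator x) (dev_vert x, dev_vert y) - R (deviator x) (main_vert x, main_vert y) \<and> deviator x \<in> I"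
  by (cases rule: deviation_graph.cases) auto

lemma split_start:
  "(x, y, c) \<in> deviation_graph any I own E T R \<Longrightarrow> \<not> is_split x \<Longrightarrow> is_split y \<Longrightarrow>
    main_vert y \<noteq> dev_vert y \<and> main_state y = dev_state y \<and> deviator y = own (main_vert x)"
  by (cases rule: deviation_graph.cases) auto

lemma not_split_eq: "\<not> is_split x \<Longrightarrow> dev_vert x = main_vert x \<and> dev_state x = main_state x"
  by (cases x) auto

lemma not_nash_if_positive_walk:
  fixes G :: "('i, 'v) game" and M :: "('q, 'v) mealy"
  assumes G: "game G" and M: "mealy_machine G M" and v\<^sub>0: "v\<^sub>0 \<in> verts G"
    and mp: "mean_payoff_from G r v\<^sub>0" and R: "scaled G r R"
    and pw: "positive_walk (game_graph False G M R) (Common (init M) v\<^sub>0)"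
  shows "\<exists>g. (\<lambda>_. g) \<in> Comp G v\<^sub>0 M \<and> \<not> nash_equilibrium G v\<^sub>0 (\<lambda>_. g)"
proof -
  let ?E = "game_graph False G M R"
  from positive_walk_lasso[OF pw] obtain F C n m where F0: "F 0 = Common (init M) v\<^sub>0"
    and FE: "\<And>k. (F k, F (Suc k), C k) \<in> ?E" and m: "m > 0"
    and per: "\<And>k. n \<le> k \<Longrightarrow> F (k + m) = F k" "\<And>k. n \<le> k \<Longrightarrow> C (k + m) = C k"
    and pos: "(\<Sum>k<m. C (n + k)) > 0" by blast
  define \<pi> where "\<pi> k = main_vert (F k)" for k
  define \<rho> where "\<rho> k = dev_vert (F k)" for k
  define Q where "Q k = main_state (F k)" for k
  define P where "P k = dev_state (F k)" for k
  have split_up: "is_split (F k) \<and> deviator (F k) = deviator (F j)" if "j \<le> k" "is_split (F j)" for j k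
    using that by (induction k rule: dec_induct) (use is_split_step[OF FE] in auto)
  \<comment> \<open>The edges that leave \<open>Common\<close> vertices have weight
    \<open>0\<close>, and \<open>Split\<close> vertices are never left for \<open>Common\<close>
    ones. If the cycle began at a \<open>Common\<close> vertex, then the lasso would contain no
    \<open>Split\<close> at all and its cycle would have weight \<open>0\<close>.\<close>
  have n: "is_split (F n)"
  proof (rule ccontr)
    assume *: "\<not> is_split (F n)"
    have **: "F (n + l * m) = F n" for l
      by (induction l) (use per(1)[of "n + _ * m"] in \<open>auto simp: algebra_simps\<close>)
    have "\<not> is_split (F k)" for k
    proof
      assume "is_split (F k)"
      moreover have "k \<le> n + k * m" using m by (cases m) auto
      ultimately show False using split_up ** * by metis
    qed
    then have "C k = 0" for k using not_split_weight[OF FE] by blast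
    with pos show False by simp
  qed
  define J where "J = (LEAST k. is_split (F k))"
  have J: "is_split (F J)" unfolding J_def using n by (rule LeastI)
  have bef: "\<not> is_split (F k)" if "k < J" for k using not_less_Least that by (auto simp: J_def)
  have "J \<le> n" unfolding J_def using n by (rule Least_le)
  have "J \<noteq> 0"
  proof
    assume "J = 0"
    with J F0 show False by simp
  qed
  then obtain j where j: "J = Suc j" by (cases J) auto
  define i where "i = deviator (F J)"
  have i: "i \<in> players G" using split_weight[OF FE J] by (simp add: i_def)
  have dev: "deviator (F k) = i" if "J \<le> k" for k using split_up[OF that J] by (simp add: i_def)
  have spl: "is_split (F k) \<longleftrightarrow> J \<le> k" for k using split_up J bef not_le by blast
  note start = split_start[OF FE[of j]]
  have J': "\<pi> J \<noteq> \<rho> J" "Q J = P J" "i = owner G (\<pi> j)"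
    using start spl[of j] J by (auto simp: \<pi>_def \<rho>_def Q_def P_def j i_def)
  have eq: "\<pi> k = \<rho> k \<and> Q k = P k" if "k < J" for k
    using not_split_eq[OF bef[OF that]] by (simp add: \<pi>_def \<rho>_def Q_def P_def)
  have Tsub: "trans M \<subseteq> states M \<times> verts G \<times> states M \<times> verts G"
    using M by (simp add: mealy_machine_def)
  have Q: "(Q k, \<pi> k, Q (Suc k), \<pi> (Suc k)) \<in> trans M" for k
    unfolding Q_def \<pi>_def using main_step[OF FE] .
  have "\<forall>k. \<exists>u. (P k, \<rho> k, P (Suc k), u) \<in> trans M \<and> (J \<le> Suc k \<longrightarrow> owner G (\<rho> k) = i \<or> \<rho> (Suc k) = u)"
  proof
    fix k
    from dev_step[OF FE[of k] Tsub] spl[of "Suc k"] dev[of "Suc k"] show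
      "\<exists>u. (P k, \<rho> k, P (Suc k), u) \<in> trans M \<and> (J \<le> Suc k \<longrightarrow> owner G (\<rho> k) = i \<or> \<rho> (Suc k) = u)"
      unfolding P_def \<rho>_def by metis
  qed
  then obtain U where U: "\<And>k. (P k, \<rho> k, P (Suc k), U k) \<in> trans M"
    "\<And>k. J \<le> Suc k \<Longrightarrow> owner G (\<rho> k) = i \<or> \<rho> (Suc k) = U k" by metis
  have \<rho>_edge: "(\<rho> k, \<rho> (Suc k)) \<in> edges G" for k
    unfolding \<rho>_def using dev_step[OF FE Tsub] by blast
  have \<pi>_edge: "(\<pi> k, \<pi> (Suc k)) \<in> edges G" for k
    using mealy_machine_state[OF M Q] by blast
  have start0: "\<pi> 0 = v\<^sub>0" "\<rho> 0 = v\<^sub>0" "Q 0 = init M" by (simp_all add: \<pi>_def \<rho>_def Q_def F0)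
  \<comment> \<open>The plays first differ at position \<open>J\<close>, so the shared prefixes are
    those of length at most \<open>J\<close>. Beyond them, prescriptions along the two plays concern
    different histories.\<close>
  have same: "map \<rho> [0..<k] = map \<pi> [0..<k] \<longleftrightarrow> k \<le> J" for k
  proof
    assume *: "map \<rho> [0..<k] = map \<pi> [0..<k]"
    show "k \<le> J"
    proof (rule ccontr)
      assume "\<not> k \<le> J"
      then have "map \<rho> [0..<k] ! J = \<rho> J" "map \<pi> [0..<k] ! J = \<pi> J" by simp_all
      with * J'(1) show False by metis
    qed
  next
    assume "k \<le> J"
    with eq show "map \<rho> [0..<k] = map \<pi> [0..<k]" by auto
  qed
  let ?on = "\<lambda>h. h = map \<pi> [0..<length h]"
  define D where "D = {h. ?on h \<or> h = map \<rho> [0..<length h]}"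
  \<comment> \<open>On shared prefixes the compatible play has precedence; at length
    \<open>J\<close>, where the plays part, both require the same state. The move after a deviating
    prefix is the one proposed at its last position, hence \<open>U (length h - 1)\<close>.\<close>
  define f where "f h = (if ?on h then Q (length h) else P (length h))" for h
  define g where "g h = (if ?on h then \<pi> (length h) else U (length h - 1))" for h
  have "(h = [] \<or> h \<in> D) \<and> (f h, v, f (h @ [v]), g (h @ [v])) \<in> trans M" if "h @ [v] \<in> D" for h v
  proof (cases "?on (h @ [v])")
    case True
    then have "h = map \<pi> [0..<length h]" "v = \<pi> (length h)" by simp_all
    with True Q[of "length h"] show ?thesis by (simp add: D_def f_def g_def)
  next
    case False
    with that have *: "h @ [v] = map \<rho> [0..<Suc (length h)]" unfolding D_def by auto
    then have h: "h = map \<rho> [0..<length h]" "v = \<rho> (length h)" by simp_all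
    from False * same[of "Suc (length h)"] have l: "J \<le> length h" by (metis length_append_singleton not_less_eq_eq)
    have "f h = P (length h)"
    proof (cases "?on h")
      case True
      with h(1) same[of "length h"] l have "length h = J" by simp
      with J'(2) True show ?thesis by (simp add: f_def)
    qed (simp add: f_def)
    moreover have "f (h @ [v]) = P (Suc (length h))" "g (h @ [v]) = U (length h)"
      using False by (auto simp add: f_def g_def)
    ultimately show ?thesis using U(1)[of "length h"] h by (simp add: D_def)
  qed
  moreover have "f [] = init M" by (simp add: f_def start0)
  ultimately obtain g' where g': "(\<lambda>_. g') \<in> Comp G v\<^sub>0 M" "\<And>h. h \<in> D \<Longrightarrow> g' h = g h"
    using Comp_extend[OF G M v\<^sub>0, of f D g] by blast
  have g\<pi>: "g' (map \<pi> [0..<Suc k]) = \<pi> (Suc k)" for k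
  proof -
    have "map \<pi> [0..<Suc k] \<in> D" by (simp add: D_def)
    from g'(2)[OF this] show ?thesis by (simp add: g_def)
  qed
  have g\<rho>: "g' (map \<rho> [0..<Suc k]) = (if Suc k \<le> J then \<pi> (Suc k) else U k)" for k
  proof -
    have "map \<rho> [0..<Suc k] \<in> D" by (simp add: D_def)
    from g'(2)[OF this] show ?thesis using same[of "Suc k"] by (simp add: g_def)
  qed
  have \<pi>_out: "\<pi> = outcome G v\<^sub>0 (\<lambda>_. g')"
    by (rule outcome_unique) (simp_all only: start0 move_def g\<pi>)
  \<comment> \<open>The deviating strategy only has to produce \<open>\<rho>\<close>; off that play
    it falls back on \<open>g'\<close>, which makes it legal at every history.\<close>
  define s where "s h = (if h = map \<rho> [0..<length h] then \<rho> (length h) else g' h)" for h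
  have s\<rho>: "s (map \<rho> [0..<Suc k]) = \<rho> (Suc k)" for k by (simp add: s_def)
  have \<rho>_out: "\<rho> = outcome G v\<^sub>0 ((\<lambda>_. g')(i := s))"
  proof (rule outcome_unique)
    fix k
    show "\<rho> (Suc k) = move G ((\<lambda>_. g')(i := s)) (map \<rho> [0..<Suc k])"
    proof (cases "owner G (\<rho> k) = i")
      case True
      have "move G ((\<lambda>_. g')(i := s)) (map \<rho> [0..<Suc k]) = s (map \<rho> [0..<Suc k])"
        using True by (simp add: move_def)
      then show ?thesis by (simp only: s\<rho>)
    next
      case False
      then have "k \<noteq> j" using J'(3) eq[of j] j by auto
      have "move G ((\<lambda>_. g')(i := s)) (map \<rho> [0..<Suc k]) = g' (map \<rho> [0..<Suc k])"
        using False by (simp add: move_def)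
      also have "\<dots> = \<rho> (Suc k)"
      proof (cases "Suc k \<le> J")
        case True
        with \<open>k \<noteq> j\<close> j eq[of "Suc k"] show ?thesis unfolding g\<rho> by simp
      next
        case no: False
        with U(2)[of k] False show ?thesis unfolding g\<rho> by simp
      qed
      finally show ?thesis ..
    qed
  qed (rule start0)
  have "strategy G v\<^sub>0 i s"
    unfolding strategy_def
  proof (intro allI impI, elim conjE)
    fix h v assume h: "history_from G v\<^sub>0 (h @ [v])" "owner G v = i"
    show "(v, s (h @ [v])) \<in> edges G"
    proof (cases "h @ [v] = map \<rho> [0..<Suc (length h)]")
      case True
      then have "v = \<rho> (length h)" by simp
      with True s\<rho>[of "length h"] \<rho>_edge[of "length h"] show ?thesis by metis
    next
      case False
      then have "s (h @ [v]) = g' (h @ [v])" by (auto simp add: s_def)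
      moreover have "strategy G v\<^sub>0 i g'" using g'(1) i by (simp add: Comp_def strategy_profile_def)
      ultimately show ?thesis using h by (simp add: strategy_def)
    qed
  qed
  moreover have "payoff G i \<pi> < payoff G i \<rho>"
  proof -
    have \<pi>_per: "\<pi> (k + m) = \<pi> k" and \<rho>_per: "\<rho> (k + m) = \<rho> k" if "n \<le> k" for k
      using per(1)[OF that] by (simp_all add: \<pi>_def \<rho>_def)
    have "rewards r i \<pi> (k + m) = rewards r i \<pi> k" "rewards r i \<rho> (k + m) = rewards r i \<rho> k"
      if "n \<le> k" for k
      using that \<pi>_per[of k] \<pi>_per[of "Suc k"] \<rho>_per[of k] \<rho>_per[of "Suc k"] by (simp_all add: rewards_def)
    note means = mean_periodic[where x = "rewards r i \<pi>", OF this(1) m]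
      mean_periodic[where x = "rewards r i \<rho>", OF this(2) m]
    from R i obtain D where D: "D > 0" "\<And>e. e \<in> edges G \<Longrightarrow> real_of_int (R i e) = D * of_rat (r i e)"
      by (auto simp: scaled_def)
    have "real_of_int (C k) = D * (rewards r i \<rho> k - rewards r i \<pi> k)" if "J \<le> k" for k
      using split_weight[OF FE[of k]] spl[of k] that dev[of k] D(2)[OF \<rho>_edge[of k]] D(2)[OF \<pi>_edge[of k]]
      by (simp add: rewards_def \<pi>_def \<rho>_def algebra_simps)
    then have "real_of_int (\<Sum>k<m. C (n + k)) = D * (\<Sum>k<m. rewards r i \<rho> (n + k) - rewards r i \<pi> (n + k))"
      using \<open>J \<le> n\<close> by (simp add: sum_distrib_left)
    with pos have "0 < D * (\<Sum>k<m. rewards r i \<rho> (n + k) - rewards r i \<pi> (n + k))" by (metis of_int_0_less_iff)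
    with D(1) have "(\<Sum>k<m. rewards r i \<pi> (n + k)) < (\<Sum>k<m. rewards r i \<rho> (n + k))"
      by (simp add: zero_less_mult_iff sum_subtractf)
    then have "mean (rewards r i \<pi>) < mean (rewards r i \<rho>)"
      using m by (simp add: means divide_strict_right_mono)
    moreover have "play G \<pi>" "play G \<rho>" using \<pi>_edge \<rho>_edge by (simp_all add: play_def)
    ultimately have "ereal (payoff G i \<pi>) < ereal (payoff G i \<rho>)"
      using mp i start0(1,2) by (simp add: mean_payoff_from_def)
    then show ?thesis by simp
  qed
  ultimately have "\<not> nash_equilibrium G v\<^sub>0 (\<lambda>_. g')"
    using i unfolding nash_equilibrium_def \<pi>_out \<rho>_out not_all by (auto simp: not_le)
  with g'(1) show ?thesis by blast
qed

theorem nash_iff_no_positive_walk: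
  assumes "game G" "mealy_machine G M" "v\<^sub>0 \<in> verts G" "mean_payoff_from G r v\<^sub>0" "scaled G r R"
  shows "(\<forall>\<sigma> \<in> Comp G v\<^sub>0 M. nash_equilibrium G v\<^sub>0 \<sigma>) \<longleftrightarrow>
    \<not> positive_walk (game_graph False G M R) (Common (init M) v\<^sub>0)"
  using nash_if_no_positive_walk[OF assms] not_nash_if_positive_walk[OF assms] by blast

section \<open>Subgame-perfect equilibria and positive closed walks\<close>

lemma walk_mono: "walk E u n a v \<Longrightarrow> E \<subseteq> E' \<Longrightarrow> walk E' u n a v"
  by (induction rule: walk.induct) (auto intro: walk.intros)

lemma positive_walk_mono: "positive_walk E s \<Longrightarrow> E \<subseteq> E' \<Longrightarrow> positive_walk E' s"
  unfolding positive_walk_def using walk_mono by metis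

lemma positive_walk_from: "walk E s n a u \<Longrightarrow> positive_walk E u \<Longrightarrow> positive_walk E s"
  unfolding positive_walk_def using walk_append by metis

lemma deviation_graph_mono: "deviation_graph False I own E T R \<subseteq> deviation_graph True I own E T R"
proof
  fix e :: "('a, 'b, 'c) node \<times> ('a, 'b, 'c) node \<times> int"
  obtain x y c where e: "e = (x, y, c)" by (cases e)
  assume "e \<in> deviation_graph False I own E T R"
  then show "e \<in> deviation_graph True I own E T R"
    unfolding e by (cases rule: deviation_graph.cases) (auto intro: deviation_graph.intros)
qed

lemma deviation_graph_split:
  assumes "(x, y, c) \<in> deviation_graph True I own E T R" "is_split x"
  shows "(x, y, c) \<in> deviation_graph False I own E T R \<and> is_split y"
  using assms by (cases rule: deviation_graph.cases) (auto intro: deviation_graph.intros)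

lemma walk_split:
  "walk (deviation_graph True I own E T R) x n a y \<Longrightarrow> is_split x \<Longrightarrow>
    walk (deviation_graph False I own E T R) x n a y \<and> is_split y"
proof (induction rule: walk.induct)
  case (walk_step u n a v v' c)
  then show ?case using deviation_graph_split by (blast intro: walk.walk_step)
qed (simp add: walk_refl)

text \<open>The data that \<open>Comp_extend\<close> needs along a single history \<open>h\<close>:
  states \<open>f\<close> and proposed moves \<open>g\<close> at its prefixes. The proposed moves
  need not be the vertices by which \<open>h\<close> continues.\<close>

definition tracked :: "('q, 'v) mealy \<Rightarrow> ('v list \<Rightarrow> 'q) \<Rightarrow> ('v list \<Rightarrow> 'v) \<Rightarrow> 'v list \<Rightarrow> bool" where
  "tracked M f g h \<longleftrightarrow> f [] = init M \<and>
     (\<forall>h' u h''. h = h' @ [u] @ h'' \<longrightarrow> (f h', u, f (h' @ [u]), g (h' @ [u])) \<in> trans M)"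

lemma tracked_snoc:
  assumes "tracked M f g h" "(f h, v, q, u) \<in> trans M"
  shows "tracked M (f(h @ [v] := q)) (g(h @ [v] := u)) (h @ [v])"
  unfolding tracked_def
proof (intro conjI allI impI)
  show "(f(h @ [v] := q)) [] = init M" using assms(1) by (simp add: tracked_def)
  fix h' x h'' assume eq: "h @ [v] = h' @ [x] @ h''"
  show "((f(h @ [v] := q)) h', x, (f(h @ [v] := q)) (h' @ [x]), (g(h @ [v] := u)) (h' @ [x])) \<in> trans M"
  proof (cases h'' rule: rev_cases)
    case Nil
    with eq assms(2) show ?thesis by simp
  next
    case (snoc ys y)
    with eq have h: "h = h' @ [x] @ ys" by simp
    then have "h' \<noteq> h @ [v]" "h' @ [x] \<noteq> h @ [v]" by auto
    with h assms(1) show ?thesis unfolding tracked_def by simp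
  qed
qed

lemma tracked_state: "mealy_machine G M \<Longrightarrow> tracked M f g h \<Longrightarrow> f h \<in> states M"
proof (cases h rule: rev_cases)
  case (snoc h' u)
  assume "mealy_machine G M" "tracked M f g h"
  moreover from this(2) snoc have "(f h', u, f (h' @ [u]), g (h' @ [u])) \<in> trans M"
    unfolding tracked_def by simp
  ultimately show ?thesis using mealy_machine_state snoc by metis
qed (auto simp: tracked_def mealy_machine_def)

text \<open>As long as a walk stays in the first phase, it is a history together with a choice of
  states along it. When it splits, the last \<open>Common\<close> vertex is remembered: the rest of
  the walk also exists in the graph of the Nash criterion.\<close>

lemma walk_tracked:
  fixes G :: "('i, 'v) game" and M :: "('q, 'v) mealy" and R and v\<^sub>0 :: 'v
  defines "reached q v \<equiv> \<exists>f g h. history_from G v\<^sub>0 (h @ [v]) \<and> tracked M f g h \<and> f h = q"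
  assumes "walk (game_graph True G M R) s n a x" "s = Common (init M) v\<^sub>0"
  shows "if is_split x
    then \<exists>q v m b. reached q v \<and> walk (game_graph False G M R) (Common q v) m b x
    else a = 0 \<and> reached (main_state x) (main_vert x)"
  using assms(2,3)
proof (induction rule: walk.induct)
  case (walk_refl u)
  have "reached (init M) v\<^sub>0"
    unfolding reached_def
    by (intro exI[of _ "\<lambda>_. init M"] exI[of _ undefined] exI[of _ "[]"]) (simp add: tracked_def)
  with walk_refl show ?case by simp
next
  case (walk_step s n a x y c)
  show ?case
  proof (cases "is_split x")
    case True
    with walk_step obtain q v m b where
      "reached q v" "walk (game_graph False G M R) (Common q v) m b x" by auto
    moreover note deviation_graph_split[OF walk_step.hyps(2) True]
    ultimately show ?thesis using walk.walk_step by (metis (full_types))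
  next
    case False
    with walk_step have a: "a = 0" and x: "reached (main_state x) (main_vert x)" by auto
    from walk_step.hyps(2) False show ?thesis
    proof (cases rule: deviation_graph.cases)
      case (common q v q' u u')
      with x obtain f g h where h: "history_from G v\<^sub>0 (h @ [v])" "tracked M f g h" "f h = q"
        unfolding reached_def by auto
      have "history_from G v\<^sub>0 ((h @ [v]) @ [u'])"
        using h(1) common by (subst history_from_snoc) auto
      moreover have "tracked M (f(h @ [v] := q')) (g(h @ [v] := u)) (h @ [v])"
        using tracked_snoc[OF h(2)] h(3) common by blast
      ultimately have "reached q' u'" unfolding reached_def by (metis fun_upd_same)
      with common a show ?thesis by simp
    next
      case (deviate q v q' u u')
      then have "(x, y, c) \<in> game_graph False G M R" by (auto intro: deviation_graph.deviate)
      from walk_edge[OF this] x deviate show ?thesis by auto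
    qed auto
  qed
qed

lemma positive_walk_tracked:
  assumes "positive_walk (game_graph True G M R) (Common (init M) v\<^sub>0)"
  shows "\<exists>f g h v. history_from G v\<^sub>0 (h @ [v]) \<and> tracked M f g h \<and>
    positive_walk (game_graph False G M R) (Common (f h) v)"
proof -
  from assms obtain x n a m b where w: "walk (game_graph True G M R) (Common (init M) v\<^sub>0) n a x"
    "walk (game_graph True G M R) x m b x" "b > 0"
    unfolding positive_walk_def by blast
  show ?thesis
  proof (cases "is_split x")
    case True
    with walk_tracked[OF w(1) refl] obtain f g h v k c where
      "history_from G v\<^sub>0 (h @ [v])" "tracked M f g h" "walk (game_graph False G M R) (Common (f h) v) k c x"
      by auto
    moreover from walk_split[OF w(2) True] have "walk (game_graph False G M R) x m b x" by simp
    ultimately show ?thesis using w(3) unfolding positive_walk_def by blast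
  next
    case False
    \<comment> \<open>Both the walk to \<open>x\<close> and its extension by the closed walk have
      weight \<open>0\<close>, which contradicts \<open>b > 0\<close>.\<close>
    with walk_tracked[OF w(1) refl] walk_tracked[OF walk_append[OF w(2,1)] refl] w(3)
    show ?thesis by simp
  qed
qed

text \<open>The machine of the subgame starts in the state after \<open>h\<close>, without
  \<open>v\<close>, since \<open>v\<close> is the first vertex that it reads.\<close>

lemma Comp_subgame:
  assumes "\<sigma> \<in> Comp G v\<^sub>0 M" "st [] = init M" "history_from G v\<^sub>0 (h @ [v])"
    "\<forall>h v. history_from G v\<^sub>0 (h @ [v]) \<longrightarrow> (st h, v, st (h @ [v]), move G \<sigma> (h @ [v])) \<in> trans M"
  shows "(\<lambda>i h'. \<sigma> i (h @ h')) \<in> Comp (subgame G h) v (M\<lparr>init := st h\<rparr>)"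
  unfolding Comp_def strategy_profile_def strategy_def mem_Collect_eq
proof (intro conjI ballI allI impI exI[of _ "\<lambda>h'. st (h @ h')"]; (elim conjE)?)
  fix i h' u
  assume i: "i \<in> players (subgame G h)" and h': "history_from (subgame G h) v (h' @ [u])" "owner (subgame G h) u = i"
  from history_from_append[OF assms(3), of "h' @ [u]"] h' have "history_from G v\<^sub>0 ((h @ h') @ [u])" by simp
  moreover have "strategy G v\<^sub>0 i (\<sigma> i)" using assms(1) i by (simp add: Comp_def strategy_profile_def)
  ultimately have "(u, \<sigma> i ((h @ h') @ [u])) \<in> edges G"
    using h'(2) unfolding strategy_def subgame_simps by blast
  then show "(u, \<sigma> i (h @ h' @ [u])) \<in> edges (subgame G h)" by simp
next
  fix h' u
  assume "history_from (subgame G h) v (h' @ [u])"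
  with history_from_append[OF assms(3), of "h' @ [u]"] have "history_from G v\<^sub>0 ((h @ h') @ [u])" by simp
  from assms(4)[rule_format, OF this]
  show "(st (h @ h'), u, st (h @ h' @ [u]), move (subgame G h) (\<lambda>i h'. \<sigma> i (h @ h')) (h' @ [u]))
      \<in> trans (M\<lparr>init := st h\<rparr>)"
    by (simp add: move_def)
qed simp

text \<open>Each subgame is judged by the Nash criterion for the machine started in the state after
  \<open>h\<close>. In one direction, histories become walks along \<open>Common\<close> vertices;
  in the other, a counterexample in one subgame is glued to the choices along the history that leads
  there.\<close>

theorem subgame_perfect_iff_no_positive_walk:
  fixes G :: "('i, 'v) game" and M :: "('q, 'v) mealy"
  assumes G: "game G" and M: "mealy_machine G M" and v\<^sub>0: "v\<^sub>0 \<in> verts G"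
    and mp: "mean_payoff_from G r v\<^sub>0" and R: "scaled G r R"
  shows "(\<forall>\<sigma> \<in> Comp G v\<^sub>0 M. subgame_perfect_equilibrium G v\<^sub>0 \<sigma>) \<longleftrightarrow>
    \<not> positive_walk (game_graph True G M R) (Common (init M) v\<^sub>0)"
proof -
  have R': "scaled (subgame G h) r R" for h using R by (simp add: scaled_def)
  have sub: "game (subgame G h)" "mealy_machine (subgame G h) (M\<lparr>init := q\<rparr>)" "v \<in> verts (subgame G h)"
      "mean_payoff_from (subgame G h) r v" "scaled (subgame G h) r R"
    if "history_from G v\<^sub>0 (h @ [v])" "q \<in> states M" for h v q
    using that G mealy_machine_subgame[OF M] history_from_vert[OF G v\<^sub>0] mean_payoff_from_subgame[OF G mp] R'
    by auto
  show ?thesis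
  proof
    assume np: "\<not> positive_walk (game_graph True G M R) (Common (init M) v\<^sub>0)"
    show "\<forall>\<sigma> \<in> Comp G v\<^sub>0 M. subgame_perfect_equilibrium G v\<^sub>0 \<sigma>"
      unfolding subgame_perfect_equilibrium_def
    proof (intro ballI allI impI)
      fix \<sigma> h v assume \<sigma>: "\<sigma> \<in> Comp G v\<^sub>0 M" and h: "history_from G v\<^sub>0 (h @ [v])"
      from Comp_states[OF \<sigma>] obtain st where st_Nil: "st [] = init M"
        and st: "\<forall>h v. history_from G v\<^sub>0 (h @ [v]) \<longrightarrow>
          (st h, v, st (h @ [v]), move G \<sigma> (h @ [v])) \<in> trans M" by blast
      have w: "\<exists>n a. walk (game_graph True G M R) (Common (init M) v\<^sub>0) n a (Common (st h) v)"
        using h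
      proof (induction h arbitrary: v rule: rev_induct)
        case Nil
        then show ?case by (auto simp: st_Nil intro: walk_refl)
      next
        case (snoc u h)
        then have h: "history_from G v\<^sub>0 (h @ [u])" "(u, v) \<in> edges G"
          using history_from_snoc[of "h @ [u]" G v\<^sub>0 v] by auto
        have "(Common (st h) u, Common (st (h @ [u])) v, 0) \<in> game_graph True G M R"
          using st h by (intro deviation_graph.common) auto
        moreover obtain n a where "walk (game_graph True G M R) (Common (init M) v\<^sub>0) n a (Common (st h) u)"
          using snoc.IH[OF h(1)] by blast
        ultimately show ?case by (blast dest: walk_step)
      qed
      have q: "st h \<in> states M"
      proof (cases h rule: rev_cases)
        case Nil
        with M st_Nil show ?thesis by (simp add: mealy_machine_def)
      next
        case (snoc h' u)
        with h have "history_from G v\<^sub>0 (h' @ [u])" using history_from_snoc[of "h' @ [u]" G v\<^sub>0 v] by auto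
        with st snoc show ?thesis using mealy_machine_state[OF M] by blast
      qed
      have "\<not> positive_walk (game_graph False G M R) (Common (st h) v)"
      proof
        assume "positive_walk (game_graph False G M R) (Common (st h) v)"
        from positive_walk_mono[OF this deviation_graph_mono]
        have "positive_walk (game_graph True G M R) (Common (st h) v)" .
        moreover from w obtain n a where
          "walk (game_graph True G M R) (Common (init M) v\<^sub>0) n a (Common (st h) v)" by blast
        ultimately show False using positive_walk_from np by metis
      qed
      then show "nash_equilibrium (subgame G h) v (\<lambda>i h'. \<sigma> i (h @ h'))"
        by (intro nash_if_no_positive_walk[OF sub[OF h q]] Comp_subgame[OF \<sigma> st_Nil h st]) simp
    qed
  next
    assume spe: "\<forall>\<sigma> \<in> Comp G v\<^sub>0 M. subgame_perfect_equilibrium G v\<^sub>0 \<sigma>"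
    show "\<not> positive_walk (game_graph True G M R) (Common (init M) v\<^sub>0)"
    proof
      assume "positive_walk (game_graph True G M R) (Common (init M) v\<^sub>0)"
      from positive_walk_tracked[OF this] obtain f g h v where h: "history_from G v\<^sub>0 (h @ [v])"
        and fg: "tracked M f g h" and pw: "positive_walk (game_graph False G M R) (Common (f h) v)"
        by blast
      have "\<exists>g. (\<lambda>_. g) \<in> Comp (subgame G h) v (M\<lparr>init := f h\<rparr>) \<and> \<not> nash_equilibrium (subgame G h) v (\<lambda>_. g)"
        using pw by (intro not_nash_if_positive_walk[OF sub[OF h tracked_state[OF M fg]]]) simp
      then obtain g\<^sub>1 where g\<^sub>1: "(\<lambda>_. g\<^sub>1) \<in> Comp (subgame G h) v (M\<lparr>init := f h\<rparr>)"
        "\<not> nash_equilibrium (subgame G h) v (\<lambda>_. g\<^sub>1)" by blast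
      from Comp_states[OF g\<^sub>1(1)] obtain st where st_Nil: "st [] = f h"
        and st: "\<And>h' u. history_from G v (h' @ [u]) \<Longrightarrow> (st h', u, st (h' @ [u]), g\<^sub>1 (h' @ [u])) \<in> trans M"
        by (auto simp: move_def)
      \<comment> \<open>Prefixes of \<open>h\<close> keep the tracked data, and extensions of
        \<open>h\<close> into the subgame follow \<open>g\<^sub>1\<close>. At \<open>h\<close>
        itself both sides give the same state, and the move is that of \<open>g\<close>, because
        \<open>g\<^sub>1\<close> has no meaning at the empty history.\<close>
      define D where "D = {h'. (\<exists>h''. h' @ h'' = h) \<or> (\<exists>h''. h' = h @ h'' \<and> h'' \<noteq> [] \<and> hd h'' = v)}"
      define f' where "f' h' = (if \<exists>h''. h' = h @ h'' then st (drop (length h) h') else f h')" for h'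
      define g' where "g' h' = (if \<exists>h''. h' = h @ h'' \<and> h'' \<noteq> [] then g\<^sub>1 (drop (length h) h') else g h')" for h'
      have f'_app: "f' (h @ h') = st h'" for h' by (simp add: f'_def)
      have f'_pre: "f' h' = f h'" if "h' @ h'' = h" for h' h''
        using that st_Nil by (auto simp: f'_def)
      have g'_pre: "g' h' = g h'" if "h' @ h'' = h" for h' h''
        using that by (auto simp: g'_def)
      have g'_app: "g' (h @ h') = g\<^sub>1 h'" if "h' \<noteq> []" for h' using that by (simp add: g'_def)
      have "\<exists>g''. (\<lambda>_. g'') \<in> Comp G v\<^sub>0 M \<and> (\<forall>h \<in> D. g'' h = g' h)"
      proof (rule Comp_extend[OF G M v\<^sub>0, of f'])
        show "f' [] = init M" using f'_pre[of "[]" h] fg by (simp add: tracked_def)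
        fix h' u assume D: "h' @ [u] \<in> D" and hist: "history_from G v\<^sub>0 (h' @ [u])"
        from D consider h'' where "(h' @ [u]) @ h'' = h" | h'' where "h' @ [u] = h @ h''" "h'' \<noteq> []" "hd h'' = v"
          unfolding D_def by blast
        then show "(h' = [] \<or> h' \<in> D) \<and> (f' h', u, f' (h' @ [u]), g' (h' @ [u])) \<in> trans M"
        proof cases
          case (1 h'')
          then have "(f h', u, f (h' @ [u]), g (h' @ [u])) \<in> trans M"
            using fg unfolding tracked_def by (metis append.assoc)
          moreover have "f' h' = f h'" "h' \<in> D" using 1 f'_pre[of h' "u # h''"] by (auto simp: D_def)
          ultimately show ?thesis using 1 f'_pre[of "h' @ [u]" h''] g'_pre[of "h' @ [u]" h''] by simp
        next
          case (2 h'')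
          then obtain ys where ys: "h'' = ys @ [u]" by (cases h'' rule: rev_cases) auto
          with 2 have h': "h' = h @ ys" by simp
          have "history_from G v (ys @ [u])"
            using history_from_drop[of G v\<^sub>0 h "ys @ [u]"] hist h' 2(3) ys by simp
          moreover have "h' = [] \<or> h' \<in> D"
          proof (cases "ys = []")
            case True
            then show ?thesis using h' by (simp add: D_def)
          next
            case False
            then show ?thesis using h' 2(3) ys by (auto simp: D_def)
          qed
          ultimately show ?thesis
            using st[of ys u] g'_app[of "ys @ [u]"] f'_app[of "ys @ [u]"] f'_app[of ys] h' by simp
        qed
      qed
      then obtain g'' where g'': "(\<lambda>_. g'') \<in> Comp G v\<^sub>0 M" "\<And>h'. h' \<in> D \<Longrightarrow> g'' h' = g' h'" by blast
      have "nash_equilibrium (subgame G h) v (\<lambda>_ h'. g'' (h @ h'))"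
        using spe[unfolded subgame_perfect_equilibrium_def, rule_format, OF g''(1) h] .
      moreover have "nash_equilibrium (subgame G h) v (\<lambda>_ h'. g'' (h @ h')) \<longleftrightarrow>
          nash_equilibrium (subgame G h) v (\<lambda>_. g\<^sub>1)"
        by (rule nash_equilibrium_cong) (use g''(2) g'_app in \<open>auto simp: D_def\<close>)
      ultimately show False using g\<^sub>1(2) by simp
    qed
  qed
qed

section \<open>Reading an instance\<close>

text \<open>The decoding is total: on any sequence, entries beyond the end and negative counts are
  taken as \<open>0\<close>. Positions depend on counts read before: the owners follow the first two
  numbers, then come the number of edges, a block of \<open>stride\<close> entries per edge, four
  numbers from \<open>mid_pos\<close> on, and four entries per transition.\<close>

definition n_players :: "int list \<Rightarrow> nat" where "n_players w = nat (input_at w 0)"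
definition n_verts :: "int list \<Rightarrow> nat" where "n_verts w = nat (input_at w 1)"
definition n_edges :: "int list \<Rightarrow> nat" where "n_edges w = nat (input_at w (n_verts w + 2))"
definition stride :: "int list \<Rightarrow> nat" where "stride w = 2 + n_players w * 2"
definition edge_pos :: "int list \<Rightarrow> nat \<Rightarrow> nat" where "edge_pos w e = n_verts w + 3 + e * stride w"
definition mid_pos :: "int list \<Rightarrow> nat" where "mid_pos w = edge_pos w (n_edges w)"
definition n_states :: "int list \<Rightarrow> nat" where "n_states w = nat (input_at w (mid_pos w + 1))"
definition n_trans :: "int list \<Rightarrow> nat" where "n_trans w = nat (input_at w (mid_pos w + 3))"
definition trans_pos :: "int list \<Rightarrow> nat \<Rightarrow> nat" where "trans_pos w t = mid_pos w + 4 + t * 4"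

definition edge_field :: "int list \<Rightarrow> nat \<Rightarrow> nat \<Rightarrow> int" where
  "edge_field w e j = input_at w (edge_pos w e + j)"
definition trans_field :: "int list \<Rightarrow> nat \<Rightarrow> nat \<Rightarrow> int" where
  "trans_field w t j = input_at w (trans_pos w t + j)"

definition owner_of :: "int list \<Rightarrow> nat \<Rightarrow> nat" where "owner_of w v = nat (input_at w (2 + v))"
definition edge_of :: "int list \<Rightarrow> nat \<Rightarrow> nat \<times> nat" where
  "edge_of w e = (nat (edge_field w e 0), nat (edge_field w e 1))"
definition num_of :: "int list \<Rightarrow> nat \<Rightarrow> nat \<Rightarrow> int" where "num_of w i e = edge_field w e (2 + i * 2)"
definition den_of :: "int list \<Rightarrow> nat \<Rightarrow> nat \<Rightarrow> int" where "den_of w i e = edge_field w e (3 + i * 2)"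
definition trans_of :: "int list \<Rightarrow> nat \<Rightarrow> nat \<times> nat \<times> nat \<times> nat" where
  "trans_of w t = (nat (trans_field w t 0), nat (trans_field w t 1), nat (trans_field w t 2), nat (trans_field w t 3))"
definition start_vert :: "int list \<Rightarrow> nat" where "start_vert w = nat (input_at w (mid_pos w))"
definition start_state :: "int list \<Rightarrow> nat" where "start_state w = nat (input_at w (mid_pos w + 2))"

text \<open>The last two bounds hold for every instance, because there is an edge, which lists the
  rewards of all players, and every state has a transition. With them, the loops of the program
  reach all players and states.\<close>

definition well_shaped :: "int list \<Rightarrow> bool" where
  "well_shaped w \<longleftrightarrow> 0 \<le> input_at w 0 \<and> 0 \<le> input_at w 1 \<and> 0 \<le> input_at w (n_verts w + 2) \<and>
     0 \<le> input_at w (mid_pos w + 1) \<and> 0 \<le> input_at w (mid_pos w + 3) \<and>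
     length w = mid_pos w + 4 + n_trans w * 4 \<and> n_players w \<le> length w \<and> n_states w \<le> length w"

text \<open>The upper bounds for the two vertices of a transition come from the requirement that
  they form an edge.\<close>

definition well_formed :: "int list \<Rightarrow> bool" where
  "well_formed w \<longleftrightarrow>
     (\<forall>v<n_verts w. 0 \<le> input_at w (2 + v) \<and> input_at w (2 + v) < int (n_players w)) \<and>
     (\<forall>e<n_edges w. 0 \<le> edge_field w e 0 \<and> edge_field w e 0 < int (n_verts w) \<and>
        0 \<le> edge_field w e 1 \<and> edge_field w e 1 < int (n_verts w) \<and>
        (\<forall>i<n_players w. 0 < den_of w i e)) \<and>
     (\<forall>e<n_edges w. \<forall>f<n_edges w.
        edge_field w e 0 = edge_field w f 0 \<and> edge_field w e 1 = edge_field w f 1 \<longrightarrow> e = f) \<and>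
     (\<forall>v<n_verts w. \<exists>e<n_edges w. edge_field w e 0 = int v) \<and>
     0 \<le> input_at w (mid_pos w) \<and> input_at w (mid_pos w) < int (n_verts w) \<and>
     0 \<le> input_at w (mid_pos w + 2) \<and> input_at w (mid_pos w + 2) < int (n_states w) \<and>
     (\<forall>t<n_trans w. 0 \<le> trans_field w t 0 \<and> trans_field w t 0 < int (n_states w) \<and>
        0 \<le> trans_field w t 1 \<and> 0 \<le> trans_field w t 2 \<and> trans_field w t 2 < int (n_states w) \<and>
        (\<exists>e<n_edges w. edge_field w e 0 = trans_field w t 1 \<and> edge_field w e 1 = trans_field w t 3)) \<and>
     (\<forall>t<n_trans w. \<forall>t'<n_trans w. trans_field w t 0 = trans_field w t' 0 \<and> trans_field w t 1 = trans_field w t' 1 \<and>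
        trans_field w t 2 = trans_field w t' 2 \<and> trans_field w t 3 = trans_field w t' 3 \<longrightarrow> t = t') \<and>
     (\<forall>p<n_states w. \<forall>u<n_verts w. \<exists>t<n_trans w. trans_field w t 0 = int p \<and> trans_field w t 1 = int u)"

definition valid :: "int list \<Rightarrow> bool" where "valid w \<longleftrightarrow> well_shaped w \<and> well_formed w"

text \<open>Existence of a transition is part of \<open>well_formed\<close>, so determinism amounts
  to uniqueness; different indices stand for different transitions.\<close>

definition det_code :: "int list \<Rightarrow> bool" where
  "det_code w \<longleftrightarrow> (\<forall>t<n_trans w. \<forall>t'<n_trans w.
     trans_field w t 0 = trans_field w t' 0 \<and> trans_field w t 1 = trans_field w t' 1 \<longrightarrow> t = t')"

definition edge_index :: "int list \<Rightarrow> nat \<times> nat \<Rightarrow> nat" where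
  "edge_index w p = (THE e. e < n_edges w \<and> edge_of w e = p)"

text \<open>This is the reward multiplied by all denominators of the player; leaving out the
  denominator of \<open>e\<close> replaces a division.\<close>

definition int_reward :: "int list \<Rightarrow> nat \<Rightarrow> nat \<Rightarrow> int" where
  "int_reward w i e = num_of w i e * (\<Prod>f\<in>{..<n_edges w} - {e}. den_of w i f)"

definition reward_of :: "int list \<Rightarrow> nat \<Rightarrow> nat \<times> nat \<Rightarrow> int" where
  "reward_of w i p = int_reward w i (edge_index w p)"

definition code_graph :: "bool \<Rightarrow> int list \<Rightarrow> (nat, nat, nat) node wgraph" where
  "code_graph any w = deviation_graph any {..<n_players w} (owner_of w) (edge_of w ` {..<n_edges w})
     (trans_of w ` {..<n_trans w}) (reward_of w)"

lemma input_at_append: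
  "input_at (xs @ ys) a = (if a < length xs then input_at xs a else input_at ys (a - length xs))"
  by (auto simp: input_at_def nth_append)

lemma input_at_Cons: "input_at (x # xs) a = (if a = 0 then x else input_at xs (a - 1))"
  by (auto simp: input_at_def nth_Cons')

lemma length_concat_uniform: "(\<And>x. x \<in> set xs \<Longrightarrow> length (f x) = L) \<Longrightarrow> length (concat (map f xs)) = length xs * L"
  by (induction xs) auto

lemma input_at_concat:
  "(\<And>x. x \<in> set xs \<Longrightarrow> length (f x) = L) \<Longrightarrow> i < length xs \<Longrightarrow> j < L \<Longrightarrow>
    input_at (concat (map f xs)) (i * L + j) = input_at (f (xs ! i)) j"
proof (induction xs arbitrary: i)
  case (Cons x xs)
  then show ?case by (cases i) (auto simp: input_at_append)
qed simp

lemma length_encode_edge: "length (encode_edge k num den e) = 2 + k * 2"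
  using length_concat_uniform[of "[0..<k]" "\<lambda>i. [num i e, den i e]" 2] by (simp add: encode_edge_def)

lemma encode_edge_at:
  "input_at (encode_edge k num den e) 0 = int (fst e)"
  "input_at (encode_edge k num den e) 1 = int (snd e)"
  "i < k \<Longrightarrow> input_at (encode_edge k num den e) (2 + i * 2) = num i e"
  "i < k \<Longrightarrow> input_at (encode_edge k num den e) (3 + i * 2) = den i e"
  using input_at_concat[of "[0..<k]" "\<lambda>i. [num i e, den i e]" 2 i 0]
    input_at_concat[of "[0..<k]" "\<lambda>i. [num i e, den i e]" 2 i 1]
  by (simp_all add: encode_edge_def input_at_Cons)

lemma encode_transition_at:
  "input_at (encode_transition (p, u, q, v)) 0 = int p" "input_at (encode_transition (p, u, q, v)) 1 = int u"
  "input_at (encode_transition (p, u, q, v)) 2 = int q" "input_at (encode_transition (p, u, q, v)) 3 = int v"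
  by (simp_all add: input_at_Cons)

text \<open>Each position is computed from entries read earlier, which dictates the order of the
  proof: the first two numbers locate the number of edges, this one yields \<open>mid_pos\<close>,
  and everything behind is relative to it.\<close>

lemma read_code:
  fixes own :: "nat \<Rightarrow> nat" and es ts k n s q\<^sub>0 v\<^sub>0 num den
  defines "w \<equiv> [int k, int n] @ map (\<lambda>v. int (own v)) [0..<n] @
            [int (length es)] @ concat (map (encode_edge k num den) es) @
            [int v\<^sub>0] @ [int s, int q\<^sub>0] @
            [int (length ts)] @ concat (map encode_transition ts)"
  shows "input_at w 0 = int k" "input_at w 1 = int n" "input_at w (n_verts w + 2) = int (length es)"
    "input_at w (mid_pos w) = int v\<^sub>0" "input_at w (mid_pos w + 1) = int s"
    "input_at w (mid_pos w + 2) = int q\<^sub>0" "input_at w (mid_pos w + 3) = int (length ts)"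
    "length w = mid_pos w + 4 + length ts * 4"
    "\<And>v. v < n \<Longrightarrow> input_at w (2 + v) = int (own v)"
    "\<And>e. e < length es \<Longrightarrow> edge_field w e 0 = int (fst (es ! e)) \<and> edge_field w e 1 = int (snd (es ! e))"
    "\<And>i e. e < length es \<Longrightarrow> i < k \<Longrightarrow> num_of w i e = num i (es ! e) \<and> den_of w i e = den i (es ! e)"
    "\<And>t. t < length ts \<Longrightarrow> ts ! t = (nat (trans_field w t 0), nat (trans_field w t 1), nat (trans_field w t 2), nat (trans_field w t 3)) \<and>
       (\<forall>j<4. trans_field w t j \<ge> 0)"
proof -
  let ?A = "[int k, int n] @ map (\<lambda>v. int (own v)) [0..<n] @ [int (length es)]"
  let ?E = "concat (map (encode_edge k num den) es)"
  let ?B = "[int v\<^sub>0, int s, int q\<^sub>0, int (length ts)]"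
  let ?T = "concat (map encode_transition ts)"
  have w: "w = ?A @ ?E @ ?B @ ?T" by (simp add: w_def)
  have lA: "length ?A = n + 3" by simp
  have lE: "length ?E = length es * (2 + k * 2)"
    by (rule length_concat_uniform) (rule length_encode_edge)
  have lt: "length (encode_transition t) = 4" for t by (cases t) simp
  have lT: "length ?T = length ts * 4" by (rule length_concat_uniform) (rule lt)
  define b where "b = n + 3"
  define c where "c = length es * (2 + k * 2)"
  have w_at: "input_at w a = (if a < b then input_at ?A a else if a - b < c then input_at ?E (a - b)
      else if a - b - c < 4 then input_at ?B (a - b - c) else input_at ?T (a - b - c - 4))" for a
    unfolding w input_at_append lA lE by (simp add: b_def c_def)
  show 0: "input_at w 0 = int k" "input_at w 1 = int n" by (simp_all add: w_def input_at_Cons)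
  have n: "n_verts w = n" "stride w = 2 + k * 2" unfolding n_verts_def stride_def n_players_def 0 by simp_all
  have "input_at w (n + 2) = int (length es)"
    by (simp add: w_def input_at_Cons input_at_append)
  then show m: "input_at w (n_verts w + 2) = int (length es)"
    unfolding n .
  have mid: "mid_pos w = b + c"
  proof -
    have "n_edges w = length es" by (simp only: n_edges_def m nat_int)
    then show ?thesis by (simp only: mid_pos_def edge_pos_def n b_def c_def)
  qed
  have B: "input_at w (mid_pos w + j) = input_at ?B j" if "j < 4" for j
    using that by (simp add: w_at mid)
  show "input_at w (mid_pos w) = int v\<^sub>0" "input_at w (mid_pos w + 1) = int s"
    "input_at w (mid_pos w + 2) = int q\<^sub>0" "input_at w (mid_pos w + 3) = int (length ts)"
    using B[of 0] B[of 1] B[of 2] B[of 3] by (simp_all add: input_at_Cons)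
  show "length w = mid_pos w + 4 + length ts * 4"
    unfolding mid unfolding w length_append lA lE lT b_def c_def by simp
  show "input_at w (2 + v) = int (own v)" if "v < n" for v
    using that by (simp add: w_def input_at_Cons input_at_append) (simp add: input_at_def)
  have E: "edge_field w e j = input_at (encode_edge k num den (es ! e)) j"
    if "e < length es" "j < 2 + k * 2" for e j
  proof -
    have "e * (2 + k * 2) + j < length es * (2 + k * 2)"
    proof -
      have "e * (2 + k * 2) + j < (e + 1) * (2 + k * 2)" using that(2) by simp
      also have "\<dots> \<le> length es * (2 + k * 2)" using that(1) by (intro mult_right_mono) auto
      finally show ?thesis .
    qed
    moreover have "input_at ?E (e * (2 + k * 2) + j) = input_at (encode_edge k num den (es ! e)) j"
      using input_at_concat[of es "encode_edge k num den" "2 + k * 2" e j] length_encode_edge that by blast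
    ultimately show ?thesis
      by (simp add: edge_field_def edge_pos_def n w_at b_def c_def add.assoc)
  qed
  show "edge_field w e 0 = int (fst (es ! e)) \<and> edge_field w e 1 = int (snd (es ! e))" if "e < length es" for e
    using E[OF that, of 0] E[OF that, of 1] by (simp only: encode_edge_at; simp)
  show "num_of w i e = num i (es ! e) \<and> den_of w i e = den i (es ! e)" if "e < length es" "i < k" for i e
    using E[OF that(1), of "2 + i * 2"] E[OF that(1), of "3 + i * 2"] that(2)
    unfolding num_of_def den_of_def by (simp only: encode_edge_at; simp)
  have T: "trans_field w t j = input_at (encode_transition (ts ! t)) j" if "t < length ts" "j < 4" for t j
  proof -
    have "input_at ?T (t * 4 + j) = input_at (encode_transition (ts ! t)) j"
      using input_at_concat[of ts encode_transition 4 t j] lt that by blast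
    then show ?thesis
      by (simp add: trans_field_def trans_pos_def mid w_at add.assoc)
  qed
  show "ts ! t = (nat (trans_field w t 0), nat (trans_field w t 1), nat (trans_field w t 2), nat (trans_field w t 3)) \<and>
       (\<forall>j<4. trans_field w t j \<ge> 0)" if "t < length ts" for t
  proof -
    obtain p u q v where pq: "ts ! t = (p, u, q, v)" by (cases "ts ! t")
    have f: "trans_field w t 0 = int p" "trans_field w t 1 = int u" "trans_field w t 2 = int q" "trans_field w t 3 = int v"
      using T[OF that, of 0] T[OF that, of 1] T[OF that, of 2] T[OF that, of 3]
      unfolding pq encode_transition_at by simp_all
    have "trans_field w t j \<ge> 0" if "j < 4" for j
    proof -
      from that consider "j = 0" | "j = 1" | "j = 2" | "j = 3" by linarith
      then show ?thesis by cases (simp_all only: f of_nat_0_le_iff)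
    qed
    then show ?thesis unfolding pq f nat_int by blast
  qed
qed

text \<open>The owner map of a game is arbitrary outside its vertices, where the code says nothing.
  The graph consults it only at sources of transitions.\<close>

lemma deviation_graph_own_cong:
  assumes "\<And>q v x. (q, v, x) \<in> T \<Longrightarrow> own v = own' v"
  shows "deviation_graph any I own E T R = deviation_graph any I own' E T R"
proof -
  have "deviation_graph any I f E T R \<subseteq> deviation_graph any I f' E T R"
    if "\<And>q v x. (q, v, x) \<in> T \<Longrightarrow> f v = f' v" for f f'
  proof
    fix e assume "e \<in> deviation_graph any I f E T R"
    moreover obtain x y c where e: "e = (x, y, c)" by (cases e)
    ultimately have "(x, y, c) \<in> deviation_graph any I f E T R" by simp
    then show "e \<in> deviation_graph any I f' E T R"
      unfolding e
    proof (cases rule: deviation_graph.cases)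
      case (common q v q' u u')
      then show "(x, y, c) \<in> deviation_graph any I f' E T R"
        by (auto intro: deviation_graph.common)
    next
      case (deviate q v q' u u')
      with that[OF deviate(4)] show "(x, y, c) \<in> deviation_graph any I f' E T R"
        by (auto intro: deviation_graph.deviate)
    next
      case (split i p u p' z u' q v q' v')
      with that[OF split(5)] show "(x, y, c) \<in> deviation_graph any I f' E T R"
        by (auto intro: deviation_graph.split)
    qed
  qed
  from this[of own own'] this[of own' own] show ?thesis using assms by (metis subset_antisym)
qed

lemma edge_index_eq:
  assumes "\<And>e f. e < n_edges w \<Longrightarrow> f < n_edges w \<Longrightarrow> edge_of w e = edge_of w f \<Longrightarrow> e = f" "e < n_edges w"
  shows "edge_index w (edge_of w e) = e"
  unfolding edge_index_def using assms by (intro the_equality) auto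

lemma image_lessThan_nth: "set xs = (\<lambda>i. xs ! i) ` {..<length xs}"
  by (auto simp: in_set_conv_nth image_iff)

text \<open>A code does not determine the game: owners outside the vertices, payoffs of sequences
  that are not plays and rewards outside the edges stay free. Everything that the criterion depends
  on is determined.\<close>

lemma mp_instance_code:
  assumes "mp_instance w G v\<^sub>0 M"
  obtains r where "valid w" "game G" "mealy_machine G M" "v\<^sub>0 \<in> verts G" "mean_payoff_game G r"
    "scaled G r (reward_of w)" "v\<^sub>0 = start_vert w" "init M = start_state w"
    "\<And>any. code_graph any w = game_graph any G M (reward_of w)"
    "deterministic G M \<longleftrightarrow> det_code w"
proof -
  from assms obtain r where v\<^sub>0: "v\<^sub>0 \<in> verts G" and M: "mealy_machine G M" and mp: "mean_payoff_game G r"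
    and enc: "encodes w G r v\<^sub>0 M" by (auto simp: mp_instance_def)
  from mp have G: "game G" by (simp add: mean_payoff_game_def)
  from enc obtain k n s es ts num den where
    pl: "players G = {..<k}" and ve: "verts G = {..<n}" and sts: "states M = {..<s}"
    and es: "distinct es" "set es = edges G" and ts: "distinct ts" "set ts = trans M"
    and r: "\<forall>i \<in> players G. \<forall>e \<in> edges G. den i e > 0 \<and> r i e = Fract (num i e) (den i e)"
    and w: "w = [int k, int n] @ map (\<lambda>v. int (owner G v)) [0..<n] @
            [int (length es)] @ concat (map (encode_edge k num den) es) @
            [int v\<^sub>0] @ [int s, int (init M)] @
            [int (length ts)] @ concat (map encode_transition ts)"
    unfolding encodes_def by blast
  note r = r[rule_format]
  note rc = read_code[where k = k and n = n and own = "owner G" and es = es and num = num and den = den and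
      v\<^sub>0 = v\<^sub>0 and s = s and q\<^sub>0 = "init M" and ts = ts, folded w]
  have nums: "n_players w = k" "n_verts w = n" "n_edges w = length es" "n_states w = s" "n_trans w = length ts"
    "start_vert w = v\<^sub>0" "start_state w = init M"
    unfolding n_players_def n_verts_def n_states_def n_trans_def start_vert_def start_state_def rc
    using rc(3) by (simp_all add: n_edges_def)
  have own: "owner_of w v = owner G v" if "v < n" for v using rc(9)[OF that] by (simp add: owner_of_def)
  have ee: "edge_of w e = es ! e" if "e < length es" for e
    using rc(10)[OF that] by (simp add: edge_of_def)
  have tt: "trans_of w t = ts ! t" if "t < length ts" for t
    using rc(12)[OF that] by (simp add: trans_of_def)
  have E: "edge_of w ` {..<n_edges w} = edges G"
    unfolding nums es(2)[symmetric] image_lessThan_nth[of es] by (intro image_cong) (simp_all add: ee)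
  have T: "trans_of w ` {..<n_trans w} = trans M"
    unfolding nums ts(2)[symmetric] image_lessThan_nth[of ts] by (intro image_cong) (simp_all add: tt)
  have e_in: "es ! e \<in> edges G" if "e < length es" for e using that es(2) nth_mem by blast
  have t_in: "ts ! t \<in> trans M" if "t < length ts" for t using that ts(2) nth_mem by blast
  have inj: "e = f" if "e < n_edges w" "f < n_edges w" "edge_of w e = edge_of w f" for e f
    using that es(1) by (simp add: nums ee nth_eq_iff_index_eq)
  have tn: "trans_field w t j = int (nat (trans_field w t j))" if "t < length ts" "j < 4" for t j
    using rc(12)[OF that(1)] that(2) by simp
  have tin: "(nat (trans_field w t 0), nat (trans_field w t 1), nat (trans_field w t 2), nat (trans_field w t 3)) \<in> trans M"
    if "t < length ts" for t using t_in[OF that] rc(12)[OF that] by simp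
  have inst: "nat (trans_field w t 0) < s \<and> nat (trans_field w t 1) < n \<and> nat (trans_field w t 2) < s \<and>
     (nat (trans_field w t 1), nat (trans_field w t 3)) \<in> edges G" if "t < length ts" for t
    using tin[OF that] M unfolding mealy_machine_def sts ve by blast
  have tot: "\<exists>t<length ts. trans_field w t 0 = int p \<and> trans_field w t 1 = int u" if "p < s" "u < n" for p u
  proof -
    from that M obtain q v where "(p, u, q, v) \<in> trans M" unfolding mealy_machine_def sts ve by blast
    then obtain t where t: "t < length ts" "ts ! t = (p, u, q, v)" using ts(2) by (metis in_set_conv_nth)
    from rc(12)[OF t(1)] t(2) have "nat (trans_field w t 0) = p" "nat (trans_field w t 1) = u" by auto
    with tn[OF t(1), of 0] tn[OF t(1), of 1] t(1) show ?thesis by auto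
  qed
  have n0: "0 < n" using v\<^sub>0 ve by auto
  \<comment> \<open>Every state has a transition at vertex \<open>0\<close>, so the sources of the
    transitions exhaust the states.\<close>
  have "s \<le> length ts"
  proof -
    have "{..<s} \<subseteq> (\<lambda>t. nat (trans_field w t 0)) ` {..<length ts}"
      using tot[OF _ n0] by force
    from card_mono[OF _ this] card_image_le[of "{..<length ts}" "\<lambda>t. nat (trans_field w t 0)"]
    show ?thesis by simp
  qed
  have outE: "\<exists>e<length es. edge_field w e 0 = int v" if "v < n" for v
  proof -
    from that G obtain u where "(v, u) \<in> edges G" unfolding game_def ve by blast
    then obtain e where "e < length es" "es ! e = (v, u)" using es(2) by (metis in_set_conv_nth)
    with rc(10)[of e] show ?thesis by auto
  qed
  then have "0 < length es" using n0 by auto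
  have len: "length w = mid_pos w + 4 + length ts * 4" by (rule rc(8))
  have mid: "mid_pos w = n + 3 + length es * (2 + k * 2)"
    by (simp add: mid_pos_def edge_pos_def nums stride_def)
  have "k \<le> length w"
  proof -
    have "1 * (2 + k * 2) \<le> length es * (2 + k * 2)" using \<open>0 < length es\<close> by (intro mult_right_mono) linarith+
    then have "k \<le> length es * (2 + k * 2)" by (rule order.trans[rotated]) simp
    then show ?thesis unfolding len mid by (rule trans_le_add1[OF trans_le_add1[OF trans_le_add2]])
  qed
  then have "well_shaped w"
    unfolding well_shaped_def nums rc(1,2,5,7) rc(3)[unfolded nums]
    using rc(8) \<open>s \<le> length ts\<close> by simp
  moreover have "well_formed w"
    unfolding well_formed_def nums
  proof (intro conjI allI impI)
    fix v assume v: "v < n"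
    have "owner G v < k" using G v unfolding game_def ve pl by blast
    with rc(9)[OF v] show "0 \<le> input_at w (2 + v)" "input_at w (2 + v) < int k" by simp_all
    show "\<exists>e<length es. edge_field w e 0 = int v" using outE[OF v] .
  next
    fix e assume e: "e < length es"
    have "fst (es ! e) < n" "snd (es ! e) < n"
      using game_edges[OF G, of "fst (es ! e)" "snd (es ! e)"] e_in[OF e] ve by auto
    with rc(10)[OF e] show "0 \<le> edge_field w e 0" "edge_field w e 0 < int n" "0 \<le> edge_field w e 1" "edge_field w e 1 < int n"
      by simp_all
    show "0 < den_of w i e" if "i < k" for i
      using rc(11)[OF e that] r[of i "es ! e"] e_in[OF e] that pl by simp
    show "e = f" if "f < length es" "edge_field w e 0 = edge_field w f 0 \<and> edge_field w e 1 = edge_field w f 1" for f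
      using inj[of e f] that e by (simp add: nums edge_of_def)
  next
    show "0 \<le> input_at w (mid_pos w)" "input_at w (mid_pos w) < int n"
      "0 \<le> input_at w (mid_pos w + 2)" "input_at w (mid_pos w + 2) < int s"
      using rc(4,6) v\<^sub>0 ve M sts by (auto simp: mealy_machine_def)
  next
    fix t assume t: "t < length ts"
    from inst[OF t] tn[OF t, of 0] tn[OF t, of 1] tn[OF t, of 2] tn[OF t, of 3]
    show "0 \<le> trans_field w t 0" "trans_field w t 0 < int s" "0 \<le> trans_field w t 1"
      "0 \<le> trans_field w t 2" "trans_field w t 2 < int s" by linarith+
    from inst[OF t] obtain e where e: "e < length es" "es ! e = (nat (trans_field w t 1), nat (trans_field w t 3))"
      using es(2) by (metis in_set_conv_nth)
    with rc(10)[OF e(1)] tn[OF t, of 1] tn[OF t, of 3]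
    show "\<exists>e<length es. edge_field w e 0 = trans_field w t 1 \<and> edge_field w e 1 = trans_field w t 3" by auto
    show "t = t'" if t': "t' < length ts" and eq: "trans_field w t 0 = trans_field w t' 0 \<and> trans_field w t 1 = trans_field w t' 1 \<and>
        trans_field w t 2 = trans_field w t' 2 \<and> trans_field w t 3 = trans_field w t' 3" for t'
    proof -
      have "ts ! t = ts ! t'" using rc(12)[OF t] rc(12)[OF t'] eq by simp
      with t t' ts(1) show ?thesis by (simp add: nth_eq_iff_index_eq)
    qed
  next
    fix p u assume "p < s" "u < n"
    then show "\<exists>t<length ts. trans_field w t 0 = int p \<and> trans_field w t 1 = int u" by (rule tot)
  qed
  ultimately have "valid w" by (simp add: valid_def)
  moreover have "scaled G r (reward_of w)"
    unfolding scaled_def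
  proof
    fix i assume i: "i \<in> players G"
    then have ik: "i < k" using pl by simp
    have pos: "den_of w i e > 0" if "e < length es" for e
      using rc(11)[OF that ik] r[OF i e_in[OF that]] by simp
    \<comment> \<open>A common denominator of the rewards of \<open>i\<close>, not necessarily the
      least one, is the scaling factor.\<close>
    let ?D = "\<Prod>e<length es. den_of w i e"
    show "\<exists>D>0. \<forall>e\<in>edges G. real_of_int (reward_of w i e) = D * of_rat (r i e)"
    proof (intro exI[of _ "real_of_int ?D"] conjI ballI)
      show "0 < real_of_int ?D" unfolding of_int_0_less_iff by (rule prod_pos) (use pos in simp)
      fix p assume "p \<in> edges G"
      then obtain e where e: "e < length es" "es ! e = p" using es(2) by (metis in_set_conv_nth)
      have rp: "r i p = Fract (num_of w i e) (den_of w i e)"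
        using rc(11)[OF e(1) ik] r[OF i e_in[OF e(1)]] e(2) by simp
      have "edge_index w (edge_of w e) = e"
        by (rule edge_index_eq) (use inj e(1) nums in auto)
      then have "reward_of w i p = int_reward w i e"
        unfolding reward_of_def ee[OF e(1)] e(2) by simp
      moreover have "?D = den_of w i e * (\<Prod>f\<in>{..<length es} - {e}. den_of w i f)"
        using e(1) by (intro prod.remove) auto
      ultimately show "real_of_int (reward_of w i p) = real_of_int ?D * of_rat (r i p)"
        using pos[OF e(1)] by (simp add: rp of_rat_rat int_reward_def nums)
    qed
  qed
  moreover have "code_graph any w = game_graph any G M (reward_of w)" for any
  proof -
    have lt: "v < n" if "(q, v, x) \<in> trans M" for q v x
      using that M unfolding mealy_machine_def ve by (cases x) auto
    show ?thesis
      unfolding code_graph_def E T unfolding pl nums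
      by (rule deviation_graph_own_cong) (rule own, erule lt)
  qed
  moreover have "deterministic G M \<longleftrightarrow> det_code w"
  proof
    assume det: "deterministic G M"
    show "det_code w"
      unfolding det_code_def nums
    proof (intro allI impI, elim conjE)
      fix t t' assume t: "t < length ts" "t' < length ts"
        "trans_field w t 0 = trans_field w t' 0" "trans_field w t 1 = trans_field w t' 1"
      have "nat (trans_field w t 0) \<in> states M" "nat (trans_field w t 1) \<in> verts G"
        using inst[OF t(1)] sts ve by auto
      with det tin[OF t(1)] tin[OF t(2)] t(3,4)
      have "(nat (trans_field w t 2), nat (trans_field w t 3)) = (nat (trans_field w t' 2), nat (trans_field w t' 3))"
        unfolding deterministic_def by metis
      then have "ts ! t = ts ! t'" using rc(12)[OF t(1)] rc(12)[OF t(2)] t(3,4) by simp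
      then show "t = t'" using t(1,2) ts(1) by (simp add: nth_eq_iff_index_eq)
    qed
  next
    assume det: "det_code w"
    show "deterministic G M"
      unfolding deterministic_def
    proof (intro ballI)
      fix p u assume pu: "p \<in> states M" "u \<in> verts G"
      show "\<exists>!qv. (p, u, qv) \<in> trans M"
      proof (rule ex_ex1I)
        show "\<exists>qv. (p, u, qv) \<in> trans M" using M pu unfolding mealy_machine_def by blast
        fix a b assume "(p, u, a) \<in> trans M" "(p, u, b) \<in> trans M"
        then obtain t t' where t: "t < length ts" "ts ! t = (p, u, a)" "t' < length ts" "ts ! t' = (p, u, b)"
          using ts(2) by (metis in_set_conv_nth)
        from rc(12)[OF t(1)] rc(12)[OF t(3)] t
        have eq: "nat (trans_field w t 0) = nat (trans_field w t' 0)" "nat (trans_field w t 1) = nat (trans_field w t' 1)" by auto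
        have j: "(0::nat) < 4" "(1::nat) < 4" by simp_all
        have "trans_field w t 0 = trans_field w t' 0" using tn[OF t(1) j(1)] tn[OF t(3) j(1)] eq(1) by metis
        moreover have "trans_field w t 1 = trans_field w t' 1" using tn[OF t(1) j(2)] tn[OF t(3) j(2)] eq(2) by metis
        moreover note det t(1,3)
        ultimately have "t = t'" unfolding det_code_def nums by blast
        with t show "a = b" by simp
      qed
    qed
  qed
  ultimately show thesis
    by (intro that[of r] G M v\<^sub>0 mp) (simp_all only: nums)
qed

section \<open>Instances from valid codes\<close>

definition segment :: "int list \<Rightarrow> nat \<Rightarrow> nat \<Rightarrow> int list" where
  "segment w a l = map (\<lambda>j. input_at w (a + j)) [0..<l]"

lemma segment_all: "segment w 0 (length w) = w"
  by (rule nth_equalityI) (auto simp: segment_def input_at_def)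

lemma segment_add: "segment w a (l + l') = segment w a l @ segment w (a + l) l'"
  by (rule nth_equalityI) (auto simp: segment_def nth_append add.assoc)

lemma segment_mult: "segment w a (m * L) = concat (map (\<lambda>i. segment w (a + i * L) L) [0..<m])"
proof (induction m)
  case (Suc m)
  then show ?case using segment_add[of w a "m * L" L] by (simp add: add.commute)
qed (simp add: segment_def)

lemma segment_Suc: "segment w a (Suc l) = input_at w a # segment w (Suc a) l"
  using segment_add[of w a 1 l] by (simp add: segment_def)

lemma segment_0 [simp]: "segment w a 0 = []"
  by (simp add: segment_def)

lemma well_formed_inj:
  assumes "well_formed w" "e < n_edges w" "f < n_edges w" "edge_of w e = edge_of w f"
  shows "e = f"
proof -
  have wf: "\<And>e. e < n_edges w \<Longrightarrow> 0 \<le> edge_field w e 0 \<and> 0 \<le> edge_field w e 1"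
    "\<And>e f. e < n_edges w \<Longrightarrow> f < n_edges w \<Longrightarrow>
        edge_field w e 0 = edge_field w f 0 \<and> edge_field w e 1 = edge_field w f 1 \<Longrightarrow> e = f"
    using assms(1) unfolding well_formed_def by blast+
  from assms(4) have "nat (edge_field w e 0) = nat (edge_field w f 0)" "nat (edge_field w e 1) = nat (edge_field w f 1)"
    by (simp_all add: edge_of_def)
  with wf(1)[OF assms(2)] wf(1)[OF assms(3)] show ?thesis
    by (intro wf(2)[OF assms(2,3)]) (simp add: nat_eq_iff)
qed

text \<open>The conditions that the program tests leave no sequence without an instance. Together
  with \<open>mp_instance_code\<close>, this makes \<open>valid\<close> the precise domain of the
  problems.\<close>

lemma valid_instance:
  assumes "valid w"
  shows "\<exists>G v\<^sub>0 M. mp_instance w G v\<^sub>0 M"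
proof -
  let ?k = "n_players w" and ?n = "n_verts w" and ?m = "n_edges w" and ?s = "n_states w" and ?l = "n_trans w"
  from assms have ws: "well_shaped w" and wf: "well_formed w" by (simp_all add: valid_def)
  have own: "0 \<le> input_at w (2 + v) \<and> input_at w (2 + v) < int ?k" if "v < ?n" for v
    using wf that unfolding well_formed_def by blast
  have ef: "0 \<le> edge_field w e 0 \<and> edge_field w e 0 < int ?n \<and> 0 \<le> edge_field w e 1 \<and> edge_field w e 1 < int ?n"
    and den: "\<And>i. i < ?k \<Longrightarrow> 0 < den_of w i e" if "e < ?m" for e
    using wf that unfolding well_formed_def by blast+
  have out: "\<exists>e<?m. edge_field w e 0 = int v" if "v < ?n" for v
    using wf that unfolding well_formed_def by blast
  have st: "0 \<le> input_at w (mid_pos w)" "input_at w (mid_pos w) < int ?n"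
     "0 \<le> input_at w (mid_pos w + 2)" "input_at w (mid_pos w + 2) < int ?s"
    using wf unfolding well_formed_def by blast+
  have tf: "0 \<le> trans_field w t 0 \<and> trans_field w t 0 < int ?s \<and>
        0 \<le> trans_field w t 1 \<and> 0 \<le> trans_field w t 2 \<and> trans_field w t 2 < int ?s"
    and te: "\<exists>e<?m. edge_field w e 0 = trans_field w t 1 \<and> edge_field w e 1 = trans_field w t 3" if "t < ?l" for t
    using wf that unfolding well_formed_def by blast+
  have tinj: "t = t'" if "t < ?l" "t' < ?l" "trans_field w t 0 = trans_field w t' 0 \<and> trans_field w t 1 = trans_field w t' 1 \<and>
        trans_field w t 2 = trans_field w t' 2 \<and> trans_field w t 3 = trans_field w t' 3" for t t'
    using wf that unfolding well_formed_def by blast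
  have tot: "\<exists>t<?l. trans_field w t 0 = int p \<and> trans_field w t 1 = int u" if "p < ?s" "u < ?n" for p u
    using wf that unfolding well_formed_def by blast
  define es where "es = map (edge_of w) [0..<?m]"
  define ts where "ts = map (trans_of w) [0..<?l]"
  \<comment> \<open>\<open>encode_edge\<close> takes numerators and denominators as functions of the
    pair of vertices; as edges are listed without repetition, the pair determines the index.\<close>
  define num where "num i p = num_of w i (edge_index w p)" for i p
  define den' where "den' i p = den_of w i (edge_index w p)" for i p
  define r where "r i p = Fract (num i p) (den' i p)" for i p
  \<comment> \<open>Along plays the rewards are bounded and the mean is finite, so
    \<open>real_of_ereal\<close> loses nothing; on other sequences the payoff is free.\<close>
  define G :: "(nat, nat) game" where "G = \<lparr>players = {..<?k}, verts = {..<?n}, owner = owner_of w, edges = set es,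
    payoff = \<lambda>i \<pi>. real_of_ereal (mean (rewards r i \<pi>))\<rparr>"
  define M :: "(nat, nat) mealy" where "M = \<lparr>states = {..<?s}, init = start_state w, trans = set ts\<rparr>"
  have idx: "edge_index w (edge_of w e) = e" if "e < ?m" for e
    using edge_index_eq[OF well_formed_inj[OF wf] that] .
  have G: "game G"
    unfolding game_def
  proof (intro conjI ballI)
    show "edges G \<subseteq> verts G \<times> verts G"
      using ef by (auto simp: G_def es_def edge_of_def nat_less_iff)
    fix v assume v: "v \<in> verts G"
    then obtain e where "e < ?m" "edge_field w e 0 = int v" using out by (auto simp: G_def)
    then have "(v, nat (edge_field w e 1)) \<in> edges G" by (force simp: G_def es_def edge_of_def)
    then show "\<exists>u. (v, u) \<in> edges G" by blast
    from v own[of v] show "owner G v \<in> players G" by (simp add: G_def owner_of_def nat_less_iff)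
  qed (simp_all add: G_def)
  have tE: "(nat (trans_field w t 1), nat (trans_field w t 3)) \<in> edges G" if "t < ?l" for t
  proof -
    from te[OF that] obtain e where "e < ?m" "edge_of w e = (nat (trans_field w t 1), nat (trans_field w t 3))"
      by (auto simp: edge_of_def)
    then show ?thesis by (force simp: G_def es_def)
  qed
  have M: "mealy_machine G M"
    unfolding mealy_machine_def
  proof (intro conjI ballI allI impI)
    show "init M \<in> states M" using st by (simp add: M_def start_state_def nat_less_iff)
    show edge: "(u, v) \<in> edges G" if "(p, u, q, v) \<in> trans M" for p u q v
      using that tE by (auto simp: M_def ts_def trans_of_def)
    show "trans M \<subseteq> states M \<times> verts G \<times> states M \<times> verts G"
    proof
      fix x assume "x \<in> trans M"
      then obtain t where t: "t < ?l" "x = trans_of w t" by (auto simp: M_def ts_def)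
      from game_edges[OF G tE[OF t(1)]] tf[OF t(1)] show "x \<in> states M \<times> verts G \<times> states M \<times> verts G"
        by (simp add: t(2) trans_of_def M_def nat_less_iff)
    qed
    fix p u assume "p \<in> states M" "u \<in> verts G"
    then obtain t where t: "t < ?l" "trans_field w t 0 = int p" "trans_field w t 1 = int u"
      using tot by (auto simp: M_def G_def)
    then have "trans_of w t = (p, u, nat (trans_field w t 2), nat (trans_field w t 3))" by (simp add: trans_of_def)
    moreover have "trans_of w t \<in> trans M" using t(1) by (simp add: M_def ts_def)
    ultimately show "\<exists>q v. (p, u, q, v) \<in> trans M" by metis
  qed (simp add: M_def)
  have mp: "mean_payoff_game G r"
    unfolding mean_payoff_game_def
  proof (intro conjI ballI allI impI G)
    fix i \<pi> assume "i \<in> players G" "play G \<pi>"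
    from rewards_bounded[OF G, of r i] \<open>play G \<pi>\<close> obtain B where "\<And>k. \<bar>rewards r i \<pi> k\<bar> \<le> B" by blast
    from mean_finite[OF this] have "ereal (payoff G i \<pi>) = mean (rewards r i \<pi>)"
      by (simp add: G_def ereal_real)
    then show "ereal (payoff G i \<pi>) = liminf (\<lambda>n. ereal (1 / real n * (\<Sum>k<n. of_rat (r i (\<pi> k, \<pi> (Suc k))))))"
      by (simp add: mean_def rewards_def)
  qed
  have nn: "0 \<le> input_at w 0" "0 \<le> input_at w 1" "0 \<le> input_at w (?n + 2)" "0 \<le> input_at w (mid_pos w + 1)"
    "0 \<le> input_at w (mid_pos w + 3)" "length w = mid_pos w + 4 + ?l * 4"
    using ws unfolding well_shaped_def by blast+
  have enc_edge: "encode_edge ?k num den' (edge_of w e) = segment w (edge_pos w e) (stride w)" if "e < ?m" for e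
  proof -
    have "segment w (edge_pos w e) (stride w) =
        segment w (edge_pos w e) 2 @ concat (map (\<lambda>i. segment w (edge_pos w e + 2 + i * 2) 2) [0..<?k])"
      unfolding stride_def segment_add segment_mult ..
    moreover have "segment w (edge_pos w e + 2 + i * 2) 2 = [num i (edge_of w e), den' i (edge_of w e)]" for i
      by (simp add: num_def den'_def idx[OF that] num_of_def den_of_def edge_field_def numeral_2_eq_2 segment_Suc
          numeral_3_eq_3)
    moreover have "segment w (edge_pos w e) 2 = [int (fst (edge_of w e)), int (snd (edge_of w e))]"
      using ef[OF that] by (simp add: edge_of_def edge_field_def numeral_2_eq_2 segment_Suc)
    ultimately show ?thesis by (simp add: encode_edge_def)
  qed
  have enc_trans: "encode_transition (trans_of w t) = segment w (trans_pos w t) 4" if "t < ?l" for t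
  proof -
    have "trans_field w t 3 \<ge> 0" using te[OF that] ef by force
    with tf[OF that] show ?thesis
      by (simp add: trans_of_def trans_field_def segment_Suc numeral_eq_Suc)
  qed
  have own_seg: "map (\<lambda>v. int (owner G v)) [0..<?n] = segment w 2 ?n"
    using own by (simp add: segment_def G_def owner_of_def)
  \<comment> \<open>The sequence is cut into the blocks of the encoding, which are then recognised
    one by one.\<close>
  have "w = segment w 0 (2 + (?n + (1 + (?m * stride w + (1 + (2 + (1 + ?l * 4)))))))"
  proof -
    have l: "2 + (?n + (1 + (?m * stride w + (1 + (2 + (1 + ?l * 4)))))) = length w"
      unfolding nn(6) mid_pos_def edge_pos_def by simp
    show ?thesis unfolding l segment_all ..
  qed
  also have "\<dots> = segment w 0 2 @ segment w 2 ?n @ segment w (?n + 2) 1 @ segment w (?n + 3) (?m * stride w) @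
      segment w (mid_pos w) 1 @ segment w (mid_pos w + 1) 2 @ segment w (mid_pos w + 3) 1 @
      segment w (mid_pos w + 4) (?l * 4)"
  proof -
    have pos: "2 + ?n = ?n + 2" "?n + 2 + 1 = ?n + 3" "?n + 3 + ?m * stride w = mid_pos w"
      "mid_pos w + 1 + 2 = mid_pos w + 3" "mid_pos w + 3 + 1 = mid_pos w + 4"
      by (simp_all add: mid_pos_def edge_pos_def)
    show ?thesis by (simp only: segment_add pos add_0)
  qed
  also have "segment w 0 2 = [int ?k, int ?n]"
    using nn by (simp add: numeral_2_eq_2 segment_Suc n_players_def n_verts_def)
  also have "segment w (?n + 2) 1 = [int (length es)]"
    using nn by (simp add: segment_Suc es_def n_edges_def)
  also have "segment w (?n + 3) (?m * stride w) = concat (map (encode_edge ?k num den') es)"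
    unfolding segment_mult es_def map_map
    by (intro arg_cong[where f = concat] map_cong) (simp_all add: enc_edge edge_pos_def)
  also have "segment w (mid_pos w) 1 = [int (start_vert w)]"
    using st by (simp add: segment_Suc start_vert_def)
  also have "segment w (mid_pos w + 1) 2 = [int ?s, int (init M)]"
    using st nn by (simp add: numeral_2_eq_2 segment_Suc start_state_def n_states_def M_def)
  also have "segment w (mid_pos w + 3) 1 = [int (length ts)]"
    using nn by (simp add: segment_Suc ts_def n_trans_def)
  also have "segment w (mid_pos w + 4) (?l * 4) = concat (map encode_transition ts)"
    unfolding segment_mult ts_def map_map
    by (intro arg_cong[where f = concat] map_cong) (simp_all add: enc_trans trans_pos_def)
  finally have w: "w = [int ?k, int ?n] @ map (\<lambda>v. int (owner G v)) [0..<?n] @ [int (length es)] @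
      concat (map (encode_edge ?k num den') es) @ [int (start_vert w)] @ [int ?s, int (init M)] @
      [int (length ts)] @ concat (map encode_transition ts)"
    unfolding own_seg .
  have "distinct es"
    using well_formed_inj[OF wf] by (auto simp: es_def distinct_map inj_on_def)
  moreover have "distinct ts"
    unfolding ts_def distinct_map inj_on_def
  proof (intro conjI ballI impI)
    fix t t' assume t: "t \<in> set [0..<?l]" "t' \<in> set [0..<?l]" "trans_of w t = trans_of w t'"
    then have tl: "t < ?l" "t' < ?l" by auto
    have "0 \<le> trans_field w t 3" "0 \<le> trans_field w t' 3" using te[OF tl(1)] te[OF tl(2)] ef by force+
    with t(3) tf[OF tl(1)] tf[OF tl(2)] show "t = t'"
      by (intro tinj[OF tl]) (simp add: trans_of_def nat_eq_iff)
  qed simp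
  moreover have "\<forall>i \<in> players G. \<forall>p \<in> edges G. den' i p > 0 \<and> r i p = Fract (num i p) (den' i p)"
    using den by (auto simp: r_def G_def es_def den'_def idx)
  ultimately have "encodes w G r (start_vert w) M"
    unfolding encodes_def using w
    by (intro exI[of _ ?k] exI[of _ ?n] exI[of _ ?s] exI[of _ es] exI[of _ ts] exI[of _ num] exI[of _ den'])
       (simp add: G_def M_def)
  moreover have "start_vert w \<in> verts G" using st by (simp add: G_def start_vert_def nat_less_iff)
  ultimately have "mp_instance w G (start_vert w) M"
    unfolding mp_instance_def using M mp by blast
  then show ?thesis by blast
qed

section \<open>The checking problems in terms of codes\<close>

definition positive_code :: "bool \<Rightarrow> int list \<Rightarrow> bool" where
  "positive_code any w \<longleftrightarrow> positive_walk (code_graph any w) (Common (start_state w) (start_vert w))"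

text \<open>The problems ask for some instance with code \<open>w\<close>. All instances with this
  code give the same answer, so the quantifier reduces to the existence of one, that is, to
  validity.\<close>

lemma ex_instance_iff:
  assumes "\<And>G v M. I G v M \<Longrightarrow> (A G v M \<longleftrightarrow> B) \<and> V" "V \<Longrightarrow> \<exists>G v M. I G v M"
  shows "(\<exists>G v M. I G v M \<and> A G v M) \<longleftrightarrow> V \<and> B"
  using assms by metis

theorem checking_problems:
  "w \<in> mp_nash_checking \<longleftrightarrow> valid w \<and> \<not> positive_code False w"
  "w \<in> mp_deterministic_nash_checking \<longleftrightarrow> valid w \<and> det_code w \<and> \<not> positive_code False w"
  "w \<in> mp_subgame_perfect_checking \<longleftrightarrow> valid w \<and> \<not> positive_code True w"
  "w \<in> mp_deterministic_subgame_perfect_checking \<longleftrightarrow> valid w \<and> det_code w \<and> \<not> positive_code True w"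
proof -
  have *: "valid w \<and> (deterministic G M \<longleftrightarrow> det_code w) \<and>
      ((\<forall>\<sigma> \<in> Comp G v\<^sub>0 M. nash_equilibrium G v\<^sub>0 \<sigma>) \<longleftrightarrow> \<not> positive_code False w) \<and>
      ((\<forall>\<sigma> \<in> Comp G v\<^sub>0 M. subgame_perfect_equilibrium G v\<^sub>0 \<sigma>) \<longleftrightarrow> \<not> positive_code True w)"
    if inst: "mp_instance w G v\<^sub>0 M" for G v\<^sub>0 M
  proof -
    obtain r where c: "valid w" "game G" "mealy_machine G M" "v\<^sub>0 \<in> verts G" "mean_payoff_game G r"
      "scaled G r (reward_of w)" "v\<^sub>0 = start_vert w" "init M = start_state w"
      "\<And>any. code_graph any w = game_graph any G M (reward_of w)" "deterministic G M \<longleftrightarrow> det_code w"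
      by (rule mp_instance_code[OF inst]) (use that in blast)
    note fr = mean_payoff_game_from[OF c(5)]
    show ?thesis
      using nash_iff_no_positive_walk[OF c(2-4) fr c(6)] subgame_perfect_iff_no_positive_walk[OF c(2-4) fr c(6)]
        c(1,10) unfolding positive_code_def c(9) c(7,8)[symmetric] by blast
  qed
  show "w \<in> mp_nash_checking \<longleftrightarrow> valid w \<and> \<not> positive_code False w"
    "w \<in> mp_deterministic_nash_checking \<longleftrightarrow> valid w \<and> det_code w \<and> \<not> positive_code False w"
    "w \<in> mp_subgame_perfect_checking \<longleftrightarrow> valid w \<and> \<not> positive_code True w"
    "w \<in> mp_deterministic_subgame_perfect_checking \<longleftrightarrow> valid w \<and> det_code w \<and> \<not> positive_code True w"
    unfolding mp_nash_checking_def mp_deterministic_nash_checking_def mp_subgame_perfect_checking_def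
      mp_deterministic_subgame_perfect_checking_def mem_Collect_eq
    by (rule ex_instance_iff[where V = "valid w", unfolded conj_assoc]; use * valid_instance in blast)+
qed

section \<open>The program\<close>

definition Conj :: "aexp \<Rightarrow> aexp \<Rightarrow> aexp" where "Conj e f = Ite e f (Num 0)"
definition Disj :: "aexp \<Rightarrow> aexp \<Rightarrow> aexp" where "Disj e f = Ite e (Num 1) f"
definition Neg :: "aexp \<Rightarrow> aexp" where "Neg e = Ite e (Num 0) (Num 1)"
definition Less :: "aexp \<Rightarrow> aexp \<Rightarrow> aexp" where "Less e f = Minus f e"
definition Leq :: "aexp \<Rightarrow> aexp \<Rightarrow> aexp" where "Leq e f = Plus (Minus f e) (Num 1)"
definition Eq :: "aexp \<Rightarrow> aexp \<Rightarrow> aexp" where "Eq e f = Conj (Leq e f) (Leq f e)"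
text \<open>Sums and loops always run up to \<open>N\<close>; the comparison with
  \<open>Var y\<close> cuts the range down. This is right as long as the counts are at most
  \<open>N\<close>, which \<open>fits\<close> will express.\<close>

definition ExB :: "nat \<Rightarrow> nat \<Rightarrow> aexp \<Rightarrow> aexp" where
  "ExB x y e = Sum x (Ite (Conj (Less (Var x) (Var y)) e) (Num 1) (Num 0))"
definition AllB :: "nat \<Rightarrow> nat \<Rightarrow> aexp \<Rightarrow> aexp" where "AllB x y e = Neg (ExB x y (Neg e))"
text \<open>Repeated addition, suitable when the first factor is at most \<open>N\<close>; products
  of long numbers are left to \<open>mult_com\<close>. Variable \<open>0\<close> is the index of the
  sum and cannot be an operand.\<close>

definition Times :: "nat \<Rightarrow> nat \<Rightarrow> aexp" where
  "Times x y = Sum 0 (Ite (Less (Var 0) (Var x)) (Var y) (Num 0))"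
definition Bound :: aexp where "Bound = Sum 0 (Num 1)"
definition ForB :: "nat \<Rightarrow> nat \<Rightarrow> com \<Rightarrow> com" where
  "ForB x y c = For x (Cond (Less (Var x) (Var y)) c Skip)"

lemma aval_bool [simp]:
  "0 < aval w N a (Conj e f) v \<longleftrightarrow> 0 < aval w N a e v \<and> 0 < aval w N a f v"
  "0 < aval w N a (Disj e f) v \<longleftrightarrow> 0 < aval w N a e v \<or> 0 < aval w N a f v"
  "0 < aval w N a (Neg e) v \<longleftrightarrow> \<not> 0 < aval w N a e v"
  "0 < aval w N a (Less e f) v \<longleftrightarrow> aval w N a e v < aval w N a f v"
  "0 < aval w N a (Leq e f) v \<longleftrightarrow> aval w N a e v \<le> aval w N a f v"
  "0 < aval w N a (Eq e f) v \<longleftrightarrow> aval w N a e v = aval w N a f v"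
  by (auto simp: Conj_def Disj_def Neg_def Less_def Leq_def Eq_def)

lemma aval_ExB [simp]:
  assumes "x \<noteq> y" "v y = int n" "n \<le> N"
  shows "0 < aval w N a (ExB x y e) v \<longleftrightarrow> (\<exists>i<n. 0 < aval w N a e (v(x := int i)))"
proof -
  let ?S = "{i \<in> {..<N}. i < n \<and> 0 < aval w N a e (v(x := int i))}"
  have "aval w N a (ExB x y e) v = (\<Sum>i<N. if i < n \<and> 0 < aval w N a e (v(x := int i)) then 1 else 0)"
    using assms by (auto simp: ExB_def intro!: sum.cong)
  also have "\<dots> = int (card ?S)"
    by (simp add: sum.If_cases Int_def)
  finally have "0 < aval w N a (ExB x y e) v \<longleftrightarrow> ?S \<noteq> {}"
    by (simp add: card_gt_0_iff)
  then show ?thesis using assms(3) by (auto intro: less_le_trans)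
qed

lemma aval_AllB [simp]:
  assumes "x \<noteq> y" "v y = int n" "n \<le> N"
  shows "0 < aval w N a (AllB x y e) v \<longleftrightarrow> (\<forall>i<n. 0 < aval w N a e (v(x := int i)))"
  using assms by (simp add: AllB_def)

lemma aval_Times [simp]:
  assumes "x \<noteq> 0" "y \<noteq> 0" "v x = int c" "c \<le> N"
  shows "aval w N a (Times x y) v = int c * v y"
proof -
  have "aval w N a (Times x y) v = (\<Sum>i<N. if i < c then v y else 0)"
    using assms by (auto simp: Times_def Less_def intro!: sum.cong)
  also have "\<dots> = (\<Sum>i\<in>{..<c}. v y)"
    using assms(4) by (intro sum.mono_neutral_cong_right) auto
  finally show ?thesis by simp
qed

lemma aval_Bound [simp]: "aval w N a Bound v = int N"
  by (simp add: Bound_def)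

lemma exec_For_inv:
  assumes "P 0 s" "\<And>i v a. i < N \<Longrightarrow> P i (v, a) \<Longrightarrow> P (Suc i) (exec w N c (v(x := int i), a))"
  shows "P N (exec w N (For x c) s)"
proof -
  have "P k (fold (\<lambda>i s. exec w N c ((fst s)(x := int i), snd s)) [0..<k] s)" if "k \<le> N" for k
    using that
  proof (induction k)
    case (Suc k)
    obtain v a where va: "fold (\<lambda>i s. exec w N c ((fst s)(x := int i), snd s)) [0..<k] s = (v, a)"
      by (cases "fold (\<lambda>i s. exec w N c ((fst s)(x := int i), snd s)) [0..<k] s")
    have "P k (v, a)" using Suc.IH Suc.prems va by (metis Suc_leD)
    from assms(2)[OF _ this] Suc.prems have "P (Suc k) (exec w N c (v(x := int k), a))" by simp
    then show ?case unfolding upt_Suc by (simp only: fold_append if_True le0 comp_def fold.simps va id_apply fst_conv snd_conv)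
  qed (simp add: assms(1))
  then show ?thesis by simp
qed

text \<open>The loop variable is also set in the idle iterations from \<open>m\<close> to
  \<open>N\<close>, so the invariant must not depend on its value; the index of the invariant is
  capped at \<open>m\<close>.\<close>

lemma exec_ForB_inv:
  assumes "m \<le> N" "x \<noteq> y" "P 0 s"
    and upd: "\<And>i v a z. P i (v, a) \<Longrightarrow> P i (v(x := z), a)"
    and y: "\<And>i v a. P i (v, a) \<Longrightarrow> v y = int m"
    and body: "\<And>i v a. i < m \<Longrightarrow> P i (v, a) \<Longrightarrow> v x = int i \<Longrightarrow> P (Suc i) (exec w N c (v, a))"
  shows "P m (exec w N (ForB x y c) s)"
proof -
  have "(\<lambda>i. P (min i m)) N (exec w N (ForB x y c) s)"
    unfolding ForB_def
  proof (rule exec_For_inv)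
    show "P (min 0 m) s" using assms(3) by simp
    fix i v a assume P: "P (min i m) (v, a)"
    from upd[OF P] have Q: "P (min i m) (v(x := int i), a)" .
    show "P (min (Suc i) m) (exec w N (Cond (Less (Var x) (Var y)) c Skip) (v(x := int i), a))"
    proof (cases "i < m")
      case True
      then have "min i m = i" "min (Suc i) m = Suc i" by simp_all
      with body[OF True, of "v(x := int i)" a] Q True y[OF Q] show ?thesis by simp
    next
      case False
      then have "min i m = m" "min (Suc i) m = m" by simp_all
      with Q False y[OF Q] show ?thesis by simp
    qed
  qed
  with assms(1) show ?thesis by (simp add: min_absorb2)
qed

text \<open>Variables 1 to 7 hold the parameters of the instance, 10 to 19 are loop indices; 0 is the
  verdict and the bound variable of \<open>Times\<close>.\<close>

definition params :: "int list \<Rightarrow> (nat \<Rightarrow> int) \<Rightarrow> bool" where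
  "params w v \<longleftrightarrow> v 1 = int (n_players w) \<and> v 2 = int (n_verts w) \<and> v 3 = int (n_edges w) \<and>
     v 4 = int (stride w) \<and> v 5 = int (mid_pos w) \<and> v 6 = int (n_states w) \<and> v 7 = int (n_trans w)"

lemma params_upd [simp]: "10 \<le> x \<Longrightarrow> params w (v(x := z)) = params w v"
  by (auto simp: params_def)

lemma paramsD:
  assumes "params w v"
  shows "v 1 = int (n_players w)" "v (Suc 0) = int (n_players w)" "v 2 = int (n_verts w)" "v 3 = int (n_edges w)"
    "v 4 = int (stride w)" "v 5 = int (mid_pos w)" "v 6 = int (n_states w)" "v 7 = int (n_trans w)"
  using assms by (simp_all add: params_def)

section \<open>Access to the input and validity checks\<close>

definition fits :: "int list \<Rightarrow> nat \<Rightarrow> bool" where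
  "fits w N \<longleftrightarrow> n_players w \<le> N \<and> n_verts w \<le> N \<and> n_edges w \<le> N \<and> n_states w \<le> N \<and> n_trans w \<le> N"

text \<open>The length of an edge block varies with the number of players and requires
  \<open>Times\<close>; a transition has four entries, for which additions suffice.\<close>

definition EdgeField :: "nat \<Rightarrow> aexp \<Rightarrow> aexp" where
  "EdgeField x e = Inp (Plus (Plus (Plus (Var 2) (Num 3)) (Times x 4)) e)"
definition TransField :: "nat \<Rightarrow> int \<Rightarrow> aexp" where
  "TransField x j = Inp (Plus (Plus (Var 5) (Num 4))
     (Plus (Plus (Plus (Var x) (Var x)) (Plus (Var x) (Var x))) (Num j)))"

lemma aval_EdgeField:
  assumes "params w v" "fits w N" "v x = int e" "e < n_edges w" "x \<noteq> 0" "aval w N a f v = int j"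
  shows "aval w N a (EdgeField x f) v = edge_field w e j"
proof -
  have "int (n_verts w) + 3 + int e * int (stride w) + int j = int (edge_pos w e + j)"
    by (simp add: edge_pos_def)
  moreover have "aval w N a (Times x 4) v = int e * int (stride w)"
    using aval_Times[of x 4 v e N w a] assms by (simp add: fits_def params_def)
  ultimately show ?thesis
    using assms by (simp add: EdgeField_def paramsD edge_field_def del: of_nat_add)
qed

lemma aval_TransField:
  assumes "params w v" "v x = int t"
  shows "aval w N a (TransField x (int j)) v = trans_field w t j"
proof -
  have "int (mid_pos w) + 4 + (int t + int t + (int t + int t) + int j) = int (trans_pos w t + j)"
    by (simp add: trans_pos_def)
  then show ?thesis
    using assms by (simp add: TransField_def paramsD trans_field_def del: of_nat_add)
qed

lemma aval_field_numerals [simp]: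
  assumes "params w v" "v x = int t"
  shows "aval w N a (TransField x 0) v = trans_field w t 0"
    "aval w N a (TransField x 1) v = trans_field w t 1"
    "aval w N a (TransField x 2) v = trans_field w t 2"
    "aval w N a (TransField x 3) v = trans_field w t 3"
  using aval_TransField[OF assms, of N a 0] aval_TransField[OF assms, of N a 1]
    aval_TransField[OF assms, of N a 2] aval_TransField[OF assms, of N a 3] by simp_all

lemma aval_edge_numerals [simp]:
  assumes "params w v" "fits w N" "v x = int e" "e < n_edges w" "x \<noteq> 0"
  shows "aval w N a (EdgeField x (Num 0)) v = edge_field w e 0"
    "aval w N a (EdgeField x (Num 1)) v = edge_field w e 1"
  using aval_EdgeField[OF assms, of a "Num 0" 0] aval_EdgeField[OF assms, of a "Num 1" 1] by simp_all

definition NumField :: "nat \<Rightarrow> nat \<Rightarrow> aexp" where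
  "NumField y x = EdgeField x (Plus (Num 2) (Plus (Var y) (Var y)))"
definition DenField :: "nat \<Rightarrow> nat \<Rightarrow> aexp" where
  "DenField y x = EdgeField x (Plus (Num 3) (Plus (Var y) (Var y)))"

lemma aval_NumField [simp]:
  assumes "params w v" "fits w N" "v x = int e" "e < n_edges w" "x \<noteq> 0" "v y = int i"
  shows "aval w N a (NumField y x) v = num_of w i e" "aval w N a (DenField y x) v = den_of w i e"
  unfolding NumField_def DenField_def num_of_def den_of_def
  by (rule aval_EdgeField[OF assms(1-5)]; simp add: assms(6))+

definition OwnerField :: "aexp \<Rightarrow> aexp" where
  "OwnerField e = Inp (Plus (Num 2) e)"

lemma aval_OwnerField [simp]:
  "aval w N a e v = int u \<Longrightarrow> aval w N a (OwnerField e) v = input_at w (2 + u)"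
  by (simp add: OwnerField_def nat_add_distrib)

definition owner_check :: aexp where
  "owner_check = AllB 10 2 (Conj (Leq (Num 0) (OwnerField (Var 10))) (Less (OwnerField (Var 10)) (Var 1)))"
definition edge_check :: aexp where
  "edge_check = AllB 11 3 (Conj (Leq (Num 0) (EdgeField 11 (Num 0))) (Conj (Less (EdgeField 11 (Num 0)) (Var 2))
     (Conj (Leq (Num 0) (EdgeField 11 (Num 1))) (Conj (Less (EdgeField 11 (Num 1)) (Var 2))
     (AllB 10 1 (Less (Num 0) (DenField 10 11)))))))"
definition edge_distinct_check :: aexp where
  "edge_distinct_check = AllB 11 3 (AllB 13 3 (Disj (Neg (Conj (Eq (EdgeField 11 (Num 0)) (EdgeField 13 (Num 0)))
     (Eq (EdgeField 11 (Num 1)) (EdgeField 13 (Num 1))))) (Eq (Var 11) (Var 13))))"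
definition edge_total_check :: aexp where
  "edge_total_check = AllB 10 2 (ExB 11 3 (Eq (EdgeField 11 (Num 0)) (Var 10)))"
definition start_check :: aexp where
  "start_check = Conj (Leq (Num 0) (Inp (Var 5))) (Conj (Less (Inp (Var 5)) (Var 2))
     (Conj (Leq (Num 0) (Inp (Plus (Var 5) (Num 2)))) (Less (Inp (Plus (Var 5) (Num 2))) (Var 6))))"
definition trans_check :: aexp where
  "trans_check = AllB 12 7 (Conj (Leq (Num 0) (TransField 12 0)) (Conj (Less (TransField 12 0) (Var 6))
     (Conj (Leq (Num 0) (TransField 12 1)) (Conj (Leq (Num 0) (TransField 12 2))
     (Conj (Less (TransField 12 2) (Var 6))
     (ExB 11 3 (Conj (Eq (EdgeField 11 (Num 0)) (TransField 12 1))
       (Eq (EdgeField 11 (Num 1)) (TransField 12 3)))))))))"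
definition trans_distinct_check :: aexp where
  "trans_distinct_check = AllB 12 7 (AllB 14 7 (Disj (Neg (Conj (Eq (TransField 12 0) (TransField 14 0))
     (Conj (Eq (TransField 12 1) (TransField 14 1)) (Conj (Eq (TransField 12 2) (TransField 14 2))
     (Eq (TransField 12 3) (TransField 14 3)))))) (Eq (Var 12) (Var 14))))"
definition trans_total_check :: aexp where
  "trans_total_check = AllB 10 6 (AllB 11 2 (ExB 12 7
     (Conj (Eq (TransField 12 0) (Var 10)) (Eq (TransField 12 1) (Var 11)))))"
definition content_check :: aexp where
  "content_check = Conj owner_check (Conj edge_check (Conj edge_distinct_check (Conj edge_total_check
     (Conj start_check (Conj trans_check (Conj trans_distinct_check trans_total_check))))))"

definition det_check :: aexp where
  "det_check = AllB 12 7 (AllB 14 7 (Disj (Neg (Conj (Eq (TransField 12 0) (TransField 14 0))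
        (Eq (TransField 12 1) (TransField 14 1)))) (Eq (Var 12) (Var 14))))"

lemma content_check:
  assumes "params w v" "fits w N"
  shows "0 < aval w N a content_check v \<longleftrightarrow> well_formed w"
proof -
  note p = paramsD[OF assms(1)]
  have f: "n_players w \<le> N" "n_verts w \<le> N" "n_edges w \<le> N" "n_states w \<le> N" "n_trans w \<le> N"
    using assms(2) by (simp_all add: fits_def)
  have "0 < aval w N a owner_check v \<longleftrightarrow>
     (\<forall>v<n_verts w. 0 \<le> input_at w (2 + v) \<and> input_at w (2 + v) < int (n_players w))"
    unfolding owner_check_def by (simp add: p f)
  moreover have "0 < aval w N a edge_check v \<longleftrightarrow>
     (\<forall>e<n_edges w. 0 \<le> edge_field w e 0 \<and> edge_field w e 0 < int (n_verts w) \<and>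
        0 \<le> edge_field w e 1 \<and> edge_field w e 1 < int (n_verts w) \<and>
        (\<forall>i<n_players w. 0 < den_of w i e))"
    unfolding edge_check_def by (simp add: p f assms)
  moreover have "0 < aval w N a edge_distinct_check v \<longleftrightarrow>
     (\<forall>e<n_edges w. \<forall>f<n_edges w.
        edge_field w e 0 = edge_field w f 0 \<and> edge_field w e 1 = edge_field w f 1 \<longrightarrow> e = f)"
    unfolding edge_distinct_check_def by (simp add: p f assms) blast
  moreover have "0 < aval w N a edge_total_check v \<longleftrightarrow>
     (\<forall>v<n_verts w. \<exists>e<n_edges w. edge_field w e 0 = int v)"
    unfolding edge_total_check_def by (simp add: p f assms cong: conj_cong)
  moreover have "0 < aval w N a start_check v \<longleftrightarrow>
     0 \<le> input_at w (mid_pos w) \<and> input_at w (mid_pos w) < int (n_verts w) \<and>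
     0 \<le> input_at w (mid_pos w + 2) \<and> input_at w (mid_pos w + 2) < int (n_states w)"
    unfolding start_check_def by (simp add: p nat_add_distrib)
  moreover have "0 < aval w N a trans_check v \<longleftrightarrow>
     (\<forall>t<n_trans w. 0 \<le> trans_field w t 0 \<and> trans_field w t 0 < int (n_states w) \<and>
        0 \<le> trans_field w t 1 \<and> 0 \<le> trans_field w t 2 \<and> trans_field w t 2 < int (n_states w) \<and>
        (\<exists>e<n_edges w. edge_field w e 0 = trans_field w t 1 \<and> edge_field w e 1 = trans_field w t 3))"
    unfolding trans_check_def by (simp add: p f assms cong: conj_cong)
  moreover have "0 < aval w N a trans_distinct_check v \<longleftrightarrow>
     (\<forall>t<n_trans w. \<forall>t'<n_trans w. trans_field w t 0 = trans_field w t' 0 \<and> trans_field w t 1 = trans_field w t' 1 \<and>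
        trans_field w t 2 = trans_field w t' 2 \<and> trans_field w t 3 = trans_field w t' 3 \<longrightarrow> t = t')"
    unfolding trans_distinct_check_def by (simp add: p f assms) blast
  moreover have "0 < aval w N a trans_total_check v \<longleftrightarrow>
     (\<forall>p<n_states w. \<forall>u<n_verts w. \<exists>t<n_trans w. trans_field w t 0 = int p \<and> trans_field w t 1 = int u)"
    unfolding trans_total_check_def by (simp add: p f assms)
  ultimately show ?thesis
    unfolding content_check_def well_formed_def by (simp only: aval_bool(1) conj_assoc)
qed

lemma det_check:
  assumes "params w v" "fits w N"
  shows "0 < aval w N a det_check v \<longleftrightarrow> det_code w"
proof -
  note p = paramsD[OF assms(1)]
  have f: "n_trans w \<le> N" using assms(2) by (simp add: fits_def)
  show ?thesis
    unfolding det_check_def det_code_def by (simp add: p f assms) blast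
qed

text \<open>The counts at the beginning are checked before positions are computed from them:
  \<open>Times\<close> is right only for counts up to \<open>N\<close>, and a negative count would
  silently be taken as \<open>0\<close>.\<close>

definition head_com :: com where
  "head_com = Seq (Assign 1 (Inp (Num 0))) (Seq (Assign 2 (Inp (Num 1))) (Assign 3 (Inp (Plus (Var 2) (Num 2)))))"
definition head_check :: aexp where
  "head_check = Conj (Leq (Num 0) (Var 1)) (Conj (Leq (Var 1) Len) (Conj (Leq (Num 0) (Var 2))
     (Conj (Leq (Plus (Var 2) (Num 3)) Len) (Conj (Leq (Num 0) (Var 3)) (Leq (Var 3) Len)))))"
definition mid_com :: com where
  "mid_com = Seq (Assign 4 (Plus (Num 2) (Plus (Var 1) (Var 1)))) (Seq (Assign 5 (Plus (Plus (Var 2) (Num 3)) (Times 3 4)))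
     (Seq (Assign 6 (Inp (Plus (Var 5) (Num 1)))) (Assign 7 (Inp (Plus (Var 5) (Num 3))))))"
definition mid_check :: aexp where
  "mid_check = Conj (Leq (Num 0) (Var 6)) (Conj (Leq (Num 0) (Var 7)) (Conj (Leq (Var 6) Len)
     (Eq Len (Plus (Plus (Var 5) (Num 4)) (Plus (Plus (Var 7) (Var 7)) (Plus (Var 7) (Var 7)))))))"

lemma well_shaped_le:
  assumes "well_shaped w"
  shows "n_players w \<le> length w" "n_verts w + 3 \<le> length w" "n_edges w \<le> length w"
    "n_states w \<le> length w" "n_trans w \<le> length w"
proof -
  have l: "length w = mid_pos w + 4 + n_trans w * 4" and "n_players w \<le> length w" "n_states w \<le> length w"
    using assms unfolding well_shaped_def by blast+
  then show "n_players w \<le> length w" "n_states w \<le> length w" by simp_all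
  have m: "mid_pos w = n_verts w + 3 + n_edges w * stride w" by (simp add: mid_pos_def edge_pos_def)
  have "n_edges w \<le> n_edges w * stride w" by (simp add: stride_def)
  with m l show "n_verts w + 3 \<le> length w" "n_edges w \<le> length w" "n_trans w \<le> length w"
    by linarith+
qed

lemma well_shaped_fits: "well_shaped w \<Longrightarrow> length w \<le> N \<Longrightarrow> fits w N"
  using well_shaped_le[of w] by (simp add: fits_def)

text \<open>If the first check fails, then the variables set by \<open>mid_com\<close> have no
  meaning, but the conjunction is false in any case.\<close>

lemma shape_checks:
  fixes v :: "nat \<Rightarrow> int" and a :: "array \<Rightarrow> nat \<Rightarrow> int"
  assumes "length w \<le> N"
  defines "s1 \<equiv> exec w N head_com (v, a)"
  defines "s2 \<equiv> exec w N mid_com s1"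
  shows "snd s1 = a" "fst s1 0 = v 0" "snd s2 = a" "fst s2 0 = v 0"
    "well_shaped w \<longleftrightarrow> 0 < aval w N a head_check (fst s1) \<and> 0 < aval w N a mid_check (fst s2)"
    "well_shaped w \<Longrightarrow> params w (fst s2)"
proof -
  have s1: "s1 = (v(1 := input_at w 0, 2 := input_at w 1, 3 := input_at w (nat (input_at w 1 + 2))), a)"
    by (simp add: s1_def head_com_def)
  then show "snd s1 = a" "fst s1 0 = v 0" by simp_all
  show "snd s2 = a" "fst s2 0 = v 0" by (simp_all add: s2_def mid_com_def s1)
  have head: "0 < aval w N a head_check (fst s1) \<longleftrightarrow>
     0 \<le> input_at w 0 \<and> n_players w \<le> length w \<and> 0 \<le> input_at w 1 \<and> n_verts w + 3 \<le> length w \<and>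
     0 \<le> input_at w (n_verts w + 2) \<and> n_edges w \<le> length w"
  proof (cases "0 \<le> input_at w 0 \<and> 0 \<le> input_at w 1")
    case True
    then have "input_at w 0 = int (n_players w)" and n: "input_at w 1 = int (n_verts w)"
      by (simp_all add: n_players_def n_verts_def)
    moreover have "nat (input_at w 1 + 2) = n_verts w + 2" using n by simp
    ultimately show ?thesis
      by (auto simp: head_check_def s1 n_edges_def)
  qed (auto simp: head_check_def s1)
  have p: "params w (fst s2) \<and> (0 < aval w N a mid_check (fst s2) \<longleftrightarrow>
      n_states w \<le> length w \<and> length w = mid_pos w + 4 + n_trans w * 4)"
    if h: "0 < aval w N a head_check (fst s1)" and nn: "0 \<le> input_at w (mid_pos w + 1)" "0 \<le> input_at w (mid_pos w + 3)"
    and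
      s2: "fst s2 6 = input_at w (mid_pos w + 1)" "fst s2 7 = input_at w (mid_pos w + 3)" "fst s2 5 = int (mid_pos w)"
      "fst s2 1 = int (n_players w)" "fst s2 2 = int (n_verts w)" "fst s2 3 = int (n_edges w)" "fst s2 4 = int (stride w)"
  proof -
    have "input_at w (mid_pos w + 1) = int (n_states w)" "input_at w (mid_pos w + 3) = int (n_trans w)"
      using nn by (simp_all add: n_states_def n_trans_def)
    with s2 show ?thesis
      by (auto simp: params_def mid_check_def)
  qed
  have s2: "fst s2 6 = input_at w (mid_pos w + 1) \<and> fst s2 7 = input_at w (mid_pos w + 3) \<and> fst s2 5 = int (mid_pos w) \<and>
      fst s2 1 = int (n_players w) \<and> fst s2 2 = int (n_verts w) \<and> fst s2 3 = int (n_edges w) \<and> fst s2 4 = int (stride w)"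
    if h: "0 < aval w N a head_check (fst s1)"
  proof -
    from h[unfolded head] have h': "input_at w 0 = int (n_players w)" "input_at w 1 = int (n_verts w)"
      "input_at w (n_verts w + 2) = int (n_edges w)" "n_edges w \<le> N"
      using assms(1) by (simp_all add: n_players_def n_verts_def n_edges_def)
    have n2: "nat (int (n_verts w) + 2) = n_verts w + 2" by simp
    have "fst s1 1 = int (n_players w)" "fst s1 2 = int (n_verts w)" "fst s1 3 = int (n_edges w)"
      by (simp_all add: s1 n2 h' h'(3)[unfolded add_2_eq_Suc'] del: One_nat_def)
    moreover define v1 where "v1 = (fst s1)(4 := int (stride w))"
    ultimately have v1: "v1 1 = int (n_players w)" "v1 2 = int (n_verts w)" "v1 3 = int (n_edges w)" "v1 4 = int (stride w)"
      by simp_all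
    have 4: "exec w N (Assign 4 (Plus (Num 2) (Plus (Var 1) (Var 1)))) s1 = (v1, a)"
      using \<open>fst s1 1 = _\<close> by (simp add: v1_def stride_def s1 mult.commute[of _ 2])
    have "aval w N a (Times 3 4) v1 = int (n_edges w) * int (stride w)"
      using aval_Times[of 3 4 v1 "n_edges w" N w a] v1 h'(4) by simp
    then have 5: "aval w N a (Plus (Plus (Var 2) (Num 3)) (Times 3 4)) v1 = int (mid_pos w)"
      using v1 by (simp add: mid_pos_def edge_pos_def)
    have assign5: "exec w N (Assign 5 (Plus (Plus (Var 2) (Num 3)) (Times 3 4))) (v1, a) = (v1(5 := int (mid_pos w)), a)"
      by (simp only: exec.simps 5 fst_conv snd_conv)
    have pos: "nat (int (mid_pos w) + 1) = mid_pos w + 1" "nat (int (mid_pos w) + 3) = mid_pos w + 3" by simp_all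
    have "s2 = exec w N (Seq (Assign 6 (Inp (Plus (Var 5) (Num 1)))) (Assign 7 (Inp (Plus (Var 5) (Num 3)))))
        (v1(5 := int (mid_pos w)), a)"
      unfolding s2_def mid_com_def by (simp only: exec.simps(4) 4 assign5)
    then show ?thesis using v1 by (simp add: pos)
  qed
  have iff: "well_shaped w \<longleftrightarrow> 0 < aval w N a head_check (fst s1) \<and> 0 \<le> input_at w (mid_pos w + 1) \<and>
      0 \<le> input_at w (mid_pos w + 3) \<and> n_states w \<le> length w \<and> length w = mid_pos w + 4 + n_trans w * 4"
    unfolding head using well_shaped_le[of w] by (auto simp: well_shaped_def)
  have neg: "0 \<le> input_at w (mid_pos w + 1) \<and> 0 \<le> input_at w (mid_pos w + 3)"
    if "0 < aval w N a head_check (fst s1)" "0 < aval w N a mid_check (fst s2)"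
    using s2[OF that(1)] that(2) by (simp add: mid_check_def)
  show "well_shaped w \<longleftrightarrow> 0 < aval w N a head_check (fst s1) \<and> 0 < aval w N a mid_check (fst s2)"
    using iff neg p s2 by blast
  show "params w (fst s2)" if "well_shaped w"
    using that iff p s2 by blast
qed

subsection \<open>Integer rewards\<close>

text \<open>Horner's rule consumes bits from the top and so uses the powers in decreasing order. The
  machine cannot halve, hence the table.\<close>

definition pow_com :: com where
  "pow_com = Seq (Assign 23 (Num 1)) (For 10 (Seq (Put Powers (Var 10) (Var 23)) (Assign 23 (Plus (Var 23) (Var 23)))))"

definition powers :: "nat \<Rightarrow> (array \<Rightarrow> nat \<Rightarrow> int) \<Rightarrow> bool" where
  "powers N a \<longleftrightarrow> (\<forall>j<N. a Powers j = 2 ^ j)"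

lemma pow_com:
  assumes "params w v"
  shows "\<exists>v' a'. exec w N pow_com (v, a) = (v', a') \<and> params w v' \<and> powers N a' \<and> a' Mark = a Mark \<and> a' Dist = a Dist"
proof -
  define P where "P i s \<longleftrightarrow> fst s 23 = 2 ^ i \<and> params w (fst s) \<and> powers i (snd s) \<and>
    snd s Mark = a Mark \<and> snd s Dist = a Dist" for i s
  have "P N (exec w N (For 10 (Seq (Put Powers (Var 10) (Var 23)) (Assign 23 (Plus (Var 23) (Var 23)))))
    (v(23 := 1), a))"
    by (rule exec_For_inv[where P = P]) (auto simp: P_def assms powers_def less_Suc_eq)
  then show ?thesis
    by (cases "exec w N pow_com (v, a)") (simp add: pow_com_def P_def)
qed

text \<open>Horner's rule on the bits of \<open>Var 22\<close>, which are read off from the table of powers.\<close>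

definition mult_com :: com where
  "mult_com = Seq (Assign 21 (Num 0)) (Seq (For 15 (Seq (Assign 21 (Plus (Var 21) (Var 21)))
     (Cond (Leq (Arr Powers (Minus (Minus Bound (Num 1)) (Var 15))) (Var 22))
       (Seq (Assign 22 (Minus (Var 22) (Arr Powers (Minus (Minus Bound (Num 1)) (Var 15)))))
         (Assign 21 (Plus (Var 21) (Var 20)))) Skip))) (Assign 20 (Var 21)))"

text \<open>Halving the modulus \<open>2 * D\<close> moves one bit from the remainder to the
  quotient; the comparison with \<open>D\<close> reads this bit.\<close>

lemma div_mod_half:
  fixes y D :: int
  assumes "D > 0"
  shows "D \<le> y mod (2 * D) \<Longrightarrow> y div D = 2 * (y div (2 * D)) + 1 \<and> y mod D = y mod (2 * D) - D"
    "\<not> D \<le> y mod (2 * D) \<Longrightarrow> y div D = 2 * (y div (2 * D)) \<and> y mod D = y mod (2 * D)"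
proof -
  define q r where "q = y div (2 * D)" and "r = y mod (2 * D)"
  have y: "y = 2 * D * q + r" by (simp add: q_def r_def)
  have r: "0 \<le> r" "r < 2 * D" using assms by (simp_all add: r_def)
  show "D \<le> y mod (2 * D) \<Longrightarrow> y div D = 2 * (y div (2 * D)) + 1 \<and> y mod D = y mod (2 * D) - D"
    unfolding q_def[symmetric] r_def[symmetric]
    using int_div_pos_eq[of y D "2 * q + 1" "r - D"] int_mod_pos_eq[of y D "2 * q + 1" "r - D"] y r
    by (simp add: algebra_simps)
  show "\<not> D \<le> y mod (2 * D) \<Longrightarrow> y div D = 2 * (y div (2 * D)) \<and> y mod D = y mod (2 * D)"
    unfolding q_def[symmetric] r_def[symmetric]
    using int_div_pos_eq[of y D "2 * q" r] int_mod_pos_eq[of y D "2 * q" r] y r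
    by (simp add: algebra_simps)
qed

text \<open>Only the multiplier in variable \<open>22\<close> is limited by the loop bound; the
  other factor, in variable \<open>20\<close>, may have any size and sign.\<close>

lemma mult_com:
  assumes "powers N a" "0 \<le> v 22" "v 22 < 2 ^ N"
  shows "\<exists>v'. exec w N mult_com (v, a) = (v', a) \<and> v' 20 = v 20 * v 22 \<and>
    (\<forall>x. x \<notin> {15, 20, 21, 22} \<longrightarrow> v' x = v x)"
proof -
  let ?y = "v 22"
  \<comment> \<open>After \<open>j\<close> rounds, variable \<open>21\<close> is the product with
    the number formed by the leading \<open>j\<close> of \<open>N\<close> bits, and variable
    \<open>22\<close> the number formed by the others.\<close>
  define P where "P j s \<longleftrightarrow> snd s = a \<and> fst s 20 = v 20 \<and> fst s 21 = v 20 * (?y div 2 ^ (N - j)) \<and>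
    fst s 22 = ?y mod 2 ^ (N - j) \<and> (\<forall>x. x \<notin> {15, 20, 21, 22} \<longrightarrow> fst s x = v x)" for j s
  have "P N (exec w N (For 15 (Seq (Assign 21 (Plus (Var 21) (Var 21)))
     (Cond (Leq (Arr Powers (Minus (Minus Bound (Num 1)) (Var 15))) (Var 22))
       (Seq (Assign 22 (Minus (Var 22) (Arr Powers (Minus (Minus Bound (Num 1)) (Var 15)))))
         (Assign 21 (Plus (Var 21) (Var 20)))) Skip))) (v(21 := 0), a))"
  proof (rule exec_For_inv[where P = P])
    show "P 0 (v(21 := 0), a)" using assms by (simp add: P_def)
    fix j u b assume j: "j < N" and P: "P j (u, b)"
    have e: "nat (int N - 1 - int j) = N - Suc j" "nat (int N - (1 + int j)) = N - Suc j"
      using j by linarith+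
    have D: "a Powers (N - Suc j) = 2 ^ (N - Suc j)" using assms(1) j by (simp add: powers_def)
    have d: "(2::int) ^ (N - j) = 2 * 2 ^ (N - Suc j)" using j by (simp add: Suc_diff_Suc flip: power_Suc)
    have half: "(0::int) < 2 ^ (N - Suc j)" by simp
    show "P (Suc j) (exec w N (Seq (Assign 21 (Plus (Var 21) (Var 21)))
     (Cond (Leq (Arr Powers (Minus (Minus Bound (Num 1)) (Var 15))) (Var 22))
       (Seq (Assign 22 (Minus (Var 22) (Arr Powers (Minus (Minus Bound (Num 1)) (Var 15)))))
         (Assign 21 (Plus (Var 21) (Var 20)))) Skip)) (u(15 := int j), b))"
    proof (cases "2 ^ (N - Suc j) \<le> ?y mod 2 ^ (N - j)")
      case True
      with div_mod_half(1)[OF half, of ?y] P show ?thesis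
        by (simp add: P_def e D d algebra_simps)
    next
      case False
      with div_mod_half(2)[OF half, of ?y] P show ?thesis
        by (simp add: P_def e D d algebra_simps)
    qed
  qed
  then show ?thesis
    by (cases "exec w N mult_com (v, a)") (auto simp: mult_com_def P_def)
qed

definition reward_com :: com where
  "reward_com = ForB 10 1 (ForB 11 3 (Seq (Assign 20 (NumField 10 11)) (Seq
     (ForB 13 3 (Cond (Eq (Var 11) (Var 13)) Skip (Seq (Assign 22 (DenField 10 13)) mult_com)))
     (Put Rewards (Plus (Times 10 3) (Var 11)) (Var 20)))))"

definition reward_table :: "int list \<Rightarrow> (array \<Rightarrow> nat \<Rightarrow> int) \<Rightarrow> bool" where
  "reward_table w a \<longleftrightarrow> (\<forall>i<n_players w. \<forall>e<n_edges w. a Rewards (i * n_edges w + e) = int_reward w i e)"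

text \<open>This is why loops run as often as the input has bits rather than entries: every
  denominator is then a legitimate multiplier.\<close>

lemma less_power_input_size: "input_at w k < 2 ^ input_size w"
proof -
  have "nat \<bar>input_at w k\<bar> < 2 ^ floorlog 2 (nat \<bar>input_at w k\<bar>)"
    using less_floorlog_iff[of "floorlog 2 (nat \<bar>input_at w k\<bar>)" "nat \<bar>input_at w k\<bar>"] by simp
  also have "(2::nat) ^ floorlog 2 (nat \<bar>input_at w k\<bar>) \<le> 2 ^ input_size w"
    using floorlog_input_le by (intro power_increasing) auto
  finally show ?thesis by (simp add: nat_less_numeral_power_cancel_iff)
qed

lemma index_inj:
  fixes i i' e e' m :: nat
  shows "e < m \<Longrightarrow> e' < m \<Longrightarrow> i * m + e = i' * m + e' \<longleftrightarrow> i = i' \<and> e = e'"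
  by (metis add.commute div_mult_self3 div_less add.left_neutral mod_mult_self3 mod_less
      add_cancel_right_left less_nat_zero_code)

lemma reward_com:
  assumes "params w v" "fits w N" "N = input_size w" "powers N a"
    and den: "\<And>i e. i < n_players w \<Longrightarrow> e < n_edges w \<Longrightarrow> 0 < den_of w i e"
  shows "\<exists>v' a'. exec w N reward_com (v, a) = (v', a') \<and> params w v' \<and> reward_table w a' \<and>
    a' Mark = a Mark \<and> a' Dist = a Dist"
proof -
  let ?k = "n_players w" and ?m = "n_edges w"
  have f: "?k \<le> N" "?m \<le> N" using assms(2) by (simp_all add: fits_def)
  define A where "A s \<longleftrightarrow> params w (fst s) \<and> powers N (snd s) \<and> snd s Mark = a Mark \<and> snd s Dist = a Dist" for s
  \<comment> \<open>The invariants of the three nested loops refine each other: \<open>P\<close>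
    speaks of the finished players, \<open>Q\<close> adds the finished edges of player
    \<open>i\<close>, and \<open>R\<close> the partial product for edge \<open>e\<close>.\<close>
  define P where "P i s \<longleftrightarrow> A s \<and> (\<forall>i'<i. \<forall>e<?m. snd s Rewards (i' * ?m + e) = int_reward w i' e)" for i s
  define Q where "Q i e s \<longleftrightarrow> P i s \<and> fst s 10 = int i \<and> (\<forall>e'<e. snd s Rewards (i * ?m + e') = int_reward w i e')" for i e s
  define R where "R i e g s \<longleftrightarrow> Q i e s \<and> fst s 11 = int e \<and>
     fst s 20 = num_of w i e * (\<Prod>f\<in>{..<g} - {e}. den_of w i f)" for i e g s
  have inner: "R i e ?m (exec w N (ForB 13 3 (Cond (Eq (Var 11) (Var 13)) Skip (Seq (Assign 22 (DenField 10 13)) mult_com))) s)"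
    if "i < ?k" "e < ?m" "R i e 0 s" for i e s
  proof (rule exec_ForB_inv[where P = "R i e", OF f(2) _ that(3)])
    fix g u b assume g: "g < ?m" and R: "R i e g (u, b)" and u: "u 13 = int g"
    have u': "params w u" "u 11 = int e" "u 10 = int i" "powers N b"
      using R by (simp_all add: R_def Q_def P_def A_def)
    show "R i e (Suc g) (exec w N (Cond (Eq (Var 11) (Var 13)) Skip (Seq (Assign 22 (DenField 10 13)) mult_com)) (u, b))"
    proof (cases "e = g")
      case True
      then have "{..<Suc g} - {e} = {..<g} - {e}" by auto
      with True R u u' show ?thesis by (simp add: R_def)
    next
      case False
      have fld: "aval w N b (DenField 10 13) u = den_of w i g"
        by (rule aval_NumField(2)[OF u'(1) assms(2) u g _ u'(3)]) simp
      define u1 where "u1 = u(22 := den_of w i g)"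
      have "0 \<le> u1 22" "u1 22 < 2 ^ N"
        using den[OF that(1) g] less_power_input_size[of w] assms(3)
        by (simp_all add: u1_def den_of_def edge_field_def)
      from mult_com[where v = u1, OF u'(4) this, of w] obtain u2 where
        u2: "exec w N mult_com (u1, b) = (u2, b)" "u2 20 = u1 20 * u1 22" "\<And>x. x \<notin> {15, 20, 21, 22} \<Longrightarrow> u2 x = u1 x"
        by blast
      have "{..<Suc g} - {e} = insert g ({..<g} - {e})" using False by auto
      then have "(\<Prod>f\<in>{..<Suc g} - {e}. den_of w i f) = (\<Prod>f\<in>{..<g} - {e}. den_of w i f) * den_of w i g" by simp
      moreover have "params w u2" using u'(1) u2(3) by (simp add: params_def u1_def)
      ultimately show ?thesis
        using False R u u' u2(2) u2(3)[of 10] u2(3)[of 11]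
        by (simp add: fld u2(1) flip: u1_def) (simp add: R_def Q_def P_def A_def u1_def)
    qed
  qed (auto simp: R_def Q_def P_def A_def paramsD)
  have middle: "Q i ?m (exec w N (ForB 11 3 (Seq (Assign 20 (NumField 10 11)) (Seq
     (ForB 13 3 (Cond (Eq (Var 11) (Var 13)) Skip (Seq (Assign 22 (DenField 10 13)) mult_com)))
     (Put Rewards (Plus (Times 10 3) (Var 11)) (Var 20))))) s)"
    if "i < ?k" "Q i 0 s" for i s
  proof (rule exec_ForB_inv[where P = "Q i", OF f(2) _ that(2)])
    fix e u b assume e: "e < ?m" and Q: "Q i e (u, b)" and u: "u 11 = int e"
    have u': "params w u" "u 10 = int i" using Q by (simp_all add: Q_def P_def A_def)
    have fld: "aval w N b (NumField 10 11) u = num_of w i e"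
      by (rule aval_NumField(1)[OF u'(1) assms(2) u e _ u'(2)]) simp
    have "R i e 0 (u(20 := num_of w i e), b)"
      using Q u by (simp add: R_def Q_def P_def A_def)
    from inner[OF that(1) e this] obtain u1 b1 where
      ex: "exec w N (ForB 13 3 (Cond (Eq (Var 11) (Var 13)) Skip (Seq (Assign 22 (DenField 10 13)) mult_com)))
        (u(20 := num_of w i e), b) = (u1, b1)" and R: "R i e ?m (u1, b1)" by (metis prod.collapse)
    have u1: "params w u1" "u1 10 = int i" "u1 11 = int e" "u1 20 = int_reward w i e"
      using R by (simp_all add: R_def Q_def P_def A_def int_reward_def)
    have "aval w N b1 (Times 10 3) u1 = int i * int ?m"
      using aval_Times[of 10 3 u1 i N w b1] u1 that(1) f(1) by (simp add: paramsD)
    then have pos: "nat (aval w N b1 (Plus (Times 10 3) (Var 11)) u1) = i * ?m + e"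
      using u1(3) by (simp add: nat_add_distrib nat_mult_distrib)
    \<comment> \<open>Positions of different pairs differ, so the new entry spoils no finished
      row.\<close>
    have old: "(if i' * ?m + e' = i * ?m + e then x else z) = z" if "i' < i" "e' < ?m" for i' e' and x z :: int
      using that e by (simp add: index_inj)
    show "Q i (Suc e) (exec w N (Seq (Assign 20 (NumField 10 11)) (Seq
     (ForB 13 3 (Cond (Eq (Var 11) (Var 13)) Skip (Seq (Assign 22 (DenField 10 13)) mult_com)))
     (Put Rewards (Plus (Times 10 3) (Var 11)) (Var 20)))) (u, b))"
      using R u1 e
      by (simp add: fld ex pos del: aval.simps(3) aval_Times)
         (auto simp: R_def Q_def P_def A_def powers_def old less_Suc_eq)
  qed (auto simp: Q_def P_def A_def paramsD)
  have "P ?k (exec w N reward_com (v, a))"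
    unfolding reward_com_def
  proof (rule exec_ForB_inv[where P = P, OF f(1)])
    show "P 0 (v, a)" using assms by (simp add: P_def A_def)
    fix i u b assume i: "i < ?k" and P: "P i (u, b)" and u: "u 10 = int i"
    have "Q i 0 (u, b)" using P u by (simp add: Q_def)
    from middle[OF i this] show "P (Suc i) (exec w N (ForB 11 3 (Seq (Assign 20 (NumField 10 11)) (Seq
     (ForB 13 3 (Cond (Eq (Var 11) (Var 13)) Skip (Seq (Assign 22 (DenField 10 13)) mult_com)))
     (Put Rewards (Plus (Times 10 3) (Var 11)) (Var 20))))) (u, b))"
      by (auto simp: Q_def P_def less_Suc_eq)
  qed (auto simp: P_def A_def paramsD)
  then show ?thesis
    by (cases "exec w N reward_com (v, a)") (auto simp: P_def A_def reward_table_def)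
qed

subsection \<open>Relaxation rounds\<close>

text \<open>Mixed radix representation with bases \<open>n_verts\<close> and
  \<open>n_states\<close>; parity tells the two kinds of vertices apart.\<close>

fun node_index :: "int list \<Rightarrow> (nat, nat, nat) node \<Rightarrow> nat" where
  "node_index w (Common q v) = 2 * (n_verts w * q + v)"
| "node_index w (Split i p u q v) =
     2 * (n_verts w * (n_states w * (n_verts w * (n_states w * i + p) + u) + q) + v) + 1"

definition code_nodes :: "int list \<Rightarrow> (nat, nat, nat) node set" where
  "code_nodes w = {Common q v | q v. q < n_states w \<and> v < n_verts w} \<union>
     {Split i p u q v | i p u q v. i < n_players w \<and> p < n_states w \<and> u < n_verts w \<and> q < n_states w \<and> v < n_verts w}"

lemma digits_inj: "(b::nat) < n \<Longrightarrow> b' < n \<Longrightarrow> n * a + b = n * a' + b' \<longleftrightarrow> a = a' \<and> b = b'"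
  using index_inj[of b n b' a a'] by (simp add: mult.commute)

lemma node_index_inj:
  assumes "x \<in> code_nodes w" "y \<in> code_nodes w"
  shows "node_index w x = node_index w y \<longleftrightarrow> x = y"
proof -
  have par: "2 * a \<noteq> 2 * b + 1" "2 * b + 1 \<noteq> 2 * a" for a b :: nat by presburger+
  show ?thesis
    using assms unfolding code_nodes_def by (auto simp: digits_inj par[simplified] simp del: distrib_left_numeral)
qed

lemma code_nodes_eq:
  "code_nodes w = (\<lambda>(q, v). Common q v) ` ({..<n_states w} \<times> {..<n_verts w}) \<union>
     (\<lambda>(i, p, u, q, v). Split i p u q v) ` ({..<n_players w} \<times> {..<n_states w} \<times> {..<n_verts w} \<times> {..<n_states w} \<times> {..<n_verts w})"
  unfolding code_nodes_def by (auto simp: image_iff)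

lemma finite_code_nodes: "finite (code_nodes w)"
  unfolding code_nodes_eq by simp

text \<open>A \<open>Common\<close> vertex has two coordinates and a \<open>Split\<close> vertex
  five, each with at most \<open>N\<close> values, and
  \<open>N ^ 2 + N ^ 5 < 2 * N ^ 5 <= N ^ 6\<close> for \<open>N >= 2\<close>.\<close>

lemma card_code_nodes:
  assumes "fits w N" "2 \<le> N"
  shows "card (code_nodes w) < N ^ 6"
proof -
  have f: "n_players w \<le> N" "n_verts w \<le> N" "n_states w \<le> N" using assms(1) by (simp_all add: fits_def)
  have "card (code_nodes w) \<le> card ({..<n_states w} \<times> {..<n_verts w}) +
      card ({..<n_players w} \<times> {..<n_states w} \<times> {..<n_verts w} \<times> {..<n_states w} \<times> {..<n_verts w})"
    unfolding code_nodes_eq by (rule order.trans[OF card_Un_le]) (intro add_mono card_image_le; simp)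
  also have "\<dots> = n_states w * n_verts w + n_players w * (n_states w * (n_verts w * (n_states w * n_verts w)))"
    by (simp add: card_cartesian_product)
  also have "\<dots> \<le> N * N + N * (N * (N * (N * N)))"
    using f by (intro add_mono mult_le_mono)
  also have "\<dots> = N ^ 2 + N ^ 5" by (simp add: power2_eq_square eval_nat_numeral)
  also have "\<dots> < N ^ 5 + N ^ 5" using assms(2) by (intro add_strict_right_mono power_strict_increasing) auto
  also have "\<dots> = 2 * N ^ 5" by simp
  also have "\<dots> \<le> N * N ^ 5" using assms(2) by (rule mult_right_mono) simp
  also have "\<dots> = N ^ 6" by (simp add: eval_nat_numeral)
  finally show ?thesis .
qed

section \<open>Simulation of abstract relaxations in memory\<close>

type_synonym code_labelling = "(nat, nat, nat) node labelling \<times> bool"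

text \<open>\<open>Dist\<close> is left open at vertices without label, so arrays filled with
  \<open>0\<close> represent the empty labelling.\<close>

definition represents :: "int list \<Rightarrow> (array \<Rightarrow> nat \<Rightarrow> int) \<Rightarrow> (nat, nat, nat) node labelling \<Rightarrow> bool" where
  "represents w a d \<longleftrightarrow> (\<forall>x \<in> code_nodes w.
     (d x = None \<longrightarrow> a Mark (node_index w x) \<le> 0) \<and>
     (\<forall>z. d x = Some z \<longrightarrow> 0 < a Mark (node_index w x) \<and> a Dist (node_index w x) = z))"

text \<open>The list \<open>L\<close> fixes the loop indices in force, on which the bodies of nested
  loops rely. Variable \<open>27\<close> is the flag of the labelling; other variables from
  \<open>10\<close> on are free unless listed.\<close>

definition sim :: "int list \<Rightarrow> (nat \<times> int) list \<Rightarrow> state \<Rightarrow> code_labelling \<Rightarrow> bool" where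
  "sim w L s D \<longleftrightarrow> params w (fst s) \<and> (\<forall>x z. (x, z) \<in> set L \<longrightarrow> fst s x = z) \<and> reward_table w (snd s) \<and>
     (snd D \<longleftrightarrow> 0 < fst s 27) \<and> represents w (snd s) (fst D)"

lemma sim_upd: "sim w L (v, a) D \<Longrightarrow> 10 \<le> x \<Longrightarrow> x \<noteq> 27 \<Longrightarrow> x \<notin> fst ` set L \<Longrightarrow> sim w L (v(x := z), a) D"
  unfolding sim_def by force

lemma sim_Cons: "sim w ((x, z) # L) s D \<longleftrightarrow> fst s x = z \<and> sim w L s D"
  unfolding sim_def by auto

definition relax_com :: com where
  "relax_com = Cond (Conj (Less (Num 0) (Arr Mark (Var 24))) (Disj (Leq (Arr Mark (Var 25)) (Num 0))
       (Less (Arr Dist (Var 25)) (Plus (Arr Dist (Var 24)) (Var 26)))))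
     (Seq (Put Mark (Var 25) (Num 1)) (Seq (Put Dist (Var 25) (Plus (Arr Dist (Var 24)) (Var 26)))
       (Assign 27 (Num 1)))) Skip"

lemma relax_com:
  assumes sim: "sim w L (v, a) D" and x: "v 24 = int (node_index w x)" "x \<in> code_nodes w"
    and y: "v 25 = int (node_index w y)" "y \<in> code_nodes w" and c: "v 26 = c" and L: "27 \<notin> fst ` set L"
  shows "sim w L (exec w N relax_com (v, a)) (relax (x, y, c) D)"
proof -
  have lx: "fst D x = None \<Longrightarrow> a Mark (node_index w x) \<le> 0"
      "fst D x = Some z \<Longrightarrow> 0 < a Mark (node_index w x) \<and> a Dist (node_index w x) = z"
    and ly: "fst D y = None \<Longrightarrow> a Mark (node_index w y) \<le> 0"
      "fst D y = Some z \<Longrightarrow> 0 < a Mark (node_index w y) \<and> a Dist (node_index w y) = z" for z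
    using sim x(2) y(2) by (simp_all add: sim_def represents_def)
  have iff: "relaxes (fst D) (x, y, c) \<longleftrightarrow> 0 < a Mark (node_index w x) \<and>
      (a Mark (node_index w y) \<le> 0 \<or> a Dist (node_index w y) < a Dist (node_index w x) + c)"
    using lx ly unfolding relaxes_def by (cases "fst D x"; cases "fst D y") force+
  show ?thesis
  proof (cases "relaxes (fst D) (x, y, c)")
    case True
    then obtain z where z: "fst D x = Some z" by (auto simp: relaxes_def)
    with lx have dz: "a Dist (node_index w x) = z" by simp
    have ex: "exec w N relax_com (v, a) = (v(27 := 1),
        a(Mark := (a Mark)(node_index w y := 1), Dist := (a Dist)(node_index w y := z + c)))"
      using True[unfolded iff] by (auto simp: relax_com_def x y c dz)
    have rel: "relax (x, y, c) D = ((fst D)(y \<mapsto> z + c), True)"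
      using True by (simp add: relax_def z)
    have "represents w (a(Mark := (a Mark)(node_index w y := 1), Dist := (a Dist)(node_index w y := z + c)))
        ((fst D)(y \<mapsto> z + c))"
      using sim y(2) by (auto simp: sim_def represents_def node_index_inj)
    moreover have "x \<noteq> 27" if "(x, z) \<in> set L" for x z using L that by force
    ultimately show ?thesis
      using sim unfolding ex rel by (simp add: sim_def reward_table_def)
  next
    case False
    then have "exec w N relax_com (v, a) = (v, a)"
      using False[unfolded iff] by (auto simp: relax_com_def x y c)
    with False sim show ?thesis by (simp add: relax_def)
  qed
qed

lemma sim_Seq:
  "sim w L (exec w N c s) (fold relax es D) \<Longrightarrow>
   (\<And>s D. sim w L s D \<Longrightarrow> sim w L (exec w N d s) (fold relax fs D)) \<Longrightarrow>
   sim w L (exec w N (Seq c d) s) (fold relax (es @ fs) D)"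
  by simp

lemma sim_If:
  assumes "sim w L s D" "\<And>v a. sim w L (v, a) D \<Longrightarrow> 0 < aval w N a e v \<longleftrightarrow> B"
    "\<And>s. B \<Longrightarrow> sim w L s D \<Longrightarrow> sim w L (exec w N c s) (fold relax es D)"
  shows "sim w L (exec w N (Cond e c Skip) s) (fold relax (if B then es else []) D)"
  using assms(1) assms(2)[of "fst s" "snd s"] assms(3)[of s] by auto

text \<open>Together with \<open>sim_Seq\<close> and \<open>sim_If\<close>, this translates a
  program into the list of edges that it relaxes: composition becomes concatenation, a conditional
  an optional list, and a loop the concatenation over its indices.\<close>

lemma sim_ForB:
  assumes "sim w L s D" and m: "\<And>v. params w v \<Longrightarrow> v y = int m" "m \<le> N"
    and x: "10 \<le> x" "x \<noteq> 27" "y < 10" "x \<notin> fst ` set L"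
    and body: "\<And>i s D. i < m \<Longrightarrow> sim w ((x, int i) # L) s D \<Longrightarrow>
      sim w ((x, int i) # L) (exec w N c s) (fold relax (g i) D)"
  shows "sim w L (exec w N (ForB x y c) s) (fold relax (concat (map g [0..<m])) D)"
proof (rule exec_ForB_inv[where P = "\<lambda>i s. sim w L s (fold relax (concat (map g [0..<i])) D)", OF m(2)])
  show "x \<noteq> y" using x by simp
  fix i v a
  show "sim w L (v(x := z), a) (fold relax (concat (map g [0..<i])) D)"
    if "sim w L (v, a) (fold relax (concat (map g [0..<i])) D)" for z
    using sim_upd[OF that x(1,2,4)] .
  show "v y = int m" if "sim w L (v, a) (fold relax (concat (map g [0..<i])) D)"
    using that m(1) by (simp add: sim_def)
  assume i: "i < m" and s: "sim w L (v, a) (fold relax (concat (map g [0..<i])) D)" and v: "v x = int i"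
  then have "sim w ((x, int i) # L) (v, a) (fold relax (concat (map g [0..<i])) D)" by (simp add: sim_Cons)
  from body[OF i this] show "sim w L (exec w N c (v, a)) (fold relax (concat (map g [0..<Suc i])) D)"
    by (simp add: sim_Cons)
qed (use assms(1) in simp)

lemma sim_For_iterate:
  assumes "sim w L s D" "\<And>s D. sim w L s D \<Longrightarrow> sim w L (exec w N c s) (f D)"
    and x: "10 \<le> x" "x \<noteq> 27" "x \<notin> fst ` set L"
  shows "sim w L (exec w N (For x c) s) ((f ^^ N) D)"
proof (rule exec_For_inv[where P = "\<lambda>i s. sim w L s ((f ^^ i) D)"])
  show "sim w L s ((f ^^ 0) D)" using assms(1) by simp
  fix i v a assume "sim w L (v, a) ((f ^^ i) D)"
  from assms(2)[OF sim_upd[OF this x]] show "sim w L (exec w N c (v(x := int i), a)) ((f ^^ Suc i) D)"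
    by simp
qed

definition horner :: "nat \<Rightarrow> nat \<Rightarrow> aexp \<Rightarrow> com" where
  "horner r y e = Assign r (Plus (Times y r) e)"
definition put_common :: "nat \<Rightarrow> aexp \<Rightarrow> aexp \<Rightarrow> com" where
  "put_common r q u = Seq (Assign r q) (Seq (horner r 2 u) (Assign r (Plus (Var r) (Var r))))"
definition put_split :: "nat \<Rightarrow> aexp \<Rightarrow> aexp \<Rightarrow> aexp \<Rightarrow> aexp \<Rightarrow> aexp \<Rightarrow> com" where
  "put_split r i p u q z = Seq (Assign r i) (Seq (horner r 6 p) (Seq (horner r 2 u) (Seq (horner r 6 q)
     (Seq (horner r 2 z) (Assign r (Plus (Plus (Var r) (Var r)) (Num 1)))))))"

lemma horner:
  assumes "params w v" "fits w N" "10 \<le> r" "v r = int c" "aval w N a e v = int b"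
  shows "exec w N (horner r 2 e) (v, a) = (v(r := int (n_verts w * c + b)), a)"
    "exec w N (horner r 6 e) (v, a) = (v(r := int (n_states w * c + b)), a)"
  using assms aval_Times[of 2 r v "n_verts w" N w a] aval_Times[of 6 r v "n_states w" N w a]
  by (simp_all add: horner_def fits_def paramsD)

text \<open>The second argument is evaluated when \<open>r\<close> already holds a partial result,
  so arguments must have the same value whatever \<open>r\<close> contains.\<close>

lemma put_common:
  assumes "params w v" "fits w N" "10 \<le> r"
    "\<And>z. aval w N a e (v(r := z)) = int q" "\<And>z. aval w N a f (v(r := z)) = int u"
  shows "exec w N (put_common r e f) (v, a) = (v(r := int (node_index w (Common q u))), a)"
proof -
  have "aval w N a e v = int q" using assms(4)[of "v r"] by simp
  moreover have "params w (v(r := z))" for z using assms(1,3) by simp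
  ultimately show ?thesis
    using horner[of w "v(r := int q)" N r q a f u] assms by (simp add: put_common_def mult.commute)
qed

lemma put_split:
  assumes "params w v" "fits w N" "10 \<le> r"
    "\<And>z. aval w N a e1 (v(r := z)) = int i" "\<And>z. aval w N a e2 (v(r := z)) = int p"
    "\<And>z. aval w N a e3 (v(r := z)) = int u" "\<And>z. aval w N a e4 (v(r := z)) = int q"
    "\<And>z. aval w N a e5 (v(r := z)) = int t"
  shows "exec w N (put_split r e1 e2 e3 e4 e5) (v, a) = (v(r := int (node_index w (Split i p u q t))), a)"
proof -
  have e1: "aval w N a e1 v = int i" using assms(4)[of "v r"] by simp
  have par: "params w (v(r := z))" for z using assms(1,3) by simp
  have h: "exec w N (horner r 2 e) (v(r := int c), a) = (v(r := int (n_verts w * c + b)), a)"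
      "exec w N (horner r 6 e) (v(r := int c), a) = (v(r := int (n_states w * c + b)), a)"
    if "\<And>z. aval w N a e (v(r := z)) = int b" for e c b
    using horner[of w "v(r := int c)" N r c a e b] that assms(2,3) par by simp_all
  show ?thesis
    by (simp add: put_split_def e1 h[OF assms(5)] h[OF assms(6)] h[OF assms(7)] h[OF assms(8)] del: of_nat_add of_nat_mult)
       (simp add: algebra_simps)
qed

text \<open>The commands \<open>c\<close> and \<open>d\<close> are to leave the indices of source
  and target in variables \<open>24\<close> and \<open>25\<close>.\<close>

definition edge_com :: "com \<Rightarrow> com \<Rightarrow> aexp \<Rightarrow> com" where
  "edge_com c d e = Seq c (Seq d (Seq (Assign 26 e) relax_com))"

lemma sim_edge:
  assumes sim: "sim w L (v, a) D" and L: "\<And>x. x \<in> fst ` set L \<Longrightarrow> x < 20"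
    and c: "exec w N c (v, a) = (v(24 := int (node_index w x)), a)" "x \<in> code_nodes w"
    and d: "exec w N d (v(24 := int (node_index w x)), a) = (v(24 := int (node_index w x), 25 := int (node_index w y)), a)"
      "y \<in> code_nodes w"
    and e: "aval w N a e (v(24 := int (node_index w x), 25 := int (node_index w y))) = z"
  shows "sim w L (exec w N (edge_com c d e) (v, a)) (fold relax [(x, y, z)] D)"
proof -
  let ?v = "v(24 := int (node_index w x), 25 := int (node_index w y), 26 := z)"
  have L': "24 \<notin> fst ` set L" "25 \<notin> fst ` set L" "26 \<notin> fst ` set L" "27 \<notin> fst ` set L"
    using L by force+
  have "sim w L (?v, a) D"
    using sim L' by (intro sim_upd) auto
  from relax_com[OF this, of x y z N] show ?thesis
    using c d e L'(4) by (simp add: edge_com_def)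
qed

section \<open>Enumeration of the edges of the deviation graph\<close>

definition edge_nat :: "int list \<Rightarrow> nat \<Rightarrow> nat \<Rightarrow> nat" where "edge_nat w e j = nat (edge_field w e j)"
definition trans_nat :: "int list \<Rightarrow> nat \<Rightarrow> nat \<Rightarrow> nat" where "trans_nat w t j = nat (trans_field w t j)"

lemma edge_of_nat: "edge_of w e = (edge_nat w e 0, edge_nat w e 1)"
  by (simp add: edge_of_def edge_nat_def)

lemma trans_of_nat: "trans_of w t = (trans_nat w t 0, trans_nat w t 1, trans_nat w t 2, trans_nat w t 3)"
  by (simp add: trans_of_def trans_nat_def)

lemma valid_edge:
  assumes "valid w" "e < n_edges w"
  shows "edge_field w e 0 = int (edge_nat w e 0)" "edge_field w e 1 = int (edge_nat w e 1)"
    "edge_nat w e 0 < n_verts w" "edge_nat w e 1 < n_verts w"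
proof -
  have "0 \<le> edge_field w e 0 \<and> edge_field w e 0 < int (n_verts w) \<and> 0 \<le> edge_field w e 1 \<and> edge_field w e 1 < int (n_verts w)"
    using assms unfolding valid_def well_formed_def by blast
  then show "edge_field w e 0 = int (edge_nat w e 0)" "edge_field w e 1 = int (edge_nat w e 1)"
    "edge_nat w e 0 < n_verts w" "edge_nat w e 1 < n_verts w"
    unfolding edge_nat_def by linarith+
qed

lemma valid_trans:
  assumes "valid w" "t < n_trans w"
  shows "trans_field w t 0 = int (trans_nat w t 0)" "trans_field w t 1 = int (trans_nat w t 1)"
    "trans_field w t 2 = int (trans_nat w t 2)" "trans_field w t 3 = int (trans_nat w t 3)"
    "trans_nat w t 0 < n_states w" "trans_nat w t 1 < n_verts w" "trans_nat w t 2 < n_states w" "trans_nat w t 3 < n_verts w"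
    "\<exists>e<n_edges w. edge_of w e = (trans_nat w t 1, trans_nat w t 3)"
proof -
  have r: "0 \<le> trans_field w t 0 \<and> trans_field w t 0 < int (n_states w) \<and>
      0 \<le> trans_field w t 1 \<and> 0 \<le> trans_field w t 2 \<and> trans_field w t 2 < int (n_states w)"
    and "\<exists>e<n_edges w. edge_field w e 0 = trans_field w t 1 \<and> edge_field w e 1 = trans_field w t 3"
    using assms unfolding valid_def well_formed_def by blast+
  then obtain e where e: "e < n_edges w" "edge_field w e 0 = trans_field w t 1" "edge_field w e 1 = trans_field w t 3"
    by blast
  note v = valid_edge[OF assms(1) e(1)]
  show "trans_field w t 0 = int (trans_nat w t 0)" "trans_field w t 1 = int (trans_nat w t 1)"
    "trans_field w t 2 = int (trans_nat w t 2)" "trans_field w t 3 = int (trans_nat w t 3)"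
    "trans_nat w t 0 < n_states w" "trans_nat w t 1 < n_verts w" "trans_nat w t 2 < n_states w" "trans_nat w t 3 < n_verts w"
    using r v e(2,3) unfolding trans_nat_def edge_nat_def by linarith+
  show "\<exists>e<n_edges w. edge_of w e = (trans_nat w t 1, trans_nat w t 3)"
    using e by (auto simp: edge_of_def trans_nat_def)
qed

lemma valid_owner:
  assumes "valid w" "v < n_verts w"
  shows "input_at w (2 + v) = int (owner_of w v)" "owner_of w v < n_players w"
proof -
  have "0 \<le> input_at w (2 + v) \<and> input_at w (2 + v) < int (n_players w)"
    using assms unfolding valid_def well_formed_def by blast
  then show "input_at w (2 + v) = int (owner_of w v)" "owner_of w v < n_players w"
    unfolding owner_of_def by linarith+
qed

lemma valid_start:
  assumes "valid w"
  shows "input_at w (mid_pos w) = int (start_vert w)" "input_at w (mid_pos w + 2) = int (start_state w)"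
    "start_vert w < n_verts w" "start_state w < n_states w"
proof -
  have "0 \<le> input_at w (mid_pos w) \<and> input_at w (mid_pos w) < int (n_verts w) \<and>
     0 \<le> input_at w (mid_pos w + 2) \<and> input_at w (mid_pos w + 2) < int (n_states w)"
    using assms unfolding valid_def well_formed_def by blast
  then show "input_at w (mid_pos w) = int (start_vert w)" "input_at w (mid_pos w + 2) = int (start_state w)"
    "start_vert w < n_verts w" "start_state w < n_states w"
    unfolding start_vert_def start_state_def by linarith+
qed

text \<open>The innermost loop looks up the edge \<open>e'\<close> on which the transition
  \<open>t'\<close> runs, because rewards are stored under the index of the edge.\<close>

definition split_list :: "int list \<Rightarrow> nat \<Rightarrow> nat \<Rightarrow> ((nat, nat, nat) node \<times> (nat, nat, nat) node \<times> int) list" where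
  "split_list w t e = concat (map (\<lambda>i.
     if owner_of w (edge_nat w e 0) = i \<or> edge_nat w e 1 = trans_nat w t 3
     then concat (map (\<lambda>t'. concat (map (\<lambda>e'.
       if edge_nat w e' 0 = trans_nat w t' 1 \<and> edge_nat w e' 1 = trans_nat w t' 3
       then [(Split i (trans_nat w t 0) (trans_nat w t 1) (trans_nat w t' 0) (trans_nat w t' 1),
              Split i (trans_nat w t 2) (edge_nat w e 1) (trans_nat w t' 2) (trans_nat w t' 3),
              int_reward w i e - int_reward w i e')] else []) [0..<n_edges w])) [0..<n_trans w])
     else []) [0..<n_players w])"

definition edge_list :: "bool \<Rightarrow> int list \<Rightarrow> ((nat, nat, nat) node \<times> (nat, nat, nat) node \<times> int) list" where
  "edge_list any w = concat (map (\<lambda>t. concat (map (\<lambda>e.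
     if edge_nat w e 0 = trans_nat w t 1
     then (if any \<or> edge_nat w e 1 = trans_nat w t 3
           then [(Common (trans_nat w t 0) (trans_nat w t 1), Common (trans_nat w t 2) (edge_nat w e 1), 0)] else []) @
       (if edge_nat w e 1 \<noteq> trans_nat w t 3
        then [(Common (trans_nat w t 0) (trans_nat w t 1), Split (owner_of w (trans_nat w t 1))
               (trans_nat w t 2) (edge_nat w e 1) (trans_nat w t 2) (trans_nat w t 3), 0)] else []) @
       split_list w t e
     else []) [0..<n_edges w])) [0..<n_trans w])"

lemma reward_of_edge:
  assumes "valid w" "e < n_edges w"
  shows "reward_of w i (edge_of w e) = int_reward w i e"
  using edge_index_eq[of w e] well_formed_inj[of w] assms unfolding reward_of_def valid_def by metis

lemma split_list_iff:
  "x \<in> set (split_list w t e) \<longleftrightarrow> (\<exists>i t' e'. i < n_players w \<and> t' < n_trans w \<and> e' < n_edges w \<and>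
     (owner_of w (edge_nat w e 0) = i \<or> edge_nat w e 1 = trans_nat w t 3) \<and>
     edge_nat w e' 0 = trans_nat w t' 1 \<and> edge_nat w e' 1 = trans_nat w t' 3 \<and>
     x = (Split i (trans_nat w t 0) (trans_nat w t 1) (trans_nat w t' 0) (trans_nat w t' 1),
              Split i (trans_nat w t 2) (edge_nat w e 1) (trans_nat w t' 2) (trans_nat w t' 3),
              int_reward w i e - int_reward w i e'))"
proof -
  have "x \<in> set (split_list w t e) \<longleftrightarrow> (\<exists>i<n_players w. \<exists>t'<n_trans w. \<exists>e'<n_edges w.
     (owner_of w (edge_nat w e 0) = i \<or> edge_nat w e 1 = trans_nat w t 3) \<and>
     edge_nat w e' 0 = trans_nat w t' 1 \<and> edge_nat w e' 1 = trans_nat w t' 3 \<and>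
     x = (Split i (trans_nat w t 0) (trans_nat w t 1) (trans_nat w t' 0) (trans_nat w t' 1),
              Split i (trans_nat w t 2) (edge_nat w e 1) (trans_nat w t' 2) (trans_nat w t' 3),
              int_reward w i e - int_reward w i e'))"
    unfolding split_list_def set_concat set_map UN_iff bex_simps set_upt
    by (rule iffI) (fastforce split: if_splits)+
  then show ?thesis by blast
qed

lemma edge_list_iff:
  "x \<in> set (edge_list any w) \<longleftrightarrow> (\<exists>t e. t < n_trans w \<and> e < n_edges w \<and> edge_nat w e 0 = trans_nat w t 1 \<and>
     ((any \<or> edge_nat w e 1 = trans_nat w t 3) \<and>
         x = (Common (trans_nat w t 0) (trans_nat w t 1), Common (trans_nat w t 2) (edge_nat w e 1), 0) \<or>
      edge_nat w e 1 \<noteq> trans_nat w t 3 \<and>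
         x = (Common (trans_nat w t 0) (trans_nat w t 1), Split (owner_of w (trans_nat w t 1))
               (trans_nat w t 2) (edge_nat w e 1) (trans_nat w t 2) (trans_nat w t 3), 0) \<or>
      x \<in> set (split_list w t e)))"
proof
  assume "x \<in> set (edge_list any w)"
  then obtain t e where te: "t \<in> {0..<n_trans w}" "e \<in> {0..<n_edges w}"
    and x: "x \<in> set (if edge_nat w e 0 = trans_nat w t 1
     then (if any \<or> edge_nat w e 1 = trans_nat w t 3
           then [(Common (trans_nat w t 0) (trans_nat w t 1), Common (trans_nat w t 2) (edge_nat w e 1), 0)] else []) @
       (if edge_nat w e 1 \<noteq> trans_nat w t 3
        then [(Common (trans_nat w t 0) (trans_nat w t 1), Split (owner_of w (trans_nat w t 1))
               (trans_nat w t 2) (edge_nat w e 1) (trans_nat w t 2) (trans_nat w t 3), 0)] else []) @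
       split_list w t e
     else [])"
    unfolding edge_list_def set_concat set_map UN_iff bex_simps set_upt by (elim bexE)
  then show "\<exists>t e. t < n_trans w \<and> e < n_edges w \<and> edge_nat w e 0 = trans_nat w t 1 \<and>
     ((any \<or> edge_nat w e 1 = trans_nat w t 3) \<and>
         x = (Common (trans_nat w t 0) (trans_nat w t 1), Common (trans_nat w t 2) (edge_nat w e 1), 0) \<or>
      edge_nat w e 1 \<noteq> trans_nat w t 3 \<and>
         x = (Common (trans_nat w t 0) (trans_nat w t 1), Split (owner_of w (trans_nat w t 1))
               (trans_nat w t 2) (edge_nat w e 1) (trans_nat w t 2) (trans_nat w t 3), 0) \<or>
      x \<in> set (split_list w t e))"
    by (intro exI[of _ t] exI[of _ e]) (auto split: if_splits)
next
  assume "\<exists>t e. t < n_trans w \<and> e < n_edges w \<and> edge_nat w e 0 = trans_nat w t 1 \<and>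
     ((any \<or> edge_nat w e 1 = trans_nat w t 3) \<and>
         x = (Common (trans_nat w t 0) (trans_nat w t 1), Common (trans_nat w t 2) (edge_nat w e 1), 0) \<or>
      edge_nat w e 1 \<noteq> trans_nat w t 3 \<and>
         x = (Common (trans_nat w t 0) (trans_nat w t 1), Split (owner_of w (trans_nat w t 1))
               (trans_nat w t 2) (edge_nat w e 1) (trans_nat w t 2) (trans_nat w t 3), 0) \<or>
      x \<in> set (split_list w t e))"
  then obtain t e where te: "t < n_trans w" "e < n_edges w" "edge_nat w e 0 = trans_nat w t 1"
    and x: "(any \<or> edge_nat w e 1 = trans_nat w t 3) \<and>
         x = (Common (trans_nat w t 0) (trans_nat w t 1), Common (trans_nat w t 2) (edge_nat w e 1), 0) \<or>
      edge_nat w e 1 \<noteq> trans_nat w t 3 \<and>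
         x = (Common (trans_nat w t 0) (trans_nat w t 1), Split (owner_of w (trans_nat w t 1))
               (trans_nat w t 2) (edge_nat w e 1) (trans_nat w t 2) (trans_nat w t 3), 0) \<or>
      x \<in> set (split_list w t e)" by blast
  show "x \<in> set (edge_list any w)"
    unfolding edge_list_def set_concat set_map UN_iff bex_simps set_upt
    by (rule bexI[of _ t], rule bexI[of _ e]) (use te x in auto)
qed

text \<open>\<open>bellman_ford\<close> depends on the list only through its set, so order and
  repetitions in the enumeration are immaterial.\<close>

lemma set_edge_list:
  assumes v: "valid w"
  shows "set (edge_list any w) = code_graph any w"
proof
  let ?T = "trans_of w ` {..<n_trans w}" and ?E = "edge_of w ` {..<n_edges w}"
  have T: "(trans_nat w t 0, trans_nat w t 1, trans_nat w t 2, trans_nat w t 3) \<in> ?T" if "t < n_trans w" for t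
    using that unfolding trans_of_nat[symmetric] by simp
  have E: "(edge_nat w e 0, edge_nat w e 1) \<in> ?E" if "e < n_edges w" for e
    using that unfolding edge_of_nat[symmetric] by simp
  have R: "reward_of w i (edge_nat w e 0, edge_nat w e 1) = int_reward w i e" if "e < n_edges w" for i e
    using reward_of_edge[OF v that, of i] by (simp add: edge_of_nat)
  show "set (edge_list any w) \<subseteq> code_graph any w"
  proof
    fix x assume "x \<in> set (edge_list any w)"
    then obtain t e where te: "t < n_trans w" "e < n_edges w" "edge_nat w e 0 = trans_nat w t 1"
      and x: "(any \<or> edge_nat w e 1 = trans_nat w t 3) \<and>
         x = (Common (trans_nat w t 0) (trans_nat w t 1), Common (trans_nat w t 2) (edge_nat w e 1), 0) \<or>
      edge_nat w e 1 \<noteq> trans_nat w t 3 \<and>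
         x = (Common (trans_nat w t 0) (trans_nat w t 1), Split (owner_of w (trans_nat w t 1))
               (trans_nat w t 2) (edge_nat w e 1) (trans_nat w t 2) (trans_nat w t 3), 0) \<or>
      x \<in> set (split_list w t e)" unfolding edge_list_iff by blast
    have Ee: "(trans_nat w t 1, edge_nat w e 1) \<in> ?E" using E[OF te(2)] te(3) by simp
    from x show "x \<in> code_graph any w"
    proof (elim disjE conjE)
      assume "x \<in> set (split_list w t e)"
      then obtain i t' e' where s: "i < n_players w" "t' < n_trans w" "e' < n_edges w"
        "owner_of w (edge_nat w e 0) = i \<or> edge_nat w e 1 = trans_nat w t 3"
        "edge_nat w e' 0 = trans_nat w t' 1" "edge_nat w e' 1 = trans_nat w t' 3" and
        x: "x = (Split i (trans_nat w t 0) (trans_nat w t 1) (trans_nat w t' 0) (trans_nat w t' 1),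
              Split i (trans_nat w t 2) (edge_nat w e 1) (trans_nat w t' 2) (trans_nat w t' 3),
              int_reward w i e - int_reward w i e')" unfolding split_list_iff by blast
      have "(Split i (trans_nat w t 0) (trans_nat w t 1) (trans_nat w t' 0) (trans_nat w t' 1),
              Split i (trans_nat w t 2) (edge_nat w e 1) (trans_nat w t' 2) (trans_nat w t' 3),
              reward_of w i (trans_nat w t 1, edge_nat w e 1) - reward_of w i (trans_nat w t' 1, trans_nat w t' 3))
          \<in> code_graph any w"
        unfolding code_graph_def
        by (rule deviation_graph.split[OF _ T[OF te(1)] Ee _ T[OF s(2)]]) (use s te(3) in auto)
      then show ?thesis unfolding x using R[OF te(2), of i] R[OF s(3), of i] te(3) s(5,6) by simp
    qed (use T[OF te(1)] Ee in \<open>auto simp: code_graph_def intro: deviation_graph.common deviation_graph.deviate\<close>)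
  qed
  show "code_graph any w \<subseteq> set (edge_list any w)"
  proof
    fix x assume "x \<in> code_graph any w"
    moreover obtain y z c where x: "x = (y, z, c)" by (cases x)
    ultimately have "(y, z, c) \<in> deviation_graph any {..<n_players w} (owner_of w) ?E ?T (reward_of w)"
      by (simp add: code_graph_def)
    then show "x \<in> set (edge_list any w)"
    proof (cases rule: deviation_graph.cases)
      case (common q v q' u u')
      then obtain t e where "t < n_trans w" "trans_of w t = (q, v, q', u)" "e < n_edges w" "edge_of w e = (v, u')" by auto
      with common show ?thesis unfolding edge_list_iff x
        by (intro exI[of _ t] exI[of _ e]) (simp add: trans_of_nat edge_of_nat)
    next
      case (deviate q v q' u u')
      then obtain t e where "t < n_trans w" "trans_of w t = (q, v, q', u)" "e < n_edges w" "edge_of w e = (v, u')" by auto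
      with deviate show ?thesis unfolding edge_list_iff x
        by (intro exI[of _ t] exI[of _ e]) (simp add: trans_of_nat edge_of_nat)
    next
      case (split i p u p' z' u' q v q' v')
      then obtain t e t' where te: "t < n_trans w" "trans_of w t = (p, u, p', z')" "e < n_edges w" "edge_of w e = (u, u')"
        "t' < n_trans w" "trans_of w t' = (q, v, q', v')" by auto
      \<comment> \<open>In the graph the compatible play moves by a transition alone; validity
        provides the edge that carries its reward.\<close>
      from valid_trans(9)[OF assms te(5)] te(6) obtain e' where e': "e' < n_edges w" "edge_of w e' = (v, v')"
        by (auto simp: trans_of_nat)
      have "x \<in> set (split_list w t e)"
        unfolding split_list_iff x
        by (rule exI[of _ i], rule exI[of _ t'], rule exI[of _ e'])
           (use split te e' reward_of_edge[OF assms te(3), of i] reward_of_edge[OF assms e'(1), of i]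
            in \<open>simp add: trans_of_nat edge_of_nat\<close>)
      with te show ?thesis unfolding edge_list_iff
        by (intro exI[of _ t] exI[of _ e]) (simp add: trans_of_nat edge_of_nat)
    qed
  qed
qed

lemma edge_list_nodes:
  assumes "valid w"
  shows "set (edge_list any w) \<subseteq> code_nodes w \<times> code_nodes w \<times> UNIV"
proof
  fix x assume "x \<in> set (edge_list any w)"
  then obtain t e where te: "t < n_trans w" "e < n_edges w" and
    x: "(any \<or> edge_nat w e 1 = trans_nat w t 3) \<and>
         x = (Common (trans_nat w t 0) (trans_nat w t 1), Common (trans_nat w t 2) (edge_nat w e 1), 0) \<or>
      edge_nat w e 1 \<noteq> trans_nat w t 3 \<and>
         x = (Common (trans_nat w t 0) (trans_nat w t 1), Split (owner_of w (trans_nat w t 1))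
               (trans_nat w t 2) (edge_nat w e 1) (trans_nat w t 2) (trans_nat w t 3), 0) \<or>
      x \<in> set (split_list w t e)" unfolding edge_list_iff by blast
  note v = valid_trans(5-8)[OF assms te(1)] valid_edge(4)[OF assms te(2)]
  from x show "x \<in> code_nodes w \<times> code_nodes w \<times> UNIV"
  proof (elim disjE conjE)
    assume "x \<in> set (split_list w t e)"
    then obtain i t' e' where "i < n_players w" "t' < n_trans w"
        "x = (Split i (trans_nat w t 0) (trans_nat w t 1) (trans_nat w t' 0) (trans_nat w t' 1),
              Split i (trans_nat w t 2) (edge_nat w e 1) (trans_nat w t' 2) (trans_nat w t' 3),
              int_reward w i e - int_reward w i e')" unfolding split_list_iff by blast
    with v valid_trans(5-8)[OF assms this(2)] show ?thesis by (simp add: code_nodes_def)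
  qed (use v valid_owner(2)[OF assms v(2)] in \<open>auto simp: code_nodes_def\<close>)
qed

text \<open>From here on, fields are rewritten to images of natural numbers, the form in which they
  enter vertex indices.\<close>

declare aval_field_numerals [simp del] aval_edge_numerals [simp del] aval_OwnerField [simp del]

section \<open>Commands for the three kinds of edges\<close>

definition common_com :: com where
  "common_com = edge_com (put_common 24 (TransField 12 0) (TransField 12 1))
     (put_common 25 (TransField 12 2) (EdgeField 11 (Num 1))) (Num 0)"
definition deviate_com :: com where
  "deviate_com = edge_com (put_common 24 (TransField 12 0) (TransField 12 1))
     (put_split 25 (OwnerField (TransField 12 1)) (TransField 12 2) (EdgeField 11 (Num 1)) (TransField 12 2) (TransField 12 3))
     (Num 0)"
definition split_com :: com where
  "split_com = ForB 10 1 (Cond (Disj (Eq (OwnerField (EdgeField 11 (Num 0))) (Var 10)) (Eq (EdgeField 11 (Num 1)) (TransField 12 3)))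
     (ForB 14 7 (ForB 13 3 (Cond (Conj (Eq (EdgeField 13 (Num 0)) (TransField 14 1)) (Eq (EdgeField 13 (Num 1)) (TransField 14 3)))
       (edge_com (put_split 24 (Var 10) (TransField 12 0) (TransField 12 1) (TransField 14 0) (TransField 14 1))
         (put_split 25 (Var 10) (TransField 12 2) (EdgeField 11 (Num 1)) (TransField 14 2) (TransField 14 3))
         (Minus (Arr Rewards (Plus (Times 10 3) (Var 11))) (Arr Rewards (Plus (Times 10 3) (Var 13))))) Skip))) Skip)"
definition graph_com :: "bool \<Rightarrow> com" where
  "graph_com any = ForB 12 7 (ForB 11 3 (Cond (Eq (EdgeField 11 (Num 0)) (TransField 12 1))
     (Seq (Cond (if any then Num 1 else Eq (EdgeField 11 (Num 1)) (TransField 12 3)) common_com Skip)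
     (Seq (Cond (Neg (Eq (EdgeField 11 (Num 1)) (TransField 12 3))) deviate_com Skip) split_com)) Skip))"

lemma aval_trans_nat:
  assumes "valid w" "params w v" "v x = int t" "t < n_trans w"
  shows "aval w N a (TransField x 0) v = int (trans_nat w t 0)"
    "aval w N a (TransField x 1) v = int (trans_nat w t 1)"
    "aval w N a (TransField x 2) v = int (trans_nat w t 2)"
    "aval w N a (TransField x 3) v = int (trans_nat w t 3)"
    "aval w N a (OwnerField (TransField x 1)) v = int (owner_of w (trans_nat w t 1))"
proof -
  show *: "aval w N a (TransField x 0) v = int (trans_nat w t 0)"
    "aval w N a (TransField x 1) v = int (trans_nat w t 1)"
    "aval w N a (TransField x 2) v = int (trans_nat w t 2)"
    "aval w N a (TransField x 3) v = int (trans_nat w t 3)"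
    unfolding aval_field_numerals[OF assms(2,3)] by (rule valid_trans(1-4)[OF assms(1,4)])+
  show "aval w N a (OwnerField (TransField x 1)) v = int (owner_of w (trans_nat w t 1))"
    unfolding aval_OwnerField[OF *(2)] by (rule valid_owner(1)[OF assms(1) valid_trans(6)[OF assms(1,4)]])
qed

lemma aval_edge_nat:
  assumes "valid w" "fits w N" "params w v" "v x = int e" "e < n_edges w" "x \<noteq> 0"
  shows "aval w N a (EdgeField x (Num 0)) v = int (edge_nat w e 0)"
    "aval w N a (EdgeField x (Num 1)) v = int (edge_nat w e 1)"
    "aval w N a (OwnerField (EdgeField x (Num 0))) v = int (owner_of w (edge_nat w e 0))"
proof -
  show *: "aval w N a (EdgeField x (Num 0)) v = int (edge_nat w e 0)"
    "aval w N a (EdgeField x (Num 1)) v = int (edge_nat w e 1)"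
    unfolding aval_edge_numerals[OF assms(3,2,4-6)] by (rule valid_edge(1,2)[OF assms(1,5)])+
  show "aval w N a (OwnerField (EdgeField x (Num 0))) v = int (owner_of w (edge_nat w e 0))"
    unfolding aval_OwnerField[OF *(1)] by (rule valid_owner(1)[OF assms(1) valid_edge(3)[OF assms(1,5)]])
qed

lemma sim_common:
  assumes v: "valid w" "fits w N" and t: "t < n_trans w" "e < n_edges w"
    and s: "sim w [(11, int e), (12, int t)] s D"
  shows "sim w [(11, int e), (12, int t)] (exec w N common_com s) (fold relax
    [(Common (trans_nat w t 0) (trans_nat w t 1), Common (trans_nat w t 2) (edge_nat w e 1), 0)] D)"
proof -
  obtain u a where ua: "s = (u, a)" by (cases s)
  have p: "params w u" "u 12 = int t" "u 11 = int e" using s by (simp_all add: ua sim_def)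
  note tv = aval_trans_nat[OF v(1) _ _ t(1), where x = 12] and ev = aval_edge_nat[OF v _ _ t(2), where x = 11]
  note vt = valid_trans(5-8)[OF v(1) t(1)] and ve = valid_edge(4)[OF v(1) t(2)]
  show ?thesis
    unfolding ua common_com_def
  proof (rule sim_edge[OF s[unfolded ua]])
    show "exec w N (put_common 24 (TransField 12 0) (TransField 12 1)) (u, a) =
      (u(24 := int (node_index w (Common (trans_nat w t 0) (trans_nat w t 1)))), a)"
      by (rule put_common[OF p(1) v(2)]) (simp_all add: tv p)
    show "exec w N (put_common 25 (TransField 12 2) (EdgeField 11 (Num 1)))
       (u(24 := int (node_index w (Common (trans_nat w t 0) (trans_nat w t 1)))), a) =
      (u(24 := int (node_index w (Common (trans_nat w t 0) (trans_nat w t 1))),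
         25 := int (node_index w (Common (trans_nat w t 2) (edge_nat w e 1)))), a)"
      by (rule put_common[OF _ v(2)]) (simp_all add: tv ev p)
  qed (use vt ve in \<open>auto simp: code_nodes_def\<close>)
qed

lemma sim_deviate:
  assumes v: "valid w" "fits w N" and t: "t < n_trans w" "e < n_edges w"
    and s: "sim w [(11, int e), (12, int t)] s D"
  shows "sim w [(11, int e), (12, int t)] (exec w N deviate_com s) (fold relax
    [(Common (trans_nat w t 0) (trans_nat w t 1), Split (owner_of w (trans_nat w t 1))
       (trans_nat w t 2) (edge_nat w e 1) (trans_nat w t 2) (trans_nat w t 3), 0)] D)"
proof -
  obtain u a where ua: "s = (u, a)" by (cases s)
  have p: "params w u" "u 12 = int t" "u 11 = int e" using s by (simp_all add: ua sim_def)
  note tv = aval_trans_nat[OF v(1) _ _ t(1), where x = 12] and ev = aval_edge_nat[OF v _ _ t(2), where x = 11]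
  note vt = valid_trans(5-8)[OF v(1) t(1)] and ve = valid_edge(4)[OF v(1) t(2)]
  note vo = valid_owner(2)[OF v(1) vt(2)]
  show ?thesis
    unfolding ua deviate_com_def
  proof (rule sim_edge[OF s[unfolded ua]])
    show "exec w N (put_common 24 (TransField 12 0) (TransField 12 1)) (u, a) =
      (u(24 := int (node_index w (Common (trans_nat w t 0) (trans_nat w t 1)))), a)"
      by (rule put_common[OF p(1) v(2)]) (simp_all add: tv p)
    show "exec w N (put_split 25 (OwnerField (TransField 12 1)) (TransField 12 2) (EdgeField 11 (Num 1)) (TransField 12 2) (TransField 12 3))
       (u(24 := int (node_index w (Common (trans_nat w t 0) (trans_nat w t 1)))), a) =
      (u(24 := int (node_index w (Common (trans_nat w t 0) (trans_nat w t 1))),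
         25 := int (node_index w (Split (owner_of w (trans_nat w t 1))
           (trans_nat w t 2) (edge_nat w e 1) (trans_nat w t 2) (trans_nat w t 3)))), a)"
      by (rule put_split[OF _ v(2)]) (simp_all add: tv ev p)
  qed (use vt ve vo in \<open>auto simp: code_nodes_def\<close>)
qed

lemma sim_split:
  assumes v: "valid w" "fits w N" and t: "t < n_trans w" "e < n_edges w"
    and s: "sim w [(11, int e), (12, int t)] s D"
  shows "sim w [(11, int e), (12, int t)] (exec w N split_com s) (fold relax (split_list w t e) D)"
  unfolding split_com_def split_list_def
proof (rule sim_ForB[OF s])
  note f = v(2)[unfolded fits_def]
  note tv = aval_trans_nat[OF v(1) _ _ t(1), where x = 12] and ev = aval_edge_nat[OF v _ _ t(2), where x = 11]
  note vt = valid_trans(5-8)[OF v(1) t(1)] and ve = valid_edge(4)[OF v(1) t(2)]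
  fix i s D assume i: "i < n_players w" and s: "sim w [(10, int i), (11, int e), (12, int t)] s D"
  show "sim w [(10, int i), (11, int e), (12, int t)]
    (exec w N (Cond (Disj (Eq (OwnerField (EdgeField 11 (Num 0))) (Var 10)) (Eq (EdgeField 11 (Num 1)) (TransField 12 3)))
     (ForB 14 7 (ForB 13 3 (Cond (Conj (Eq (EdgeField 13 (Num 0)) (TransField 14 1)) (Eq (EdgeField 13 (Num 1)) (TransField 14 3)))
       (edge_com (put_split 24 (Var 10) (TransField 12 0) (TransField 12 1) (TransField 14 0) (TransField 14 1))
         (put_split 25 (Var 10) (TransField 12 2) (EdgeField 11 (Num 1)) (TransField 14 2) (TransField 14 3))
         (Minus (Arr Rewards (Plus (Times 10 3) (Var 11))) (Arr Rewards (Plus (Times 10 3) (Var 13))))) Skip))) Skip) s)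
    (fold relax (if owner_of w (edge_nat w e 0) = i \<or> edge_nat w e 1 = trans_nat w t 3
     then concat (map (\<lambda>t'. concat (map (\<lambda>e'.
       if edge_nat w e' 0 = trans_nat w t' 1 \<and> edge_nat w e' 1 = trans_nat w t' 3
       then [(Split i (trans_nat w t 0) (trans_nat w t 1) (trans_nat w t' 0) (trans_nat w t' 1),
              Split i (trans_nat w t 2) (edge_nat w e 1) (trans_nat w t' 2) (trans_nat w t' 3),
              int_reward w i e - int_reward w i e')] else []) [0..<n_edges w])) [0..<n_trans w])
     else []) D)"
  proof (rule sim_If[OF s])
    show "0 < aval w N a (Disj (Eq (OwnerField (EdgeField 11 (Num 0))) (Var 10)) (Eq (EdgeField 11 (Num 1)) (TransField 12 3))) u \<longleftrightarrow>
        (owner_of w (edge_nat w e 0) = i \<or> edge_nat w e 1 = trans_nat w t 3)"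
      if "sim w [(10, int i), (11, int e), (12, int t)] (u, a) D" for u a
      using that by (simp add: sim_def tv ev)
  next
    fix s assume s: "sim w [(10, int i), (11, int e), (12, int t)] s D"
    show "sim w [(10, int i), (11, int e), (12, int t)]
      (exec w N (ForB 14 7 (ForB 13 3 (Cond (Conj (Eq (EdgeField 13 (Num 0)) (TransField 14 1)) (Eq (EdgeField 13 (Num 1)) (TransField 14 3)))
       (edge_com (put_split 24 (Var 10) (TransField 12 0) (TransField 12 1) (TransField 14 0) (TransField 14 1))
         (put_split 25 (Var 10) (TransField 12 2) (EdgeField 11 (Num 1)) (TransField 14 2) (TransField 14 3))
         (Minus (Arr Rewards (Plus (Times 10 3) (Var 11))) (Arr Rewards (Plus (Times 10 3) (Var 13))))) Skip))) s)
      (fold relax (concat (map (\<lambda>t'. concat (map (\<lambda>e'.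
       if edge_nat w e' 0 = trans_nat w t' 1 \<and> edge_nat w e' 1 = trans_nat w t' 3
       then [(Split i (trans_nat w t 0) (trans_nat w t 1) (trans_nat w t' 0) (trans_nat w t' 1),
              Split i (trans_nat w t 2) (edge_nat w e 1) (trans_nat w t' 2) (trans_nat w t' 3),
              int_reward w i e - int_reward w i e')] else []) [0..<n_edges w])) [0..<n_trans w])) D)"
    proof (rule sim_ForB[OF s])
      fix t' s D assume t': "t' < n_trans w" and s: "sim w [(14, int t'), (10, int i), (11, int e), (12, int t)] s D"
      show "sim w [(14, int t'), (10, int i), (11, int e), (12, int t)]
        (exec w N (ForB 13 3 (Cond (Conj (Eq (EdgeField 13 (Num 0)) (TransField 14 1)) (Eq (EdgeField 13 (Num 1)) (TransField 14 3)))
         (edge_com (put_split 24 (Var 10) (TransField 12 0) (TransField 12 1) (TransField 14 0) (TransField 14 1))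
         (put_split 25 (Var 10) (TransField 12 2) (EdgeField 11 (Num 1)) (TransField 14 2) (TransField 14 3))
         (Minus (Arr Rewards (Plus (Times 10 3) (Var 11))) (Arr Rewards (Plus (Times 10 3) (Var 13))))) Skip)) s)
        (fold relax (concat (map (\<lambda>e'.
           if edge_nat w e' 0 = trans_nat w t' 1 \<and> edge_nat w e' 1 = trans_nat w t' 3
           then [(Split i (trans_nat w t 0) (trans_nat w t 1) (trans_nat w t' 0) (trans_nat w t' 1),
              Split i (trans_nat w t 2) (edge_nat w e 1) (trans_nat w t' 2) (trans_nat w t' 3),
              int_reward w i e - int_reward w i e')] else []) [0..<n_edges w])) D)"
      proof (rule sim_ForB[OF s])
        fix e' s D assume e': "e' < n_edges w"
          and s: "sim w [(13, int e'), (14, int t'), (10, int i), (11, int e), (12, int t)] s D"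
        note tv' = aval_trans_nat[OF v(1) _ _ t', where x = 14] and ev' = aval_edge_nat[OF v _ _ e', where x = 13]
        note vt' = valid_trans(5-8)[OF v(1) t']
        let ?L = "[(13, int e'), (14, int t'), (10, int i), (11, int e), (12, int t)]"
        let ?x = "Split i (trans_nat w t 0) (trans_nat w t 1) (trans_nat w t' 0) (trans_nat w t' 1)"
        let ?y = "Split i (trans_nat w t 2) (edge_nat w e 1) (trans_nat w t' 2) (trans_nat w t' 3)"
        show "sim w ?L
          (exec w N (Cond (Conj (Eq (EdgeField 13 (Num 0)) (TransField 14 1)) (Eq (EdgeField 13 (Num 1)) (TransField 14 3)))
           (edge_com (put_split 24 (Var 10) (TransField 12 0) (TransField 12 1) (TransField 14 0) (TransField 14 1))
           (put_split 25 (Var 10) (TransField 12 2) (EdgeField 11 (Num 1)) (TransField 14 2) (TransField 14 3))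
           (Minus (Arr Rewards (Plus (Times 10 3) (Var 11))) (Arr Rewards (Plus (Times 10 3) (Var 13))))) Skip) s)
          (fold relax (if edge_nat w e' 0 = trans_nat w t' 1 \<and> edge_nat w e' 1 = trans_nat w t' 3
             then [(?x, ?y, int_reward w i e - int_reward w i e')] else []) D)"
        proof (rule sim_If[OF s])
          show "0 < aval w N a (Conj (Eq (EdgeField 13 (Num 0)) (TransField 14 1)) (Eq (EdgeField 13 (Num 1)) (TransField 14 3))) u \<longleftrightarrow>
            edge_nat w e' 0 = trans_nat w t' 1 \<and> edge_nat w e' 1 = trans_nat w t' 3" if "sim w ?L (u, a) D" for u a
            using that by (simp add: sim_def tv' ev')
        next
          fix s assume s: "sim w ?L s D"
          obtain u a where ua: "s = (u, a)" by (cases s)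
          have p: "params w u" "u 12 = int t" "u 11 = int e" "u 10 = int i" "u 14 = int t'" "u 13 = int e'"
            and rt: "reward_table w a"
            using s by (simp_all add: ua sim_def)
          have tm: "aval w N a (Times 10 3) u' = int i * int (n_edges w)" if "params w u'" "u' 10 = int i" for u'
            using aval_Times[of 10 3 u' i N w a] that i f by (simp add: paramsD)
          have pos: "nat (int i * int (n_edges w) + int b) = i * n_edges w + b" for b
            by (simp add: nat_add_distrib nat_mult_distrib)
          have rw: "a Rewards (i * n_edges w + b) = int_reward w i b" if "b < n_edges w" for b
            using rt i that by (simp add: reward_table_def)
          show "sim w ?L (exec w N (edge_com
             (put_split 24 (Var 10) (TransField 12 0) (TransField 12 1) (TransField 14 0) (TransField 14 1))
             (put_split 25 (Var 10) (TransField 12 2) (EdgeField 11 (Num 1)) (TransField 14 2) (TransField 14 3))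
             (Minus (Arr Rewards (Plus (Times 10 3) (Var 11))) (Arr Rewards (Plus (Times 10 3) (Var 13))))) s)
            (fold relax [(?x, ?y, int_reward w i e - int_reward w i e')] D)"
            unfolding ua
          proof (rule sim_edge[OF s[unfolded ua]])
            show "exec w N (put_split 24 (Var 10) (TransField 12 0) (TransField 12 1) (TransField 14 0) (TransField 14 1)) (u, a) =
              (u(24 := int (node_index w ?x)), a)"
              by (rule put_split[OF p(1) v(2)]) (simp_all add: tv tv' p)
            show "exec w N (put_split 25 (Var 10) (TransField 12 2) (EdgeField 11 (Num 1)) (TransField 14 2) (TransField 14 3))
                (u(24 := int (node_index w ?x)), a) =
              (u(24 := int (node_index w ?x), 25 := int (node_index w ?y)), a)"
              by (rule put_split[OF _ v(2)]) (simp_all add: tv tv' ev p)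
            show "aval w N a (Minus (Arr Rewards (Plus (Times 10 3) (Var 11))) (Arr Rewards (Plus (Times 10 3) (Var 13))))
              (u(24 := int (node_index w ?x), 25 := int (node_index w ?y))) = int_reward w i e - int_reward w i e'"
              using p by (simp add: tm pos rw t(2) e' del: aval_Times)
          qed (use vt vt' ve i in \<open>auto simp: code_nodes_def\<close>)
        qed
      qed (use f in \<open>auto simp: paramsD\<close>)
    qed (use f in \<open>auto simp: paramsD\<close>)
  qed
qed (use v(2)[unfolded fits_def] in \<open>auto simp: paramsD\<close>)

lemma sim_graph:
  assumes v: "valid w" "fits w N" and s: "sim w [] s D"
  shows "sim w [] (exec w N (graph_com any) s) (fold relax (edge_list any w) D)"
  unfolding graph_com_def edge_list_def
proof (rule sim_ForB[OF s])
  note f = v(2)[unfolded fits_def]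
  fix t s D assume t: "t < n_trans w" and s: "sim w [(12, int t)] s D"
  note tv = aval_trans_nat[OF v(1) _ _ t, where x = 12]
  show "sim w [(12, int t)] (exec w N (ForB 11 3 (Cond (Eq (EdgeField 11 (Num 0)) (TransField 12 1))
     (Seq (Cond (if any then Num 1 else Eq (EdgeField 11 (Num 1)) (TransField 12 3)) common_com Skip)
     (Seq (Cond (Neg (Eq (EdgeField 11 (Num 1)) (TransField 12 3))) deviate_com Skip) split_com)) Skip)) s)
    (fold relax (concat (map (\<lambda>e.
     if edge_nat w e 0 = trans_nat w t 1
     then (if any \<or> edge_nat w e 1 = trans_nat w t 3
           then [(Common (trans_nat w t 0) (trans_nat w t 1), Common (trans_nat w t 2) (edge_nat w e 1), 0)] else []) @
       (if edge_nat w e 1 \<noteq> trans_nat w t 3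
        then [(Common (trans_nat w t 0) (trans_nat w t 1), Split (owner_of w (trans_nat w t 1))
               (trans_nat w t 2) (edge_nat w e 1) (trans_nat w t 2) (trans_nat w t 3), 0)] else []) @
       split_list w t e
     else []) [0..<n_edges w])) D)"
  proof (rule sim_ForB[OF s])
    fix e s D assume e: "e < n_edges w" and s: "sim w [(11, int e), (12, int t)] s D"
    note ev = aval_edge_nat[OF v _ _ e, where x = 11]
    let ?L = "[(11, int e), (12, int t)]"
    let ?cs = "if any \<or> edge_nat w e 1 = trans_nat w t 3
           then [(Common (trans_nat w t 0) (trans_nat w t 1), Common (trans_nat w t 2) (edge_nat w e 1), 0)] else []"
    let ?ds = "if edge_nat w e 1 \<noteq> trans_nat w t 3
        then [(Common (trans_nat w t 0) (trans_nat w t 1), Split (owner_of w (trans_nat w t 1))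
               (trans_nat w t 2) (edge_nat w e 1) (trans_nat w t 2) (trans_nat w t 3), 0)] else []"
    show "sim w ?L (exec w N (Cond (Eq (EdgeField 11 (Num 0)) (TransField 12 1))
      (Seq (Cond (if any then Num 1 else Eq (EdgeField 11 (Num 1)) (TransField 12 3)) common_com Skip)
      (Seq (Cond (Neg (Eq (EdgeField 11 (Num 1)) (TransField 12 3))) deviate_com Skip) split_com)) Skip) s)
      (fold relax (if edge_nat w e 0 = trans_nat w t 1 then ?cs @ ?ds @ split_list w t e else []) D)"
    proof (rule sim_If[OF s])
      show "0 < aval w N a (Eq (EdgeField 11 (Num 0)) (TransField 12 1)) u \<longleftrightarrow> edge_nat w e 0 = trans_nat w t 1"
        if "sim w ?L (u, a) D" for u a
        using that by (simp add: sim_def tv ev)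
    next
      fix s assume s: "sim w ?L s D"
      show "sim w ?L (exec w N (Seq (Cond (if any then Num 1 else Eq (EdgeField 11 (Num 1)) (TransField 12 3)) common_com Skip)
        (Seq (Cond (Neg (Eq (EdgeField 11 (Num 1)) (TransField 12 3))) deviate_com Skip) split_com)) s)
        (fold relax (?cs @ ?ds @ split_list w t e) D)"
      proof (rule sim_Seq)
        show "sim w ?L (exec w N (Cond (if any then Num 1 else Eq (EdgeField 11 (Num 1)) (TransField 12 3)) common_com Skip) s)
          (fold relax ?cs D)"
          by (rule sim_If[OF s _ sim_common[OF v t e]]) (simp add: sim_def tv ev)
        fix s D assume s: "sim w ?L s D"
        show "sim w ?L (exec w N (Seq (Cond (Neg (Eq (EdgeField 11 (Num 1)) (TransField 12 3))) deviate_com Skip) split_com) s)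
          (fold relax (?ds @ split_list w t e) D)"
        proof (rule sim_Seq[OF _ sim_split[OF v t e]])
          show "sim w ?L (exec w N (Cond (Neg (Eq (EdgeField 11 (Num 1)) (TransField 12 3))) deviate_com Skip) s)
            (fold relax ?ds D)"
            by (rule sim_If[OF s _ sim_deviate[OF v t e]]) (simp add: sim_def tv ev)
        qed
      qed
    qed
  qed (use f in \<open>auto simp: paramsD\<close>)
qed (use v(2)[unfolded fits_def] in \<open>auto simp: paramsD\<close>)

section \<open>Rounds, search and the complete program\<close>

definition round_com :: "bool \<Rightarrow> com" where
  "round_com any = Seq (Assign 27 (Num 0)) (graph_com any)"

lemma sim_round:
  assumes "valid w" "fits w N" "sim w [] s D"
  shows "sim w [] (exec w N (round_com any) s) (bf_round (edge_list any w) D)"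
proof -
  have "sim w [] ((fst s)(27 := 0), snd s) (fst D, False)"
    using assms(3) by (simp add: sim_def)
  from sim_graph[OF assms(1,2) this, of any] show ?thesis
    by (simp add: round_com_def bf_round_def)
qed

text \<open>The number of rounds is fixed in advance and no loop is left early. The loop variables
  occur nowhere else: each level merely multiplies the number of rounds by \<open>N\<close>.\<close>

definition search_com :: "bool \<Rightarrow> com" where
  "search_com any = For 30 (For 31 (For 32 (For 33 (For 34 (For 35 (round_com any))))))"

lemma sim_search:
  assumes "valid w" "fits w N" "sim w [] s D"
  shows "sim w [] (exec w N (search_com any) s) ((bf_round (edge_list any w) ^^ (N ^ 6)) D)"
proof -
  let ?f = "bf_round (edge_list any w)"
  have it: "sim w [] (exec w N (For x c) s) ((?f ^^ (k * N)) D)"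
    if "\<And>s D. sim w [] s D \<Longrightarrow> sim w [] (exec w N c s) ((?f ^^ k) D)" "sim w [] s D" "10 \<le> x" "x \<noteq> 27" for x c k s D
    using sim_For_iterate[OF that(2), of N c "?f ^^ k" x] that(1,3,4) by (simp add: funpow_mult)
  have "sim w [] (exec w N (search_com any) s) ((?f ^^ (1 * N * N * N * N * N * N)) D)"
    unfolding search_com_def
    by (intro it assms(3)) (use sim_round[OF assms(1,2)] in simp_all)
  then show ?thesis by (simp add: eval_nat_numeral mult.assoc)
qed

definition start_com :: com where
  "start_com = Seq (put_common 24 (Inp (Plus (Var 5) (Num 2))) (Inp (Var 5))) (Put Mark (Var 24) (Num 1))"
definition main_com :: "bool \<Rightarrow> com" where
  "main_com any = Seq pow_com (Seq reward_com (Seq start_com (Seq (search_com any)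
     (Assign 0 (Ite (Var 27) (Num 0) (Num 1))))))"

lemma main_com:
  assumes v: "valid w" and p: "params w u" and a: "a Mark = (\<lambda>_. 0)" "a Dist = (\<lambda>_. 0)"
    and N: "N = input_size w"
  shows "0 < fst (exec w N (main_com any) (u, a)) 0 \<longleftrightarrow> \<not> positive_code any w"
proof -
  let ?s = "Common (start_state w) (start_vert w)"
  have ws: "well_shaped w" using v by (simp add: valid_def)
  have lN: "length w \<le> N" using length_le_input_size N by simp
  have f: "fits w N" using well_shaped_fits[OF ws lN] .
  have "3 \<le> N" using well_shaped_le(2)[OF ws] lN by simp
  obtain u1 a1 where 1: "exec w N pow_com (u, a) = (u1, a1)" "params w u1" "powers N a1" "a1 Mark = (\<lambda>_. 0)" "a1 Dist = (\<lambda>_. 0)"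
    using pow_com[OF p, of N a] a by auto
  have den: "0 < den_of w i e" if "i < n_players w" "e < n_edges w" for i e
    using v that unfolding valid_def well_formed_def by blast
  obtain u2 a2 where 2: "exec w N reward_com (u1, a1) = (u2, a2)" "params w u2" "reward_table w a2"
      "a2 Mark = (\<lambda>_. 0)" "a2 Dist = (\<lambda>_. 0)"
    using reward_com[OF 1(2) f N 1(3) den] 1(4,5) by auto
  note st = valid_start[OF v]
  have node: "?s \<in> code_nodes w" using st by (simp add: code_nodes_def)
  let ?u3 = "u2(24 := int (node_index w ?s))"
  let ?a3 = "a2(Mark := (a2 Mark)(node_index w ?s := 1))"
  have "exec w N (put_common 24 (Inp (Plus (Var 5) (Num 2))) (Inp (Var 5))) (u2, a2) = (?u3, a2)"
  proof (rule put_common[OF 2(2) f])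
    have "nat (int (mid_pos w) + 2) = mid_pos w + 2" by simp
    then show "aval w N a2 (Inp (Plus (Var 5) (Num 2))) (u2(24 := z)) = int (start_state w)" for z
      using 2(2) st(2) by (simp add: paramsD)
    show "aval w N a2 (Inp (Var 5)) (u2(24 := z)) = int (start_vert w)" for z
      using 2(2) st(1) by (simp add: paramsD)
  qed simp
  then have 3: "exec w N start_com (u2, a2) = (?u3, ?a3)" by (simp add: start_com_def del: node_index.simps)
  \<comment> \<open>The value of variable \<open>27\<close> is not known at this point, which is
    harmless because each round resets the flag.\<close>
  let ?b = "0 < ?u3 27"
  have "sim w [] (?u3, ?a3) ([?s \<mapsto> 0], ?b)"
    using 2 node by (auto simp: sim_def represents_def reward_table_def node_index_inj simp del: node_index.simps)
  note sim = sim_search[OF v f this, of any]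
  \<comment> \<open>The number of vertices is strictly below \<open>N ^ 6\<close>, hence at most
    \<open>K\<close>: the first \<open>K\<close> rounds build the labelling, and the last one is the
    test.\<close>
  define K where "K = N ^ 6 - 1"
  have K: "N ^ 6 = Suc K" "card (code_nodes w) \<le> K"
    using card_code_nodes[OF f] \<open>3 \<le> N\<close> by (auto simp: K_def)
  have "0 < fst (exec w N (search_com any) (?u3, ?a3)) 27 \<longleftrightarrow> snd ((bf_round (edge_list any w) ^^ Suc K) ([?s \<mapsto> 0], ?b))"
    using sim unfolding K(1) by (simp only: sim_def)
  also have "\<dots> \<longleftrightarrow> positive_walk (set (edge_list any w)) ?s"
    by (rule bellman_ford[OF edge_list_nodes[OF v] finite_code_nodes node K(2)])
  also have "\<dots> \<longleftrightarrow> positive_code any w"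
    by (simp add: set_edge_list[OF v] positive_code_def)
  finally have "0 < fst (exec w N (search_com any) (?u3, ?a3)) 27 \<longleftrightarrow> positive_code any w" .
  moreover have "fst (exec w N (main_com any) (u, a)) 0 =
      (if 0 < fst (exec w N (search_com any) (?u3, ?a3)) 27 then 0 else 1)"
    unfolding main_com_def by (simp add: 1(1) 2(1) 3)
  ultimately show ?thesis by simp
qed

text \<open>Whenever a check fails, variable \<open>0\<close> keeps its initial value
  \<open>0\<close>, which means rejection; this covers the sequences that represent no
  instance.\<close>

definition check_com :: "bool \<Rightarrow> bool \<Rightarrow> com" where
  "check_com any det = Seq head_com (Cond head_check (Seq mid_com
     (Cond (Conj mid_check (Conj content_check (if det then det_check else Num 1))) (main_com any) Skip)) Skip)"

lemma check_com:
  "0 < fst (exec w (input_size w) (check_com any det) start) 0 \<longleftrightarrow>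
    valid w \<and> (det \<longrightarrow> det_code w) \<and> \<not> positive_code any w"
proof -
  let ?N = "input_size w" and ?v = "\<lambda>_::nat. 0::int" and ?a = "\<lambda>_ _. 0 :: int"
  define s1 where "s1 = exec w ?N head_com (?v, ?a)"
  define s2 where "s2 = exec w ?N mid_com s1"
  note sh = shape_checks[where v = ?v and a = ?a, OF length_le_input_size[of w], folded s1_def s2_def]
  have e: "s1 = (fst s1, ?a)" "s2 = (fst s2, ?a)" using sh(1,3) by (metis prod.collapse)+
  have ex: "exec w ?N (check_com any det) start =
    (if 0 < aval w ?N ?a head_check (fst s1)
     then if 0 < aval w ?N ?a mid_check (fst s2) \<and> 0 < aval w ?N ?a content_check (fst s2) \<and>
            (det \<longrightarrow> 0 < aval w ?N ?a det_check (fst s2))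
          then exec w ?N (main_com any) (fst s2, ?a) else s2
     else s1)"
    using sh(1,3) e by (auto simp add: check_com_def start_def simp flip: s1_def s2_def)
  show ?thesis
  proof (cases "well_shaped w")
    case True
    note p = sh(6)[OF True]
    have f: "fits w ?N" using well_shaped_fits[OF True length_le_input_size] .
    have c: "0 < aval w ?N ?a content_check (fst s2) \<longleftrightarrow> well_formed w"
      "0 < aval w ?N ?a det_check (fst s2) \<longleftrightarrow> det_code w"
      using content_check[OF p f] det_check[OF p f] by simp_all
    have "exec w ?N (check_com any det) start =
      (if well_formed w \<and> (det \<longrightarrow> det_code w) then exec w ?N (main_com any) (fst s2, ?a) else s2)"
      using True sh(5) unfolding ex c by simp
    then show ?thesis
      using main_com[OF _ p, of ?a ?N any] True sh(4) by (simp add: valid_def)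
  next
    case False
    then show ?thesis
      using sh(2,4,5) unfolding ex by (auto simp: valid_def)
  qed
qed

theorem theorem26:
  shows "polynomial_time_decidable mp_nash_checking \<and>
    polynomial_time_decidable mp_deterministic_nash_checking \<and>
    polynomial_time_decidable mp_subgame_perfect_checking \<and>
    polynomial_time_decidable mp_deterministic_subgame_perfect_checking"
proof (intro conjI)
  show "polynomial_time_decidable mp_nash_checking"
    by (rule polynomial_time_decidable_exec[of _ "check_com False False"]) (simp add: check_com checking_problems)
  show "polynomial_time_decidable mp_deterministic_nash_checking"
    by (rule polynomial_time_decidable_exec[of _ "check_com False True"]) (simp add: check_com checking_problems)
  show "polynomial_time_decidable mp_subgame_perfect_checking"
    by (rule polynomial_time_decidable_exec[of _ "check_com True False"]) (simp add: check_com checking_problems)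
  show "polynomial_time_decidable mp_deterministic_subgame_perfect_checking"
    by (rule polynomial_time_decidable_exec[of _ "check_com True True"]) (simp add: check_com checking_problems)
qed

end
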